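(* Let $0\le k\le n$ and $f\in\widetilde S_n$. Then $G_{f,k}\ne0$ if and only if $f\in T\operatorname{Bound}(k,n)$.
   Context: $\widetilde S_n$: bijections $f:\mathbb{Z}\to\mathbb{Z}$ with $f(i+n)=f(i)+n$; $\tau(i)=i+1$, $T=\{\tau^j\}$; $s_i$ swaps $i+pn$ and $i+1+pn$ for all $p$; $\widetilde S^0_n=\langle s_0,\dots,s_{n-1}\rangle$; $f=\tau^{\operatorname{av}(f)}g$ uniquely with $g\in\widetilde S^0_n$. $\ell(f)=\#\{(i,j):1\le i\le n,\ i<j,\ f(i)>f(j)\}$. $\operatorname{Bound}(k,n)$: $f$ with $i\le f(i)\le i+n$ for all $i$ and exactly $k$ of $f(1),\dots,f(n)$ exceeding $n$; $T\operatorname{Bound}(k,n)=\{\tau^jg\}$. Affine Stanley symmetric function: $\widetilde F_f=\sum x_1^{\ell(f_1)}x_2^{\ell(f_2)}\cdots$ over factorizations $\tau^{-\operatorname{av}(f)}f=f_1f_2\cdots$ with $\sum\ell(f_i)=\ell(f)$ and each $f_i$ cyclically decreasing, i.e. equal to $s_{i_1}\cdots s_{i_m}$ for distinct $i_1,\dots,i_m\in\mathbb{Z}/n\mathbb{Z}$ such that whenever $j,j+1$ both occur, $j+1$ occurs first. $G_{f,k}$ is the image of $\widetilde F_f(x_1,\dots,x_k)$ in $\Lambda^{n-k}(k)=\mathbb{Z}[x_1,\dots,x_k]^{S_k}/\langle h_d(x_1,\dots,x_k): d>n-k\rangle$. *)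

theory Defs
  imports "HOL-Library.Poly_Mapping" "HOL-Combinatorics.Permutations" "HOL-Algebra.Algebra"
begin

subsection \<open>Affine permutations\<close>

definition affine_perms :: "nat \<Rightarrow> (int \<Rightarrow> int) set" where
  "affine_perms n = {f. bij f \<and> (\<forall>i. f (i + int n) = f i + int n)}"

definition affine_group :: "nat \<Rightarrow> (int \<Rightarrow> int) monoid" where
  "affine_group n = \<lparr>carrier = affine_perms n, monoid.mult = (\<circ>), one = id\<rparr>"

definition tau_pow :: "int \<Rightarrow> int \<Rightarrow> int" where
  "tau_pow j = (\<lambda>i. i + j)"

text \<open>For \<open>n = 1\<close> the residue classes of \<open>i\<close> and \<open>i + 1\<close> coincide, so there is no simple
  reflection; the value is then taken to be the identity, so that the subgroup generated
  by the simple reflections is trivial.\<close>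

definition simple_refl :: "nat \<Rightarrow> int \<Rightarrow> int \<Rightarrow> int" where
  "simple_refl n i = (\<lambda>x.
     if n = 1 then x
     else if x mod int n = i mod int n then x + 1
     else if x mod int n = (i + 1) mod int n then x - 1
     else x)"

definition affine_perms0 :: "nat \<Rightarrow> (int \<Rightarrow> int) set" where
  "affine_perms0 n = generate (affine_group n) (simple_refl n ` {0..<int n})"

definition av :: "nat \<Rightarrow> (int \<Rightarrow> int) \<Rightarrow> int" where
  "av n f = (THE j. \<exists>g\<in>affine_perms0 n. f = tau_pow j \<circ> g)"

definition affine_length :: "nat \<Rightarrow> (int \<Rightarrow> int) \<Rightarrow> nat" where
  "affine_length n f = card {(i, j). 1 \<le> i \<and> i \<le> int n \<and> i < j \<and> f i > f j}"

definition Bound :: "nat \<Rightarrow> nat \<Rightarrow> (int \<Rightarrow> int) set" where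
  "Bound k n = {f \<in> affine_perms n.
     (\<forall>i. i \<le> f i \<and> f i \<le> i + int n) \<and> card {i \<in> {1..int n}. f i > int n} = k}"

definition TBound :: "nat \<Rightarrow> nat \<Rightarrow> (int \<Rightarrow> int) set" where
  "TBound k n = {tau_pow j \<circ> g | j g. g \<in> Bound k n}"

subsection \<open>Affine Stanley symmetric functions\<close>

definition comp_list :: "(int \<Rightarrow> int) list \<Rightarrow> int \<Rightarrow> int" where
  "comp_list fs = foldr (\<circ>) fs id"

text \<open>Letters are the representatives \<open>0, \<dots>, n - 1\<close> of the residues modulo \<open>n\<close>.\<close>

definition cyc_decreasing :: "nat \<Rightarrow> (int \<Rightarrow> int) \<Rightarrow> bool" where
  "cyc_decreasing n f \<longleftrightarrow> (\<exists>w :: int list.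
     set w \<subseteq> {0..<int n} \<and> distinct w \<and>
     (\<forall>a < length w. \<forall>b < length w. w ! a = (w ! b + 1) mod int n \<longrightarrow> a < b) \<and>
     f = comp_list (map (simple_refl n) w))"

text \<open>The infinite product \<open>c 0 \<circ> c 1 \<circ> \<dots>\<close> has only finitely many nontrivial factors.\<close>

definition affine_factorization :: "nat \<Rightarrow> (int \<Rightarrow> int) \<Rightarrow> (nat \<Rightarrow> int \<Rightarrow> int) \<Rightarrow> bool" where
  "affine_factorization n f c \<longleftrightarrow>
     (\<forall>i. cyc_decreasing n (c i)) \<and>
     (\<exists>N. (\<forall>i\<ge>N. c i = id) \<and>
          comp_list (map c [0..<N]) = tau_pow (- av n f) \<circ> f \<and>
          (\<Sum>i<N. affine_length n (c i)) = affine_length n f)"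

text \<open>A formal power series in infinitely many variables is given by its coefficient function;
  an exponent vector \<open>\<alpha>\<close> stands for the product of the powers \<open>x\<^sub>i\<^sub>+\<^sub>1 ^ Poly_Mapping.lookup \<alpha> i\<close>.\<close>

definition affine_stanley :: "nat \<Rightarrow> (int \<Rightarrow> int) \<Rightarrow> (nat \<Rightarrow>\<^sub>0 nat) \<Rightarrow> int" where
  "affine_stanley n f \<alpha> =
     int (card {c. affine_factorization n f c \<and>
                   (\<forall>i. affine_length n (c i) = Poly_Mapping.lookup \<alpha> i)})"

subsection \<open>The quotient of the ring of symmetric polynomials\<close>

type_synonym int_mpoly = "(nat \<Rightarrow>\<^sub>0 nat) \<Rightarrow>\<^sub>0 int"

text \<open>Setting all variables but \<open>x\<^sub>1, \<dots>, x\<^sub>k\<close> to zero.  This yields a polynomial if the series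
  has bounded degree, see \<open>lookup_affine_stanley_poly\<close> below.\<close>

definition restrict_vars :: "nat \<Rightarrow> ((nat \<Rightarrow>\<^sub>0 nat) \<Rightarrow> int) \<Rightarrow> int_mpoly" where
  "restrict_vars k F = Abs_poly_mapping (\<lambda>\<alpha>. F \<alpha> when Poly_Mapping.keys \<alpha> \<subseteq> {..<k})"

definition affine_stanley_poly :: "nat \<Rightarrow> nat \<Rightarrow> (int \<Rightarrow> int) \<Rightarrow> int_mpoly" where
  "affine_stanley_poly n k f = restrict_vars k (affine_stanley n f)"

definition sym_polys :: "nat \<Rightarrow> int_mpoly set" where
  "sym_polys k = {p. (\<forall>\<alpha>\<in>Poly_Mapping.keys p. Poly_Mapping.keys \<alpha> \<subseteq> {..<k}) \<and>
     (\<forall>\<pi>. \<pi> permutes {..<k} \<longrightarrow> (\<forall>\<alpha>. Poly_Mapping.lookup p (Poly_Mapping.map_key \<pi> \<alpha>) = Poly_Mapping.lookup p \<alpha>))}"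

definition sym_ring :: "nat \<Rightarrow> int_mpoly ring" where
  "sym_ring k = \<lparr>carrier = sym_polys k, monoid.mult = (*), one = 1, ring.zero = 0, ring.add = (+)\<rparr>"

definition complete_hom :: "nat \<Rightarrow> nat \<Rightarrow> int_mpoly" where
  "complete_hom k d =
     (\<Sum>\<alpha> | Poly_Mapping.keys \<alpha> \<subseteq> {..<k} \<and> (\<Sum>i<k. Poly_Mapping.lookup \<alpha> i) = d. Poly_Mapping.single \<alpha> 1)"

definition Lambda_ideal :: "nat \<Rightarrow> nat \<Rightarrow> int_mpoly set" where
  "Lambda_ideal m k = genideal (sym_ring k) {complete_hom k d | d. d > m}"

definition Lambda_ring :: "nat \<Rightarrow> nat \<Rightarrow> int_mpoly set ring" where
  "Lambda_ring m k = sym_ring k Quot Lambda_ideal m k"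

definition G_class :: "nat \<Rightarrow> (int \<Rightarrow> int) \<Rightarrow> nat \<Rightarrow> int_mpoly set" where
  "G_class n f k = Lambda_ideal (n - k) k +>\<^bsub>sym_ring k\<^esub> affine_stanley_poly n k f"

subsection \<open>Well-definedness\<close>

lemma group_affine_group: "group (affine_group n)"
proof (rule groupI)
  fix f assume f: "f \<in> carrier (affine_group n)"
  then have b: "bij f" and p: "\<And>i. f (i + int n) = f i + int n"
    by (auto simp: affine_group_def affine_perms_def)
  have "inv_into UNIV f (i + int n) = inv_into UNIV f i + int n" for i
    using p[of "inv_into UNIV f i"] b
    by (metis bij_inv_eq_iff)
  then have "inv_into UNIV f \<in> affine_perms n"
    using b by (simp add: affine_perms_def bij_imp_bij_inv)
  then show "\<exists>g\<in>carrier (affine_group n). g \<otimes>\<^bsub>affine_group n\<^esub> f = \<one>\<^bsub>affine_group n\<^esub>"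
    using b by (intro bexI[of _ "inv_into UNIV f"]) (auto simp: affine_group_def bij_is_inj)
qed (auto simp: affine_group_def affine_perms_def bij_comp o_assoc)

lemma simple_refl_affine_perm:
  assumes "0 < n"
  shows "simple_refl n i \<in> affine_perms n"
proof (cases "n = 1")
  case True
  then show ?thesis by (auto simp: simple_refl_def affine_perms_def bij_def)
next
  case False
  then have n: "int n > 1" using assms by simp
  have ne: "(y + 1) mod int n \<noteq> y mod int n" for y
  proof
    assume "(y + 1) mod int n = y mod int n"
    then have "int n dvd (y + 1) - y" by (simp only: mod_eq_dvd_iff)
    then show False using n by simp
  qed
  have s1: "(x - 1) mod int n = i mod int n" if "x mod int n = (i + 1) mod int n" for x
    using that by (simp add: mod_eq_dvd_iff algebra_simps)
  have s2: "(x + 1) mod int n = (i + 1) mod int n" if "x mod int n = i mod int n" for x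
    using that by (rule mod_add_cong) simp
  have "simple_refl n i (simple_refl n i x) = x" for x
    using False s1[of x] s2[of x] ne[of i] by (auto simp: simple_refl_def)
  then have "bij (simple_refl n i)" by (rule involuntory_imp_bij)
  then show ?thesis using False
    by (auto simp: affine_perms_def simple_refl_def)
qed

lemma sym_polys_mult:
  assumes "p \<in> sym_polys k" and "q \<in> sym_polys k"
  shows "p * q \<in> sym_polys k"
  unfolding sym_polys_def
proof (clarify, intro conjI ballI allI impI)
  fix \<alpha> assume "\<alpha> \<in> Poly_Mapping.keys (p * q)"
  then obtain a b where "\<alpha> = a + b" "a \<in> Poly_Mapping.keys p" "b \<in> Poly_Mapping.keys q"
    using keys_mult[of p q] by blast
  then show "Poly_Mapping.keys \<alpha> \<subseteq> {..<k}"
    using assms Poly_Mapping.keys_add[of a b] unfolding sym_polys_def by blast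
next
  fix \<pi> \<alpha> assume \<pi>: "\<pi> permutes {..<k}"
  let ?m = "Poly_Mapping.map_key \<pi> :: (nat \<Rightarrow>\<^sub>0 nat) \<Rightarrow> _"
  let ?m' = "Poly_Mapping.map_key (inv_into UNIV \<pi>) :: (nat \<Rightarrow>\<^sub>0 nat) \<Rightarrow> _"
  have i: "inj \<pi>" "inj (inv_into UNIV \<pi>)"
    using \<pi> permutes_inj permutes_inv by blast+
  have 1: "?m (?m' \<beta>) = \<beta>" "?m' (?m \<beta>) = \<beta>" for \<beta>
    using \<pi> by (auto simp: poly_mapping_eq_iff map_key.rep_eq i o_def permutes_inverses)
  have b: "bij ?m"
    using 1 by (intro o_bij[of ?m']) (auto simp: fun_eq_iff)
  have p: "Poly_Mapping.lookup p (?m \<beta>) = Poly_Mapping.lookup p \<beta>"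
    and q: "Poly_Mapping.lookup q (?m \<beta>) = Poly_Mapping.lookup q \<beta>" for \<beta>
    using assms \<pi> unfolding sym_polys_def by auto
  have e: "?m \<alpha> = ?m l + ?m r \<longleftrightarrow> \<alpha> = l + r" for l r
    using bij_is_inj[OF b] by (simp add: map_key_plus[OF i(1), symmetric] inj_eq)
  have re: "Sum_any g = Sum_any (\<lambda>x. g (?m x))" for g :: "(nat \<Rightarrow>\<^sub>0 nat) \<Rightarrow> int"
    using b by (intro Sum_any.reindex_cong[of ?m]) (auto simp: bij_def)
  show "Poly_Mapping.lookup (p * q) (?m \<alpha>) = Poly_Mapping.lookup (p * q) \<alpha>"
    unfolding lookup_mult
    by (subst re, subst (2) re) (simp add: p q e)
qed

lemma sym_ring_cring: "cring (sym_ring k)"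
proof (rule cringI)
  show "abelian_group (sym_ring k)"
  proof (rule abelian_groupI)
    fix p assume "p \<in> carrier (sym_ring k)"
    then have "- p \<in> carrier (sym_ring k)"
      by (auto simp: sym_ring_def sym_polys_def)
    then show "\<exists>q\<in>carrier (sym_ring k). q \<oplus>\<^bsub>sym_ring k\<^esub> p = \<zero>\<^bsub>sym_ring k\<^esub>"
      by (rule bexI[rotated]) (simp add: sym_ring_def)
  next
    fix p q assume "p \<in> carrier (sym_ring k)" "q \<in> carrier (sym_ring k)"
    then have p: "p \<in> sym_polys k" and q: "q \<in> sym_polys k"
      by (simp_all add: sym_ring_def)
    have "Poly_Mapping.keys \<alpha> \<subseteq> {..<k}" if "\<alpha> \<in> Poly_Mapping.keys (p + q)" for \<alpha>
      using that p q Poly_Mapping.keys_add[of p q] unfolding sym_polys_def by blast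
    then show "p \<oplus>\<^bsub>sym_ring k\<^esub> q \<in> carrier (sym_ring k)"
      using p q by (simp add: sym_ring_def sym_polys_def lookup_add)
  qed (auto simp: sym_ring_def sym_polys_def algebra_simps)
  have "Poly_Mapping.map_key \<pi> \<alpha> = 0 \<longleftrightarrow> \<alpha> = 0"
    if "\<pi> permutes {..<k}" for \<pi> and \<alpha> :: "nat \<Rightarrow>\<^sub>0 nat"
  proof -
    have "inj \<pi>" "surj \<pi>" using that permutes_inj permutes_surj by blast+
    then show ?thesis
      by (auto simp: poly_mapping_eq_iff map_key.rep_eq fun_eq_iff) (metis surjD)
  qed
  then have "1 \<in> sym_polys k"
    by (auto simp: sym_polys_def lookup_one)
  then show "comm_monoid (sym_ring k)"
    by (intro comm_monoidI) (auto simp: sym_ring_def sym_polys_mult mult_ac)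
qed (auto simp: sym_ring_def algebra_simps)

lemma finite_exponents:
  "finite {\<alpha> :: nat \<Rightarrow>\<^sub>0 nat. Poly_Mapping.keys \<alpha> \<subseteq> {..<k} \<and> (\<Sum>i<k. Poly_Mapping.lookup \<alpha> i) = d}" (is "finite ?A")
proof -
  have "Poly_Mapping.lookup ` ?A \<subseteq> {g. \<forall>i. (i \<in> {..<k} \<longrightarrow> g i \<in> {..d}) \<and> (i \<notin> {..<k} \<longrightarrow> g i = 0)}"
  proof (clarify, intro conjI impI)
    fix \<alpha> :: "nat \<Rightarrow>\<^sub>0 nat" and i
    assume *: "Poly_Mapping.keys \<alpha> \<subseteq> {..<k}"
    show "Poly_Mapping.lookup \<alpha> i \<in> {..\<Sum>i<k. Poly_Mapping.lookup \<alpha> i}" if "i \<in> {..<k}"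
      using that member_le_sum[of i "{..<k}" "Poly_Mapping.lookup \<alpha>"] by simp
    show "Poly_Mapping.lookup \<alpha> i = 0" if "i \<notin> {..<k}"
      using that * by (meson in_keys_iff subsetD)
  qed
  then have "finite (Poly_Mapping.lookup ` ?A)"
    by (rule finite_subset) (rule finite_set_of_finite_funs; simp)
  then show ?thesis
    by (rule finite_imageD) (rule inj_onI, simp only: poly_mapping.lookup_inject)
qed

lemma complete_hom_sym: "complete_hom k d \<in> sym_polys k"
proof -
  let ?A = "{\<alpha> :: nat \<Rightarrow>\<^sub>0 nat. Poly_Mapping.keys \<alpha> \<subseteq> {..<k} \<and> (\<Sum>i<k. Poly_Mapping.lookup \<alpha> i) = d}"
  have l: "Poly_Mapping.lookup (complete_hom k d) \<alpha> = (1 when \<alpha> \<in> ?A)" for \<alpha>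
    unfolding complete_hom_def using finite_exponents[of k d]
    by (simp add: lookup_sum lookup_single when_def)
  have "Poly_Mapping.map_key \<pi> \<alpha> \<in> ?A \<longleftrightarrow> \<alpha> \<in> ?A" if \<pi>: "\<pi> permutes {..<k}" for \<pi> \<alpha>
  proof -
    have i: "inj \<pi>" using \<pi> permutes_inj by blast
    have "(\<Sum>i<k. Poly_Mapping.lookup (Poly_Mapping.map_key \<pi> \<alpha>) i) = (\<Sum>i<k. Poly_Mapping.lookup \<alpha> i)"
      using sum.permute[OF \<pi>, of "Poly_Mapping.lookup \<alpha>"] by (simp add: map_key.rep_eq i o_def)
    moreover have "\<pi> -` B \<subseteq> {..<k} \<longleftrightarrow> B \<subseteq> {..<k}" for B :: "nat set"
      using permutes_surj[OF \<pi>] permutes_in_image[OF \<pi>] by (auto simp: subset_iff) (metis surjD)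
    ultimately show ?thesis by (simp add: keys_map_key[OF i])
  qed
  moreover have "Poly_Mapping.keys \<alpha> \<subseteq> {..<k}"
    if "\<alpha> \<in> Poly_Mapping.keys (complete_hom k d)" for \<alpha>
    using that unfolding in_keys_iff l by (simp split: if_splits add: when_def)
  ultimately show ?thesis
    unfolding sym_polys_def by (simp add: l)
qed

lemma affine_stanley_degree:
  assumes "affine_stanley n f \<alpha> \<noteq> 0" and "Poly_Mapping.keys \<alpha> \<subseteq> {..<k}"
  shows "(\<Sum>i<k. Poly_Mapping.lookup \<alpha> i) = affine_length n f"
proof -
  from assms(1) obtain c where c: "affine_factorization n f c"
      and l: "\<And>i. affine_length n (c i) = Poly_Mapping.lookup \<alpha> i"
    unfolding affine_stanley_def by (metis (mono_tags, lifting) card.empty empty_Collect_eq of_nat_0)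
  from c obtain N where N: "\<forall>i\<ge>N. c i = id"
      and s: "(\<Sum>i<N. Poly_Mapping.lookup \<alpha> i) = affine_length n f"
    unfolding affine_factorization_def l by blast
  have "{(i, j). 1 \<le> i \<and> i \<le> int n \<and> i < j \<and> id i > id j} = {}"
    by auto
  then have id0: "affine_length n id = 0"
    unfolding affine_length_def by (simp only: card.empty)
  have "(\<Sum>i<k. Poly_Mapping.lookup \<alpha> i) = (\<Sum>i<max k N. Poly_Mapping.lookup \<alpha> i)"
    using assms(2) by (intro sum.mono_neutral_left) (auto simp: subset_iff in_keys_iff)
  also have "\<dots> = (\<Sum>i<N. Poly_Mapping.lookup \<alpha> i)"
    using N by (intro sum.mono_neutral_right) (auto simp flip: l simp: id0)
  finally show ?thesis using s by simp
qed

lemma lookup_affine_stanley_poly: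
  "Poly_Mapping.lookup (affine_stanley_poly n k f) \<alpha> = (affine_stanley n f \<alpha> when Poly_Mapping.keys \<alpha> \<subseteq> {..<k})"
proof -
  have "{\<alpha>. (affine_stanley n f \<alpha> when Poly_Mapping.keys \<alpha> \<subseteq> {..<k}) \<noteq> 0}
      \<subseteq> {\<alpha>. Poly_Mapping.keys \<alpha> \<subseteq> {..<k} \<and> (\<Sum>i<k. Poly_Mapping.lookup \<alpha> i) = affine_length n f}"
    using affine_stanley_degree by (auto simp: when_def split: if_splits)
  then have "finite {\<alpha>. (affine_stanley n f \<alpha> when Poly_Mapping.keys \<alpha> \<subseteq> {..<k}) \<noteq> 0}"
    using finite_exponents finite_subset by blast
  then show ?thesis
    unfolding affine_stanley_poly_def restrict_vars_def by (simp add: Abs_poly_mapping_inverse)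
qed

end

theory Submission
  imports Defs "Jordan_Normal_Form.Determinant" "HOL-Computational_Algebra.Formal_Power_Series"
begin

text \<open>
  Cyclically decreasing elements of length \<open>r\<close> correspond to the nonempty subsets of \<open>\<int>/n\<close> of size \<open>n - r\<close>,
  and the sums \<open>U r\<close> of all such elements in the affine nil-Coxeter algebra commute, which makes the affine
  Stanley functions symmetric.

  A symmetric polynomial \<open>p\<close> lies in the ideal generated by the \<open>h\<^sub>d\<close> with \<open>d > n - k\<close> if and only if every
  monomial of \<open>p\<close> times the Vandermonde determinant has an exponent \<open>\<ge> n\<close>; this follows from the
  Jacobi--Trudi identity.  The remaining coefficients for the affine Stanley polynomial of \<open>w\<close> are minors
  of a Toeplitz matrix in the \<open>U r\<close>.  The inverse matrix contains the sums of the inverses of cyclically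
  decreasing elements, so that the minors can be expanded in two ways.  Expanding in the \<open>k\<close> rows shows that
  they vanish unless \<open>w x \<ge> x - k\<close> for all \<open>x\<close>, and expanding in the \<open>n - k\<close> complementary rows of the inverse
  matrix that they vanish unless \<open>w x \<le> x + n - k\<close>.

  Conversely, if \<open>w\<close> satisfies both bounds and is not extremal, it has a cover in the Bruhat order that
  satisfies them too.  The Chevalley rule writes \<open>e\<^sub>1\<close> times the polynomial of \<open>w\<close>, modulo the ideal, as a
  nonnegative combination of the polynomials of the covers of \<open>w\<close>, with positive coefficient at any
  prescribed cover.  By induction some \<open>e\<^sub>1\<close>-power multiple of the polynomial of \<open>w\<close> has a positive
  coefficient at the rectangular Schur polynomial, once this is known for the extremal \<open>w\<close>, which are the
  translations with \<open>w x \<in> {x - k, x + n - k}\<close> for all \<open>x\<close>.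
\<close>

section \<open>Affine permutations and their length\<close>

locale affine =
  fixes n :: nat
  assumes n_pos: "0 < n"
begin

abbreviation N :: int where "N \<equiv> int n"
abbreviation P :: "(int \<Rightarrow> int) set" where "P \<equiv> affine_perms n"
abbreviation len :: "(int \<Rightarrow> int) \<Rightarrow> nat" where "len \<equiv> affine_length n"

abbreviation iv :: "(int \<Rightarrow> int) \<Rightarrow> int \<Rightarrow> int" where "iv f \<equiv> inv_into UNIV f"

lemma N_pos: "0 < N" using n_pos by simp

lemma P_bij: "f \<in> P \<Longrightarrow> bij f"
  by (simp add: affine_perms_def)

lemma P_inj: "f \<in> P \<Longrightarrow> f x = f y \<longleftrightarrow> x = y"
  using P_bij bij_is_inj inj_eq by metis

lemma P_shift: "f \<in> P \<Longrightarrow> f (x + N) = f x + N"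
  by (simp add: affine_perms_def)

lemma P_shift_mult: assumes "f \<in> P" shows "f (x + q * N) = f x + q * N"
proof (induction q rule: int_induct[where k=0])
  case (step1 i)
  then show ?case using P_shift[OF assms, of "x + i * N"] by (simp add: algebra_simps)
next
  case (step2 i)
  then show ?case using P_shift[OF assms, of "x + i * N - N"] by (simp add: algebra_simps)
qed simp

lemma P_comp: "f \<in> P \<Longrightarrow> g \<in> P \<Longrightarrow> f \<circ> g \<in> P"
  by (auto simp: affine_perms_def bij_comp)

lemma P_id: "id \<in> P"
  by (auto simp: affine_perms_def)

lemma P_tau: "tau_pow j \<in> P"
  unfolding affine_perms_def tau_pow_def
  by (auto intro!: o_bij[of "\<lambda>i. i - j"] simp: fun_eq_iff)

lemma P_inv: assumes "f \<in> P" shows "iv f \<in> P"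
proof -
  have "iv f (x + N) = iv f x + N" for x
    using P_shift[OF assms, of "iv f x"] P_bij[OF assms] by (metis bij_inv_eq_iff)
  then show ?thesis using P_bij[OF assms] by (simp add: affine_perms_def bij_imp_bij_inv)
qed

lemma inv_P_app [simp]: "f \<in> P \<Longrightarrow> iv f (f x) = x" "f \<in> P \<Longrightarrow> f (iv f x) = x"
  using P_bij bij_inv_eq_iff by metis+

lemma inv_P_comp: "f \<in> P \<Longrightarrow> iv f \<circ> f = id" "f \<in> P \<Longrightarrow> f \<circ> iv f = id"
  by (auto simp: fun_eq_iff)

lemma mod_eqE: assumes "x mod N = a mod N" obtains r where "x = a + r * N"
proof -
  have "x = a + (x div N - a div N) * N"
    using assms div_mult_mod_eq[of x N] div_mult_mod_eq[of a N] unfolding left_diff_distrib by linarith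
  then show ?thesis using that by blast
qed

lemma P_mod_eq_iff:
  assumes "f \<in> P" shows "f x mod N = f y mod N \<longleftrightarrow> x mod N = y mod N"
proof -
  have *: "g x mod N = g y mod N" if "x mod N = y mod N" "g \<in> P" for g x y
  proof -
    from that(1) obtain q where "x = y + q * N" by (rule mod_eqE)
    then show ?thesis using P_shift_mult[OF that(2), of y q] by simp
  qed
  show ?thesis using *[of x y f] *[of "f x" "f y" "iv f"] assms P_inv[OF assms] by auto
qed

lemma periodic_bounded:
  fixes g :: "int \<Rightarrow> int"
  assumes "\<And>x. g (x + N) = g x" shows "\<exists>K\<ge>0. \<forall>x. \<bar>g x\<bar> \<le> K"
proof -
  have g: "g (x + q * N) = g x" for x q
  proof (induction q rule: int_induct[where k=0])
    case (step1 i)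
    then show ?case using assms[of "x + i * N"] by (simp add: algebra_simps)
  next
    case (step2 i)
    then show ?case using assms[of "x + i * N - N"] by (simp add: algebra_simps)
  qed simp
  have 1: "g x = g (x mod N)" for x
    using g[of "x mod N" "x div N"] by simp
  have "\<bar>g x\<bar> \<le> Max ((\<lambda>x. \<bar>g x\<bar>) ` {0..<N})" for x
    unfolding 1[of x] using N_pos by (intro Max_ge) auto
  moreover have "0 \<le> Max ((\<lambda>x. \<bar>g x\<bar>) ` {0..<N})"
    using calculation[of 0] by linarith
  ultimately show ?thesis by blast
qed

lemma P_bounded: assumes "f \<in> P" shows "\<exists>K\<ge>0. \<forall>x. \<bar>f x - x\<bar> \<le> K"
  using periodic_bounded[of "\<lambda>x. f x - x"] P_shift[OF assms] by simp

subsection \<open>Counting pairs modulo a simultaneous shift\<close>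

definition shift_inv :: "(int \<times> int) set \<Rightarrow> bool" where
  "shift_inv A \<longleftrightarrow> (\<forall>i j q. (i, j) \<in> A \<longrightarrow> (i + q * N, j + q * N) \<in> A)"

definition reps :: "(int \<times> int) set \<Rightarrow> (int \<times> int) set" where
  "reps A = {(i, j) \<in> A. 1 \<le> i \<and> i \<le> N}"

definition pair_count :: "(int \<times> int) set \<Rightarrow> nat" where
  "pair_count A = card (reps A)"

definition equivar :: "(int \<times> int \<Rightarrow> int \<times> int) \<Rightarrow> bool" where
  "equivar \<phi> \<longleftrightarrow> (\<forall>i j q. \<phi> (i + q * N, j + q * N) = (fst (\<phi> (i, j)) + q * N, snd (\<phi> (i, j)) + q * N))"

definition norm_pair :: "int \<times> int \<Rightarrow> int \<times> int" where
  "norm_pair p = (fst p - (fst p - 1) div N * N, snd p - (fst p - 1) div N * N)"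

lemma norm_pair_range: "1 \<le> fst (norm_pair p)" "fst (norm_pair p) \<le> N"
proof -
  have "fst (norm_pair p) = (fst p - 1) mod N + 1"
    by (simp add: norm_pair_def minus_div_mult_eq_mod[symmetric])
  then show "1 \<le> fst (norm_pair p)" "fst (norm_pair p) \<le> N"
    using pos_mod_bound[OF N_pos, of "fst p - 1"] pos_mod_sign[OF N_pos, of "fst p - 1"] by linarith+
qed

lemma norm_pair_in: "shift_inv A \<Longrightarrow> p \<in> A \<Longrightarrow> norm_pair p \<in> reps A"
proof -
  assume A: "shift_inv A" "p \<in> A"
  obtain i j where p: "p = (i, j)" by (cases p)
  have "(i + - ((i - 1) div N) * N, j + - ((i - 1) div N) * N) \<in> A"
    using A p unfolding shift_inv_def by blast
  then have "norm_pair p \<in> A" by (simp add: norm_pair_def p)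
  then show ?thesis using norm_pair_range[of p] by (auto simp: reps_def case_prod_beta)
qed

lemma norm_pair_eqD:
  assumes "norm_pair (i, j) = norm_pair (i', j')"
  shows "\<exists>q. i = i' + q * N \<and> j = j' + q * N"
  using assms unfolding norm_pair_def
  by (intro exI[of _ "(i - 1) div N - (i' - 1) div N"]) (auto simp: algebra_simps)

lemma rep_shift_zero: assumes "1 \<le> i" "i \<le> N" "1 \<le> i + q * N" "i + q * N \<le> N" shows "q = 0"
proof -
  have "\<not> q \<ge> 1"
  proof
    assume "q \<ge> 1" then have "q * N \<ge> 1 * N" using N_pos by (intro mult_right_mono) auto
    then show False using assms by linarith
  qed
  moreover have "\<not> q \<le> - 1"
  proof
    assume "q \<le> - 1" then have "q * N \<le> (- 1) * N" using N_pos by (intro mult_right_mono) auto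
    then show False using assms by linarith
  qed
  ultimately show ?thesis by linarith
qed

lemma pair_count_inj:
  assumes A: "shift_inv A" and B: "shift_inv B" and e: "equivar \<phi>" and inj: "inj_on \<phi> A"
    and sub: "\<phi> ` A \<subseteq> B" and fin: "finite (reps B)"
  shows "finite (reps A)" "pair_count A \<le> pair_count B"
proof -
  have i: "inj_on (norm_pair \<circ> \<phi>) (reps A)"
  proof (rule inj_onI)
    fix p p' assume p: "p \<in> reps A" and p': "p' \<in> reps A" and eq: "(norm_pair \<circ> \<phi>) p = (norm_pair \<circ> \<phi>) p'"
    obtain i j where ij: "p = (i, j)" by (cases p)
    obtain i' j' where ij': "p' = (i', j')" by (cases p')
    obtain a b where ab: "\<phi> p = (a, b)" by (cases "\<phi> p")
    obtain a' b' where ab': "\<phi> p' = (a', b')" by (cases "\<phi> p'")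
    from norm_pair_eqD[of a b a' b'] eq ab ab' obtain q where q: "a = a' + q * N" "b = b' + q * N" by auto
    have "\<phi> (i' + q * N, j' + q * N) = \<phi> p"
      using e ab ab' ij' q unfolding equivar_def by auto
    moreover have "(i' + q * N, j' + q * N) \<in> A" "p \<in> A"
      using A p p' ij ij' unfolding shift_inv_def reps_def by auto
    ultimately have *: "(i' + q * N, j' + q * N) = p" using inj by (meson inj_onD)
    then have "q = 0" using p p' ij ij' rep_shift_zero[of i' q] unfolding reps_def by auto
    then show "p = p'" using * ij' by simp
  qed
  have s: "(norm_pair \<circ> \<phi>) ` reps A \<subseteq> reps B"
  proof
    fix p assume "p \<in> (norm_pair \<circ> \<phi>) ` reps A"
    then obtain a where "a \<in> A" "p = norm_pair (\<phi> a)" by (auto simp: reps_def)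
    then show "p \<in> reps B" using sub norm_pair_in[OF B] by blast
  qed
  show "finite (reps A)" using inj_on_finite[OF i s fin] .
  show "pair_count A \<le> pair_count B" unfolding pair_count_def using card_inj_on_le[OF i s fin] .
qed

lemma pair_count_bij:
  assumes A: "shift_inv A" and B: "shift_inv B" and e: "equivar \<phi>" and e': "equivar \<psi>"
    and ab: "\<And>p. p \<in> A \<Longrightarrow> \<phi> p \<in> B \<and> \<psi> (\<phi> p) = p" and ba: "\<And>p. p \<in> B \<Longrightarrow> \<psi> p \<in> A \<and> \<phi> (\<psi> p) = p"
    and fin: "finite (reps B)"
  shows "pair_count A = pair_count B"
proof (rule antisym)
  have i: "inj_on \<phi> A" "inj_on \<psi> B" using ab ba by (metis inj_onI)+
  have s: "\<phi> ` A \<subseteq> B" "\<psi> ` B \<subseteq> A" using ab ba by auto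
  show "pair_count A \<le> pair_count B" using pair_count_inj(2)[OF A B e i(1) s(1) fin] .
  show "pair_count B \<le> pair_count A" using pair_count_inj(2)[OF B A e' i(2) s(2) pair_count_inj(1)[OF A B e i(1) s(1) fin]] .
qed

lemma reps_Un: "reps (A \<union> B) = reps A \<union> reps B" by (auto simp: reps_def)

lemma pair_count_Un: "finite (reps A) \<Longrightarrow> finite (reps B) \<Longrightarrow> A \<inter> B = {} \<Longrightarrow> pair_count (A \<union> B) = pair_count A + pair_count B"
  unfolding pair_count_def reps_Un by (intro card_Un_disjoint) (auto simp: reps_def)

definition Inv :: "(int \<Rightarrow> int) \<Rightarrow> (int \<times> int) set" where
  "Inv f = {(i, j). i < j \<and> f i > f j}"

lemma len_pair_count: "len f = pair_count (Inv f)"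
  unfolding affine_length_def pair_count_def reps_def Inv_def by (rule arg_cong[where f=card]) auto

lemma shift_inv_Inv: "f \<in> P \<Longrightarrow> shift_inv (Inv f)"
  by (auto simp: shift_inv_def Inv_def P_shift_mult)

lemma finite_Inv: assumes "f \<in> P" shows "finite (reps (Inv f))"
proof -
  obtain K where K: "\<And>x. \<bar>f x - x\<bar> \<le> K" using P_bounded[OF assms] by blast
  have "reps (Inv f) \<subseteq> {1..N} \<times> {1..N + 2 * K}"
  proof
    fix p assume "p \<in> reps (Inv f)"
    then obtain i j where p: "p = (i, j)" "1 \<le> i" "i \<le> N" "i < j" "f i > f j"
      by (auto simp: reps_def Inv_def)
    then show "p \<in> {1..N} \<times> {1..N + 2 * K}" using K[of i] K[of j] by auto
  qed
  then show ?thesis by (rule finite_subset) simp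
qed

lemma len_mult:
  assumes u: "u \<in> P" and v: "v \<in> P"
  defines "XX \<equiv> {(i, j). i < j \<and> v i > v j \<and> u (v i) < u (v j)}"
  shows "len (u \<circ> v) + 2 * pair_count XX = len u + len v" "finite (reps XX)"
proof -
  define Y where "Y = {(i, j). i < j \<and> v i > v j \<and> u (v i) > u (v j)}"
  define Z where "Z = {(i, j). i < j \<and> v i < v j \<and> u (v i) > u (v j)}"
  have uv: "u \<circ> v \<in> P" using P_comp u v by blast
  have sX: "shift_inv XX" and sY: "shift_inv Y" and sZ: "shift_inv Z"
    by (auto simp: shift_inv_def XX_def Y_def Z_def P_shift_mult u v)
  have 1: "Inv v = XX \<union> Y" "XX \<inter> Y = {}" 
    using P_inj[OF u] P_inj[OF v] unfolding Inv_def XX_def Y_def by (auto simp: neq_iff not_less order.order_iff_strict)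
  have 2: "Inv (u \<circ> v) = Y \<union> Z" "Y \<inter> Z = {}" 
    using P_inj[OF u] P_inj[OF v] unfolding Inv_def Z_def Y_def by (auto simp: neq_iff not_less order.order_iff_strict)
  have f: "finite (reps XX)" "finite (reps Y)" "finite (reps Z)"
    using finite_Inv[OF v] finite_Inv[OF uv] unfolding 1 2 reps_Un by auto
  then show "finite (reps XX)" by simp
  define XX' where "XX' = (\<lambda>(i, j). (j, i)) ` XX"
  have XX': "XX' = {(j, i). i < j \<and> v i > v j \<and> u (v i) < u (v j)}"
    by (auto simp: XX'_def XX_def image_def)
  have sX': "shift_inv XX'" by (auto simp: shift_inv_def XX' P_shift_mult u v)
  have cX: "pair_count XX' = pair_count XX"
    by (rule pair_count_bij[OF sX' sX _ _ _ _ f(1), of "\<lambda>(i, j). (j, i)" "\<lambda>(i, j). (j, i)"])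
       (auto simp: equivar_def XX'_def)
  have fX': "finite (reps XX')"
    by (rule pair_count_inj(1)[OF sX' sX _ _ _ f(1), of "\<lambda>(i, j). (j, i)"]) (auto simp: equivar_def XX'_def inj_on_def)
  have "pair_count (XX' \<union> Z) = pair_count (Inv u)"
  proof (rule pair_count_bij[OF _ shift_inv_Inv[OF u] _ _ _ _ finite_Inv[OF u],
        of _ "\<lambda>(i, j). (v i, v j)" "\<lambda>(i, j). (iv v i, iv v j)"])
    show "shift_inv (XX' \<union> Z)" using sX' sZ by (auto simp: shift_inv_def)
    show "equivar (\<lambda>(i, j). (v i, v j))" "equivar (\<lambda>(i, j). (iv v i, iv v j))"
      by (auto simp: equivar_def P_shift_mult[OF v] P_shift_mult[OF P_inv[OF v]])
    fix p assume "p \<in> Inv u"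
    then obtain i j where p: "p = (i, j)" "i < j" "u i > u j" by (auto simp: Inv_def)
    have "iv v i \<noteq> iv v j" using p(2) v by (metis inv_P_app(2) less_irrefl)
    then show "(case p of (i, j) \<Rightarrow> (iv v i, iv v j)) \<in> XX' \<union> Z
      \<and> (case case p of (i, j) \<Rightarrow> (iv v i, iv v j) of (i, j) \<Rightarrow> (v i, v j)) = p"
      using p v by (auto simp: XX' Z_def)
  next
    fix p assume p: "p \<in> XX' \<union> Z"
    obtain i j where ij: "p = (i, j)" by (cases p)
    have "v i < v j \<and> u (v i) > u (v j)" using p ij by (auto simp: XX' Z_def)
    then show "(case p of (i, j) \<Rightarrow> (v i, v j)) \<in> Inv u
      \<and> (case case p of (i, j) \<Rightarrow> (v i, v j) of (i, j) \<Rightarrow> (iv v i, iv v j)) = p"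
      using ij v by (auto simp: Inv_def)
  qed
  moreover have "pair_count (XX' \<union> Z) = pair_count XX' + pair_count Z"
  proof (rule pair_count_Un[OF fX' f(3)])
    show "XX' \<inter> Z = {}" unfolding XX' Z_def by force
  qed
  moreover have "len v = pair_count XX + pair_count Y" unfolding len_pair_count 1(1) by (rule pair_count_Un[OF f(1,2) 1(2)])
  moreover have "len (u \<circ> v) = pair_count Y + pair_count Z" unfolding len_pair_count 2(1) by (rule pair_count_Un[OF f(2,3) 2(2)])
  ultimately show "len (u \<circ> v) + 2 * pair_count XX = len u + len v"
    unfolding len_pair_count[of u] using cX by linarith
qed

lemma len_mult_le: "u \<in> P \<Longrightarrow> v \<in> P \<Longrightarrow> len (u \<circ> v) \<le> len u + len v"
  using len_mult(1)[of u v] by linarith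

lemma pair_count_eq_0: assumes "shift_inv A" "finite (reps A)" "pair_count A = 0" shows "A = {}"
  using assms norm_pair_in[OF assms(1)] by (auto simp: pair_count_def)

lemma additiveD:
  assumes "u \<in> P" "v \<in> P" "len (u \<circ> v) = len u + len v" "i < j" "v i > v j"
  shows "u (v i) > u (v j)"
proof (rule ccontr)
  let ?XX = "{(i, j). i < j \<and> v i > v j \<and> u (v i) < u (v j)}"
  assume "\<not> ?thesis"
  then have "(i, j) \<in> ?XX" using assms P_inj[OF assms(1)] P_inj[OF assms(2)]
    by (auto simp: neq_iff not_less le_less)
  moreover have "?XX = {}"
    using len_mult[OF assms(1,2)] assms(3)
    by (intro pair_count_eq_0) (auto simp: shift_inv_def P_shift_mult assms(1,2))
  ultimately show False by blast
qed

lemma additiveI: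
  assumes "u \<in> P" "v \<in> P" "\<And>i j. i < j \<Longrightarrow> v i > v j \<Longrightarrow> u (v i) > u (v j)"
  shows "len (u \<circ> v) = len u + len v"
proof -
  have "{(i, j). i < j \<and> v i > v j \<and> u (v i) < u (v j)} = {}" using assms(3) by force
  then have "pair_count {(i, j). i < j \<and> v i > v j \<and> u (v i) < u (v j)} = 0" by (simp only: pair_count_def reps_def) simp
  then show ?thesis using len_mult(1)[OF assms(1,2)] by simp
qed

lemma len_id [simp]: "len id = 0"
proof -
  have "Inv id = {}" by (auto simp: Inv_def)
  then show ?thesis by (simp add: len_pair_count pair_count_def reps_def)
qed

lemma len_tau_left [simp]: "len (tau_pow j \<circ> f) = len f"
  by (simp add: affine_length_def tau_pow_def)

lemma len_inv: assumes "f \<in> P" shows "len (iv f) = len f"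
  unfolding len_pair_count
  by (rule pair_count_bij[of _ _ "\<lambda>(i, j). (iv f j, iv f i)" "\<lambda>(i, j). (f j, f i)"])
     (auto simp: shift_inv_Inv P_inv assms finite_Inv equivar_def P_shift_mult, auto simp: Inv_def assms)

subsection \<open>Reflections\<close>

definition refl :: "int \<Rightarrow> int \<Rightarrow> int \<Rightarrow> int" where
  "refl a b x = (if x mod N = a mod N then x + (b - a)
     else if x mod N = b mod N then x - (b - a) else x)"

lemma mod_add_diff: "x mod N = a mod N \<Longrightarrow> (x + (b - a)) mod N = b mod N"
  by (metis add.commute diff_add_cancel mod_add_right_eq mod_diff_right_eq)

lemma mod_sub_diff: "x mod N = b mod N \<Longrightarrow> (x - (b - a)) mod N = a mod N"
  using mod_add_diff[of x b a] by (simp add: algebra_simps)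

lemma refl_refl [simp]: assumes "a mod N \<noteq> b mod N" shows "refl a b (refl a b x) = x"
  using assms mod_add_diff[of x a b] mod_sub_diff[of x b a] by (auto simp: refl_def)

lemma refl_P: assumes "a mod N \<noteq> b mod N" shows "refl a b \<in> P"
proof -
  have "bij (refl a b)" using refl_refl[OF assms] by (rule involuntory_imp_bij)
  then show ?thesis by (auto simp: affine_perms_def refl_def)
qed

lemma refl_comp [simp]: "a mod N \<noteq> b mod N \<Longrightarrow> refl a b \<circ> refl a b = id"
  by (auto simp: fun_eq_iff)

lemma refl_app [simp]: "refl a b a = b" "a mod N \<noteq> b mod N \<Longrightarrow> refl a b b = a"
  by (auto simp: refl_def)

lemma refl_commute: "a mod N \<noteq> b mod N \<Longrightarrow> refl a b = refl b a"
  by (auto simp: refl_def fun_eq_iff)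

lemma refl_shift: "refl (a + q * N) (b + q * N) = refl a b"
  by (auto simp: refl_def fun_eq_iff)

lemma refl_conj: assumes "q \<in> P" shows "q \<circ> refl a b = refl (q a) (q b) \<circ> q"
proof
  fix x
  have *: "q (x + (b - a)) = q x + (q b - q a)" if "x mod N = a mod N" for x a b
  proof -
    from that obtain r where "x = a + r * N" by (rule mod_eqE)
    then show ?thesis using P_shift_mult[OF assms, of a r] P_shift_mult[OF assms, of b r]
      by (simp add: algebra_simps)
  qed
  show "(q \<circ> refl a b) x = (refl (q a) (q b) \<circ> q) x"
    using *[of x a b] *[of x b a] P_mod_eq_iff[OF assms, of x] by (auto simp: refl_def algebra_simps)
qed

lemma refl_reverse:
  assumes ab: "a < b" and i: "i < j" "refl a b i > refl a b j"
  shows "refl a b i = i \<or> i mod N = a mod N" "refl a b j = j \<or> (j mod N = b mod N \<and> j mod N \<noteq> a mod N)"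
proof -
  show "refl a b i = i \<or> i mod N = a mod N"
    using assms by (auto simp: refl_def split: if_splits)
  show "refl a b j = j \<or> (j mod N = b mod N \<and> j mod N \<noteq> a mod N)"
    using assms by (auto simp: refl_def split: if_splits)
qed

lemma len_refl_up:
  assumes w: "w \<in> P" and ab: "a < b" "a mod N \<noteq> b mod N" and lt: "w a < w b"
  shows "len w < len (w \<circ> refl a b)"
proof -
  let ?t = "refl a b"
  define w' where "w' = w \<circ> ?t"
  have t: "?t \<in> P" using refl_P ab by blast
  have w': "w' \<in> P" unfolding w'_def using w t P_comp by blast
  define B where "B = Inv w' - {(a + q * N, b + q * N) | q. True}"
  define Orb where "Orb = {(a + q * N, b + q * N) | q. True}"
  define \<phi> where "\<phi> = (\<lambda>(i, j). if ?t i < ?t j then (?t i, ?t j) else (i, j))"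
  have up: "w (?t x) \<ge> w x" if "?t x = x \<or> x mod N = a mod N" for x
  proof (cases "x mod N = a mod N")
    case True
    from True obtain r where r: "x = a + r * N" by (rule mod_eqE)
    then have "?t x = b + r * N" by (simp add: refl_def)
    then show ?thesis using r P_shift_mult[OF w] lt by simp
  qed (use that in auto)
  have down: "w (?t x) \<le> w x" if "?t x = x \<or> (x mod N = b mod N \<and> x mod N \<noteq> a mod N)" for x
  proof (cases "?t x = x")
    case False
    with that have "x mod N = b mod N" by blast
    then obtain r where r: "x = b + r * N" using mod_eqE by blast
    then have "?t x = a + r * N" using ab by (simp add: refl_def)
    then show ?thesis using r P_shift_mult[OF w] lt by simp
  qed simp
  have tO: "?t (a + q * N) = b + q * N" "?t (b + q * N) = a + q * N" for q
    using ab by (auto simp: refl_def)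
  have sO: "shift_inv Orb"
    proof -
    have "(a + r * N, b + r * N) \<in> Orb" for r unfolding Orb_def by blast
    from this[of "_ + _"] show ?thesis unfolding shift_inv_def
      by (auto simp: Orb_def algebra_simps)
  qed
  have sB: "shift_inv B"
  proof -
    have "(i, j) \<in> Orb" if "(i + q * N, j + q * N) \<in> Orb" for i j q
      using sO[unfolded shift_inv_def, rule_format, OF that, of "- q"] by simp
    then show ?thesis using shift_inv_Inv[OF w'] unfolding shift_inv_def B_def Orb_def[symmetric] by blast
  qed
  have fB: "finite (reps B)" using finite_Inv[OF w'] by (rule rev_finite_subset) (auto simp: reps_def B_def)
  have "pair_count (Inv w) \<le> pair_count B"
  proof (rule pair_count_inj(2)[OF shift_inv_Inv[OF w] sB _ _ _ fB])
    show "equivar \<phi>" by (auto simp: equivar_def \<phi>_def P_shift_mult[OF t])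
    show "inj_on \<phi> (Inv w)"
    proof (rule inj_on_inverseI[where g=\<phi>])
      fix p assume "p \<in> Inv w"
      then obtain i j where "p = (i, j)" "i < j" by (auto simp: Inv_def)
      then show "\<phi> (\<phi> p) = p" using ab by (simp add: \<phi>_def)
    qed
    show "\<phi> ` Inv w \<subseteq> B"
    proof
      fix p assume "p \<in> \<phi> ` Inv w"
      then obtain i j where ij: "i < j" "w i > w j" "p = \<phi> (i, j)" by (auto simp: Inv_def)
      show "p \<in> B"
      proof (cases "?t i < ?t j")
        case True
        then have p: "p = (?t i, ?t j)" using ij by (simp add: \<phi>_def)
        have "p \<in> Inv w'" using p True ij ab by (simp add: Inv_def w'_def)
        moreover have "p \<notin> Orb"
        proof
          assume "p \<in> Orb"
          then obtain q where "?t i = a + q * N" "?t j = b + q * N" using p by (auto simp: Orb_def)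
          then have "?t (?t i) = b + q * N" "?t (?t j) = a + q * N" using tO by simp_all
          then have "i = b + q * N" "j = a + q * N" using ab by simp_all
          then show False using ij ab by simp
        qed
        ultimately show ?thesis by (simp add: B_def Orb_def)
      next
        case False
        then have p: "p = (i, j)" using ij by (simp add: \<phi>_def)
        have "?t i \<noteq> ?t j" using ij(1) P_inj[OF t] by auto
        then have gt: "?t i > ?t j" using False by simp
        have "w' i > w' j"
          using up[OF refl_reverse(1)[OF ab(1) ij(1) gt]] down[OF refl_reverse(2)[OF ab(1) ij(1) gt]] ij(2)
          by (simp add: w'_def)
        moreover have "p \<notin> Orb"
          using ij(2) p lt by (auto simp: Orb_def P_shift_mult[OF w])
        ultimately show ?thesis using p ij by (simp add: B_def Orb_def Inv_def)
      qed
    qed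
  qed
  moreover have "pair_count B < pair_count (Inv w')"
    unfolding pair_count_def
  proof (rule psubset_card_mono[OF finite_Inv[OF w']])
    have "(a, b) \<in> Inv w'" using ab lt by (simp add: Inv_def w'_def)
    then have 1: "norm_pair (a, b) \<in> reps (Inv w')" using norm_pair_in shift_inv_Inv[OF w'] by blast
    have "(a, b) \<in> Orb" by (auto simp: Orb_def intro!: exI[of _ 0])
    then have "norm_pair (a, b) \<in> reps Orb" using norm_pair_in sO by blast
    then have "norm_pair (a, b) \<notin> reps B" by (auto simp: reps_def B_def Orb_def)
    moreover have "reps B \<subseteq> reps (Inv w')" by (auto simp: reps_def B_def)
    ultimately show "reps B \<subset> reps (Inv w')" using 1 by blast
  qed
  ultimately show ?thesis unfolding len_pair_count w'_def by linarith
qed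

lemma len_refl_less_iff:
  assumes w: "w \<in> P" and ab: "a < b" "a mod N \<noteq> b mod N"
  shows "len (w \<circ> refl a b) < len w \<longleftrightarrow> w b < w a" "len w < len (w \<circ> refl a b) \<longleftrightarrow> w a < w b"
proof -
  have t: "refl a b \<in> P" using refl_P ab by blast
  have "w a \<noteq> w b" using P_inj[OF w] ab by auto
  moreover have "len (w \<circ> refl a b) < len w" if "w b < w a"
  proof -
    have "len (w \<circ> refl a b) < len ((w \<circ> refl a b) \<circ> refl a b)"
      using len_refl_up[OF P_comp[OF w t] ab] that ab by simp
    then show ?thesis using ab by (simp add: o_assoc[symmetric])
  qed
  ultimately show "len (w \<circ> refl a b) < len w \<longleftrightarrow> w b < w a" "len w < len (w \<circ> refl a b) \<longleftrightarrow> w a < w b"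
    using len_refl_up[OF w ab] by (metis less_asym linorder_neqE)+
qed

lemma len_cover:
  assumes w: "w \<in> P" and ab: "a < b" "a mod N \<noteq> b mod N" and lt: "w a < w b"
    and nb: "\<And>c. a < c \<Longrightarrow> c < b \<Longrightarrow> \<not> (w a < w c \<and> w c < w b)"
  shows "len (w \<circ> refl a b) = len w + 1"
proof -
  let ?t = "refl a b"
  define w' where "w' = w \<circ> ?t"
  have t: "?t \<in> P" using refl_P ab by blast
  have w': "w' \<in> P" unfolding w'_def using w t P_comp by blast
  define Orb where "Orb = {(a + q * N, b + q * N) | q. True}"
  define B where "B = Inv w' - Orb"
  define \<phi> where "\<phi> = (\<lambda>(i, j). if ?t i < ?t j then (?t i, ?t j) else (i, j))"
  have tO: "?t (a + q * N) = b + q * N" "?t (b + q * N) = a + q * N" for q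
    using ab by (auto simp: refl_def)
  have sO: "shift_inv Orb"
    proof -
    have "(a + r * N, b + r * N) \<in> Orb" for r unfolding Orb_def by blast
    from this[of "_ + _"] show ?thesis unfolding shift_inv_def
      by (auto simp: Orb_def algebra_simps)
  qed
  have sB: "shift_inv B"
  proof -
    have "(i, j) \<in> Orb" if "(i + q * N, j + q * N) \<in> Orb" for i j q
      using sO[unfolded shift_inv_def, rule_format, OF that, of "- q"] by simp
    then show ?thesis using shift_inv_Inv[OF w'] unfolding shift_inv_def B_def by blast
  qed
  have fB: "finite (reps B)" using finite_Inv[OF w'] by (rule rev_finite_subset) (auto simp: reps_def B_def)
  have nb': "\<not> (w a + q * N < w c \<and> w c < w b + q * N)" if "a + q * N < c" "c < b + q * N" for c q
    using nb[of "c - q * N"] that P_shift_mult[OF w, of c "- q"] by auto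
  have "pair_count B \<le> pair_count (Inv w)"
  proof (rule pair_count_inj(2)[OF sB shift_inv_Inv[OF w] _ _ _ finite_Inv[OF w]])
    show "equivar \<phi>" by (auto simp: equivar_def \<phi>_def P_shift_mult[OF t])
    show "inj_on \<phi> B"
    proof (rule inj_on_inverseI[where g=\<phi>])
      fix p assume "p \<in> B"
      then obtain i j where "p = (i, j)" "i < j" by (auto simp: Inv_def B_def)
      then show "\<phi> (\<phi> p) = p" using ab by (simp add: \<phi>_def)
    qed
    show "\<phi> ` B \<subseteq> Inv w"
    proof
      fix p assume "p \<in> \<phi> ` B"
      then obtain i j where ij: "i < j" "w (?t i) > w (?t j)" "(i, j) \<notin> Orb" "p = \<phi> (i, j)"
        by (auto simp: Inv_def B_def w'_def)
      show "p \<in> Inv w"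
      proof (cases "?t i < ?t j")
        case True
        then show ?thesis using ij by (simp add: \<phi>_def Inv_def)
      next
        case False
        then have p: "p = (i, j)" using ij by (simp add: \<phi>_def)
        have "?t i \<noteq> ?t j" using ij(1) P_inj[OF t] by auto
        then have gt: "?t i > ?t j" using False by simp
        note r = refl_reverse[OF ab(1) ij(1) gt]
        have wne: "w i \<noteq> w j" using ij(1) P_inj[OF w] by auto
        have "w i > w j"
        proof (cases "i mod N = a mod N")
          case True
          then obtain q where q: "i = a + q * N" using mod_eqE by blast
          have ti: "?t i = b + q * N" using q tO by simp
          show ?thesis
          proof (cases "?t j = j")
            case True
            then show ?thesis using nb'[of q j] ij gt ti q wne P_shift_mult[OF w] by auto
          next
            case False
            with r(2) have "j mod N = b mod N" by blast
            then obtain s where s: "j = b + s * N" using mod_eqE by blast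
            have tj: "?t j = a + s * N" using s tO by simp
            have sq: "s \<noteq> q" using ij(3) q s by (auto simp: Orb_def)
            show ?thesis
            proof (cases "s < q")
              case True
              then have "s * N < q * N" using N_pos by simp
              then show ?thesis using nb'[of q j] ij(1,2) gt ti tj q s wne P_shift_mult[OF w] by auto
            next
              case False
              then have "q * N < s * N" using N_pos sq by simp
              then show ?thesis using nb'[of q "a + s * N"] ij(1,2) gt ti tj q s wne P_shift_mult[OF w] by auto
            qed
          qed
        next
          case False
          then have ti: "?t i = i" using r(1) by blast
          then have "?t j \<noteq> j" using gt ij(1) by auto
          with r(2) have "j mod N = b mod N" by blast
          then obtain s where s: "j = b + s * N" using mod_eqE by blast
          have tj: "?t j = a + s * N" using s tO by simp
          show ?thesis using nb'[of s i] ij(1,2) gt ti tj s wne P_shift_mult[OF w] by auto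
        qed
        then show ?thesis using p ij by (simp add: Inv_def)
      qed
    qed
  qed
  moreover have "pair_count (Inv w') \<le> pair_count B + 1"
  proof -
    have "reps (Inv w') \<subseteq> insert (norm_pair (a, b)) (reps B)"
    proof
      fix p assume p: "p \<in> reps (Inv w')"
      show "p \<in> insert (norm_pair (a, b)) (reps B)"
      proof (cases "p \<in> Orb")
        case True
        then obtain q where q: "p = (a + q * N, b + q * N)" by (auto simp: Orb_def)
        obtain s where s: "norm_pair (a, b) = (a + s * N, b + s * N)"
          unfolding norm_pair_def by (metis fst_conv snd_conv diff_conv_add_uminus minus_mult_left)
        have "q - s = 0"
          using p q s norm_pair_range[of "(a, b)"] rep_shift_zero[of "a + s * N" "q - s"]
          by (auto simp: reps_def algebra_simps)
        then show ?thesis using q s by simp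
      qed (use p in \<open>auto simp: reps_def B_def\<close>)
    qed
    then have "card (reps (Inv w')) \<le> card (insert (norm_pair (a, b)) (reps B))"
      using fB by (intro card_mono) auto
    then show ?thesis unfolding pair_count_def using card_insert_le_m1[of _ "reps B"] fB
      by (simp add: card_insert_if split: if_splits)
  qed
  ultimately show ?thesis using len_refl_up[OF w ab lt] unfolding len_pair_count w'_def by linarith
qed

subsection \<open>The average displacement\<close>

definition displ :: "(int \<Rightarrow> int) \<Rightarrow> int" where
  "displ f = (\<Sum>i\<in>{1..N}. f i - i)"

lemma sum_periodic_reindex:
  fixes g :: "int \<Rightarrow> int"
  assumes f: "f \<in> P" and g: "\<And>x. g (x + N) = g x"
  shows "(\<Sum>i\<in>{1..N}. g (f i)) = (\<Sum>i\<in>{1..N}. g i)"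
proof -
  define r where "r x = (x - 1) mod N + 1" for x
  have gq: "g (x + q * N) = g x" for x q
  proof (induction q rule: int_induct[where k=0])
    case (step1 i)
    then show ?case using g[of "x + i * N"] by (simp add: algebra_simps)
  next
    case (step2 i)
    then show ?case using g[of "x + i * N - N"] by (simp add: algebra_simps)
  qed simp
  have gr: "g (r x) = g x" for x
  proof -
    have "r x = x + (- ((x - 1) div N)) * N"
      by (simp add: r_def minus_div_mult_eq_mod[symmetric])
    then show ?thesis using gq by metis
  qed
  have rin: "r x \<in> {1..N}" for x
    using pos_mod_bound[OF N_pos, of "x - 1"] pos_mod_sign[OF N_pos, of "x - 1"] by (simp add: r_def)
  have "inj_on (\<lambda>i. r (f i)) {1..N}"
  proof (rule inj_onI)
    fix i j assume ij: "i \<in> {1..N}" "j \<in> {1..N}" "r (f i) = r (f j)"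
    then have "(f i - 1) mod N = (f j - 1) mod N" by (simp add: r_def)
    then have "(f i - 1 + 1) mod N = (f j - 1 + 1) mod N" by (rule mod_add_cong) simp
    then have "i mod N = j mod N" using P_mod_eq_iff[OF f] by simp
    then obtain q where "i = j + q * N" by (rule mod_eqE)
    moreover from this have "q = 0" using rep_shift_zero[of j q] ij by auto
    ultimately show "i = j" by simp
  qed
  moreover from this have "(\<lambda>i. r (f i)) ` {1..N} = {1..N}"
    using rin by (intro endo_inj_surj) auto
  ultimately have "(\<Sum>i\<in>{1..N}. g i) = (\<Sum>i\<in>{1..N}. g (r (f i)))"
    using sum.reindex[of "\<lambda>i. r (f i)" "{1..N}" g] by simp
  then show ?thesis by (simp add: gr)
qed

lemma displ_comp: assumes "f \<in> P" "g \<in> P" shows "displ (f \<circ> g) = displ f + displ g"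
proof -
  have "displ (f \<circ> g) = (\<Sum>i\<in>{1..N}. f (g i) - g i) + displ g"
    by (simp add: displ_def sum_subtractf)
  also have "(\<Sum>i\<in>{1..N}. f (g i) - g i) = displ f"
    using sum_periodic_reindex[OF assms(2), of "\<lambda>x. f x - x"] P_shift[OF assms(1)] by (simp add: displ_def)
  finally show ?thesis .
qed

lemma displ_tau: "displ (tau_pow j) = j * N"
  by (simp add: displ_def tau_pow_def)

lemma displ_id: "displ id = 0"
  by (simp add: displ_def)

lemma sum_level_one:
  assumes f: "f \<in> P" and \<chi>: "\<And>x. \<chi> (x + N) = \<chi> x + (1::int)"
  shows "(\<Sum>i\<in>{1..N}. \<chi> (f i) - \<chi> i) * N = displ f"
proof -
  have "(\<Sum>i\<in>{1..N}. \<chi> (f i) * N - f i) = (\<Sum>i\<in>{1..N}. \<chi> i * N - i)"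
    using sum_periodic_reindex[OF f, of "\<lambda>x. \<chi> x * N - x"] \<chi> by (simp add: algebra_simps)
  then show ?thesis
    by (simp add: displ_def sum_subtractf sum_distrib_right left_diff_distrib)
qed

lemma displ_dvd: assumes "f \<in> P" shows "\<exists>j. displ f = j * N"
  using sum_level_one[OF assms, of "\<lambda>x. x div N"] N_pos by (metis div_add_self2 less_irrefl)

lemma simple_refl_eq: assumes "n \<noteq> 1" shows "simple_refl n i = refl i (i + 1)"
  using assms by (auto simp: simple_refl_def refl_def fun_eq_iff)

lemma mod_Suc_ne: assumes "n \<noteq> 1" shows "i mod N \<noteq> (i + 1) mod N"
proof
  assume "i mod N = (i + 1) mod N"
  then have "N dvd (i + 1) - i" by (metis mod_eq_dvd_iff)
  then show False using assms N_pos by simp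
qed

lemma simple_refl_P: "simple_refl n i \<in> P"
  using simple_refl_affine_perm n_pos by blast

lemma displ_refl: assumes "a mod N \<noteq> b mod N" shows "displ (refl a b) = 0"
  using displ_comp[OF refl_P[OF assms] refl_P[OF assms]] assms displ_id by simp

lemma displ_simple_refl: "displ (simple_refl n i) = 0"
proof (cases "n = 1")
  case True
  then have "simple_refl n i = id" by (auto simp: simple_refl_def)
  then show ?thesis using displ_id by simp
next
  case False
  then show ?thesis using displ_refl[OF mod_Suc_ne[OF False]] simple_refl_eq by simp
qed

lemma increasing_affine_perm:
  assumes f: "f \<in> P" and inc: "\<And>i. f i < f (i + 1)" shows "f = tau_pow (f 0)"
proof -
  have mono: "f i < f (i + 1 + int d)" for i d
  proof (induction d)
    case 0
    show ?case using inc[of i] by simp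
  next
    case (Suc d)
    have "f (i + 1 + int d) < f (i + 1 + int (Suc d))" using inc[of "i + 1 + int d"] by (simp add: algebra_simps)
    then show ?case using Suc by linarith
  qed
  then have mono': "f i < f j" if "i < j" for i j
    using mono[of i "nat (j - i - 1)"] that by simp
  have step: "f (i + 1) = f i + 1" for i
  proof -
    obtain x where x: "f x = f i + 1" using inv_P_app(2)[OF f] by metis
    have "\<not> x \<le> i" using mono'[of x i] x by (cases "x = i") auto
    moreover have "\<not> x > i + 1" using mono'[of "i + 1" x] inc[of i] x by auto
    ultimately have "x = i + 1" by auto
    then show ?thesis using x by simp
  qed
  have *: "f x = f 0 + x" for x
  proof (induction x rule: int_induct[where k=0])
    case (step1 i)
    then show ?case using step[of i] by simp
  next
    case (step2 i)
    then show ?case using step[of "i - 1"] by simp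
  qed simp
  show ?thesis unfolding tau_pow_def by (rule ext) (subst *, rule add.commute)
qed

lemma affine_perms0_subset: "f \<in> affine_perms0 n \<Longrightarrow> f \<in> P \<and> displ f = 0"
  unfolding affine_perms0_def
proof (induction rule: generate.induct)
  case one
  then show ?case using P_id displ_id by (simp add: affine_group_def id_def)
next
  case (incl h)
  then show ?case using simple_refl_P displ_simple_refl by auto
next
  case (inv h)
  then have h: "h \<in> P" "displ h = 0" using simple_refl_P displ_simple_refl by auto
  let ?g = "inv\<^bsub>affine_group n\<^esub> h"
  have hc: "h \<in> carrier (affine_group n)" using h by (simp add: affine_group_def)
  have g: "?g \<in> P" using group.inv_closed[OF group_affine_group hc] by (simp add: affine_group_def)
  have "?g \<circ> h = id" using group.l_inv[OF group_affine_group hc] by (simp add: affine_group_def)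
  then show ?case using displ_comp[OF g h(1)] h g displ_id by simp
next
  case (eng h1 h2)
  then show ?case using P_comp[of h1 h2] displ_comp[of h1 h2] by (simp add: affine_group_def comp_def)
qed

lemma affine_perms0_supset: "f \<in> P \<Longrightarrow> displ f = 0 \<Longrightarrow> f \<in> affine_perms0 n"
proof (induction "len f" arbitrary: f rule: less_induct)
  case less
  show ?case
  proof (cases "\<forall>i. f i < f (i + 1)")
    case True
    then have *: "f = tau_pow (f 0)" using increasing_affine_perm less.prems by blast
    then have "f 0 * N = 0" using less.prems(2) displ_tau by metis
    then have "f 0 = 0" using N_pos by simp
    then have "f = id" using * by (auto simp: tau_pow_def)
    then show ?thesis using generate.one[of "affine_group n"]
      unfolding affine_perms0_def by (simp add: affine_group_def)
  next
    case False
    then obtain i where i: "\<not> f i < f (i + 1)" by blast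
    moreover have "f i \<noteq> f (i + 1)" using P_inj[OF less.prems(1)] by simp
    ultimately have gt: "f (i + 1) < f i" by linarith
    have n1: "n \<noteq> 1"
    proof
      assume "n = 1" then show False using P_shift[OF less.prems(1), of i] gt by simp
    qed
    let ?s = "simple_refl n i"
    have s: "?s = refl i (i + 1)" using simple_refl_eq n1 by blast
    have "len (f \<circ> ?s) < len f"
      unfolding s using len_refl_less_iff(1)[OF less.prems(1) _ mod_Suc_ne[OF n1]] gt by simp
    moreover have "f \<circ> ?s \<in> P" "displ (f \<circ> ?s) = 0"
      using less.prems P_comp simple_refl_P displ_comp displ_simple_refl by auto
    ultimately have 1: "f \<circ> ?s \<in> affine_perms0 n" using less.hyps by blast
    have "?s = simple_refl n (i mod N)"
      by (auto simp: simple_refl_def fun_eq_iff mod_simps)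
    then have "?s \<in> simple_refl n ` {0..<N}" using N_pos by auto
    then have "?s \<in> affine_perms0 n" unfolding affine_perms0_def by (rule generate.incl)
    then have "(f \<circ> ?s) \<circ> ?s \<in> affine_perms0 n"
      using 1 generate.eng[of "f \<circ> ?s" "affine_group n"] unfolding affine_perms0_def by (simp add: affine_group_def)
    moreover have "(f \<circ> ?s) \<circ> ?s = f"
      using s mod_Suc_ne[OF n1] by (simp add: o_assoc[symmetric])
    ultimately show ?thesis by simp
  qed
qed

lemma affine_perms0_eq: "affine_perms0 n = {f \<in> P. displ f = 0}"
  using affine_perms0_subset affine_perms0_supset by blast

lemma tau_tau [simp]: "tau_pow a \<circ> (tau_pow b \<circ> f) = tau_pow (a + b) \<circ> f" "tau_pow 0 = id"
  by (auto simp: tau_pow_def)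

lemma av_eqI: assumes f: "f \<in> P" and j: "displ f = j * N" shows "av n f = j"
  unfolding av_def
proof (rule the_equality)
  let ?g = "tau_pow (- j) \<circ> f"
  have "?g \<in> affine_perms0 n" 
    unfolding affine_perms0_eq using P_comp[OF P_tau f] displ_comp[OF P_tau f] displ_tau j by simp
  then show "\<exists>g\<in>affine_perms0 n. f = tau_pow j \<circ> g" by (intro bexI[of _ ?g]) simp_all
  fix j' assume "\<exists>g\<in>affine_perms0 n. f = tau_pow j' \<circ> g"
  then obtain g where g: "g \<in> P" "displ g = 0" "f = tau_pow j' \<circ> g" unfolding affine_perms0_eq by blast
  then have "j' * N = j * N" using displ_comp[OF P_tau g(1)] displ_tau j by simp
  then show "j' = j" using N_pos by simp
qed

section \<open>Cyclically decreasing elements\<close>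

abbreviation on :: "int set \<Rightarrow> int \<Rightarrow> bool" where "on T x \<equiv> x mod N \<in> T"

definition nxt :: "int set \<Rightarrow> int \<Rightarrow> int" where
  "nxt T x = x + 1 + int (LEAST d. on T (x + 1 + int d))"

definition is_support :: "int set \<Rightarrow> bool" where
  "is_support T \<longleftrightarrow> T \<subseteq> {0..<N} \<and> T \<noteq> {}"

lemma ex_on: assumes "is_support T" shows "\<exists>d. d < n \<and> on T (x + int d)"
proof -
  obtain t where t: "t \<in> T" "0 \<le> t" "t < N" using assms unfolding is_support_def by force
  define d where "d = nat ((t - x) mod N)"
  have d: "int d = (t - x) mod N" unfolding d_def using N_pos by simp
  have "(x + int d) mod N = t" unfolding d using t by (simp add: mod_simps)
  moreover have "int d < N" unfolding d using N_pos by simp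
  ultimately show ?thesis using t by auto
qed

lemma nxt_on: assumes "is_support T" shows "on T (nxt T x)"
  unfolding nxt_def using ex_on[OF assms, of "x + 1"] by (metis (mono_tags, lifting) LeastI)

lemma nxt_gt: "x < nxt T x" by (simp add: nxt_def)

lemma nxt_le: assumes "is_support T" shows "nxt T x \<le> x + N"
proof -
  obtain d where d: "d < n" "on T (x + 1 + int d)" using ex_on[OF assms] by blast
  then have "(LEAST d. on T (x + 1 + int d)) \<le> d" by (intro Least_le)
  then show ?thesis using d by (simp add: nxt_def)
qed

lemma nxt_between: assumes "x < y" "y < nxt T x" shows "\<not> on T y"
proof -
  have "nat (y - x - 1) < (LEAST d. on T (x + 1 + int d))" using assms by (simp add: nxt_def)
  then have "\<not> on T (x + 1 + int (nat (y - x - 1)))" by (rule not_less_Least)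
  then show ?thesis using assms by simp
qed

lemma nxt_eqI: assumes "x < z" "on T z" "\<And>y. x < y \<Longrightarrow> y < z \<Longrightarrow> \<not> on T y" shows "nxt T x = z"
proof -
  have "(LEAST d. on T (x + 1 + int d)) = nat (z - x - 1)"
  proof (rule Least_equality)
    show "on T (x + 1 + int (nat (z - x - 1)))" using assms by simp
    fix d assume d: "on T (x + 1 + int d)"
    show "nat (z - x - 1) \<le> d"
    proof (rule ccontr)
      assume "\<not> ?thesis"
      then have "x + 1 + int d < z" by linarith
      then show False using assms(3)[of "x + 1 + int d"] d by simp
    qed
  qed
  then show ?thesis using assms by (simp add: nxt_def)
qed

lemma nxt_shift: assumes "is_support T" shows "nxt T (x + q * N) = nxt T x + q * N"
proof (rule nxt_eqI)
  show "x + q * N < nxt T x + q * N" using nxt_gt by simp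
  show "on T (nxt T x + q * N)" using nxt_on[OF assms] by simp
  fix y assume "x + q * N < y" "y < nxt T x + q * N"
  then have "\<not> on T (y - q * N)" using nxt_between[of x "y - q * N" T] by simp
  moreover have "(y - q * N) mod N = y mod N" by (simp add: mod_diff_eq[symmetric, of y "q * N"])
  ultimately show "\<not> on T y" by simp
qed

lemma nxt_le_on: assumes "on T y" "x < y" shows "nxt T x \<le> y"
  using nxt_between[of x y T] assms by force

lemma nxt_inj: assumes "on T x" "on T y" "nxt T x = nxt T y" shows "x = y"
  using nxt_le_on[of y T x] nxt_le_on[of x T y] nxt_gt[of x T] nxt_gt[of y T] assms by force

lemma prev_ex: assumes "is_support T" shows "\<exists>a. on T a \<and> a \<le> b \<and> b < nxt T a"
proof -
  obtain d0 where "on T (b - N + int d0)" "d0 < n" using ex_on[OF assms] by blast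
  then have "on T (b - int (n - d0))" by (simp add: algebra_simps of_nat_diff)
  then have ex: "\<exists>d. on T (b - int d)" by blast
  define d where "d = (LEAST d. on T (b - int d))"
  have d: "on T (b - int d)" unfolding d_def using ex by (rule LeastI_ex)
  have "b < nxt T (b - int d)"
  proof (rule ccontr)
    assume *: "\<not> ?thesis"
    define e where "e = nat (b - nxt T (b - int d))"
    have "on T (b - int e)" using * nxt_on[OF assms] by (simp add: e_def)
    then have "d \<le> e" unfolding d_def by (rule Least_le)
    then show False using * nxt_gt[of "b - int d" T] by (simp add: e_def)
  qed
  then show ?thesis using d by (intro exI[of _ "b - int d"]) simp
qed

lemma prev_unique: assumes "on T a" "a \<le> b" "b < nxt T a" "on T a'" "a' \<le> b" "b < nxt T a'" shows "a = a'"
  using assms nxt_le_on[of a' T a] nxt_le_on[of a T a'] by force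

text \<open>The cyclically decreasing element in which exactly the letters \<open>t - 1\<close> with \<open>t \<in> T\<close> do not occur.\<close>

definition cyc :: "int set \<Rightarrow> int \<Rightarrow> int" where
  "cyc T x = (if on T x then nxt T x - 1 else x - 1)"

lemma cyc_ge: "cyc T x \<ge> x - 1" using nxt_gt[of x T] by (simp add: cyc_def)

lemma cyc_on_iff: "on T x \<longleftrightarrow> cyc T x \<ge> x" using nxt_gt[of x T] by (auto simp: cyc_def)

lemma cyc_P: assumes T: "is_support T" shows "cyc T \<in> P"
proof -
  have "inj (cyc T)"
  proof (rule injI)
    fix x y assume e: "cyc T x = cyc T y"
    consider "on T x" "on T y" | "on T x" "\<not> on T y" | "\<not> on T x" "on T y" | "\<not> on T x" "\<not> on T y" by blast
    then show "x = y"
    proof cases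
      case 1 then show ?thesis using e nxt_inj[of x T y] by (simp add: cyc_def)
    next
      case 2 then have "nxt T x = y" using e by (simp add: cyc_def)
      then show ?thesis using nxt_on[OF T, of x] 2 by simp
    next
      case 3 then have "nxt T y = x" using e by (simp add: cyc_def)
      then show ?thesis using nxt_on[OF T, of y] 3 by simp
    next
      case 4 then show ?thesis using e by (simp add: cyc_def)
    qed
  qed
  moreover have "surj (cyc T)"
  proof (rule surjI)
    fix z
    have "\<exists>x. cyc T x = z"
    proof (cases "on T (z + 1)")
      case False then show ?thesis by (intro exI[of _ "z + 1"]) (simp add: cyc_def)
    next
      case True
      obtain a where a: "on T a" "a \<le> z" "z < nxt T a" using prev_ex[OF T] by blast
      then have "nxt T a = z + 1" using nxt_le_on[OF True, of a] by simp
      then show ?thesis using a by (intro exI[of _ a]) (simp add: cyc_def)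
    qed
    then show "cyc T (SOME x. cyc T x = z) = z" by (rule someI_ex)
  qed
  moreover have "cyc T (x + N) = cyc T x + N" for x
    using nxt_shift[OF T, of x 1] by (simp add: cyc_def)
  ultimately show ?thesis by (simp add: affine_perms_def bij_def)
qed

lemma Inv_cyc: assumes T: "is_support T"
  shows "Inv (cyc T) = {(a, b). on T a \<and> \<not> on T b \<and> a < b \<and> b < nxt T a}"
proof -
  have "on T a \<and> \<not> on T b \<and> a < b \<and> b < nxt T a" if "a < b" "cyc T a > cyc T b" for a b
  proof -
    have a: "on T a" using that cyc_ge[of b T] cyc_on_iff[of a T] by linarith
    moreover have "\<not> on T b"
    proof
      assume b: "on T b"
      then have "nxt T a \<le> b" using that nxt_le_on by blast
      then show False using that a b nxt_gt[of b T] by (simp add: cyc_def)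
    qed
    ultimately show ?thesis using that by (simp add: cyc_def)
  qed
  moreover have "cyc T a > cyc T b" if "on T a" "\<not> on T b" "b < nxt T a" for a b
    using that by (simp add: cyc_def)
  ultimately show ?thesis unfolding Inv_def by blast
qed

lemma card_residues:
  assumes "T \<subseteq> {0..<N}" shows "card {x \<in> {1..N}. on T x} = card T"
proof (rule bij_betw_same_card)
  show "bij_betw (\<lambda>x. x mod N) {x \<in> {1..N}. on T x} T"
  proof (rule bij_betw_byWitness[where f'="\<lambda>t. if t = 0 then N else t"])
    show "\<forall>a\<in>{x \<in> {1..N}. on T x}. (if a mod N = 0 then N else a mod N) = a"
    proof
      fix a assume "a \<in> {x \<in> {1..N}. on T x}"
      then show "(if a mod N = 0 then N else a mod N) = a"
        by (cases "a = N") auto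
    qed
    show "(\<lambda>t. if t = 0 then N else t) ` T \<subseteq> {x \<in> {1..N}. on T x}"
    proof
      fix x assume "x \<in> (\<lambda>t. if t = 0 then N else t) ` T"
      then obtain t where t: "t \<in> T" "x = (if t = 0 then N else t)" by blast
      then have "0 \<le> t" "t < N" using assms by auto
      then show "x \<in> {x \<in> {1..N}. on T x}" using t N_pos by (auto split: if_splits)
    qed
  qed (use assms in \<open>auto simp: subset_iff\<close>)
qed

lemma card_is_support: assumes "is_support T" shows "0 < card T" "card T \<le> n" "finite T"
proof -
  have s: "T \<subseteq> {0..<N}" using assms by (simp add: is_support_def)
  then show f: "finite T" by (rule finite_subset) simp
  show "0 < card T" using assms f by (auto simp: is_support_def card_gt_0_iff)
  show "card T \<le> n" using card_mono[OF _ s] by simp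
qed

lemma len_cyc: assumes T: "is_support T" shows "len (cyc T) = n - card T"
proof -
  define D where "D = {(b, b'). b = b' \<and> \<not> on T b}"
  define pr where "pr b = (THE a. on T a \<and> a \<le> b \<and> b < nxt T a)" for b
  have pr: "on T (pr b) \<and> pr b \<le> b \<and> b < nxt T (pr b)" for b
    unfolding pr_def by (rule theI') (use prev_ex[OF T] prev_unique in blast)
  have prI: "pr b = a" if "on T a" "a \<le> b" "b < nxt T a" for a b
    using prev_unique pr that by blast
  have prs: "pr (b + q * N) = pr b + q * N" for b q
    using pr[of b] nxt_shift[OF T] by (intro prI) auto
  have sD: "shift_inv D" by (auto simp: shift_inv_def D_def)
  have rD: "reps D = (\<lambda>b. (b, b)) ` {x \<in> {1..N}. \<not> on T x}" by (auto simp: reps_def D_def)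
  have "pair_count (Inv (cyc T)) = pair_count D"
  proof (rule pair_count_bij[OF shift_inv_Inv[OF cyc_P[OF T]] sD,
        of "\<lambda>(a, b). (b, b)" "\<lambda>(b, b'). (pr b, b')"])
    show "equivar (\<lambda>(a, b). (b, b))" "equivar (\<lambda>(b, b'). (pr b, b'))"
      by (auto simp: equivar_def prs)
    show "finite (reps D)" unfolding rD by (rule finite_imageI, rule finite_subset[of _ "{1..N}"]) auto
    fix p assume "p \<in> Inv (cyc T)"
    then obtain a b where p: "p = (a, b)" "on T a" "\<not> on T b" "a < b" "b < nxt T a"
      by (auto simp: Inv_cyc[OF T])
    then show "(case p of (a, b) \<Rightarrow> (b, b)) \<in> D \<and> (case case p of (a, b) \<Rightarrow> (b, b) of (b, b') \<Rightarrow> (pr b, b')) = p"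
      using prI[of a b] by (simp add: D_def)
  next
    fix p assume "p \<in> D"
    then obtain b where p: "p = (b, b)" "\<not> on T b" by (auto simp: D_def)
    moreover from this have "pr b \<noteq> b" using pr[of b] by auto
    ultimately show "(case p of (b, b') \<Rightarrow> (pr b, b')) \<in> Inv (cyc T) \<and> (case case p of (b, b') \<Rightarrow> (pr b, b') of (a, b) \<Rightarrow> (b, b)) = p"
      using pr[of b] unfolding Inv_cyc[OF T] by simp
  qed
  also have "pair_count D = card {x \<in> {1..N}. \<not> on T x}"
    unfolding pair_count_def rD by (rule card_image) (simp add: inj_on_def)
  also have "{x \<in> {1..N}. \<not> on T x} = {1..N} - {x \<in> {1..N}. on T x}" by auto
  also have "card \<dots> = n - card T"
  proof (subst card_Diff_subset)
    show "finite {x \<in> {1..N}. on T x}" by (rule finite_subset[of _ "{1..N}"]) auto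
    show "card {1..N} - card {x \<in> {1..N}. on T x} = n - card T"
      using card_residues[of T] T by (simp add: is_support_def)
  qed auto
  finally show ?thesis unfolding len_pair_count .
qed

lemma cyc_inj: assumes "is_support T" "is_support T'" "cyc T = cyc T'" shows "T = T'"
proof -
  have "on T x \<longleftrightarrow> on T' x" for x using cyc_on_iff assms(3) by metis
  then have "t \<in> T \<longleftrightarrow> t \<in> T'" if "t \<in> {0..<N}" for t using that by (metis mod_pos_pos_trivial atLeastLessThan_iff)
  then show ?thesis using assms unfolding is_support_def by blast
qed

lemma cyc_full: "cyc {0..<N} = id"
proof
  fix x
  have "nxt {0..<N} x = x + 1" using N_pos by (intro nxt_eqI) auto
  then show "cyc {0..<N} x = id x" using N_pos by (simp add: cyc_def)
qed

lemma is_support_insert: "is_support T \<Longrightarrow> is_support (insert (b mod N) T)"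
  using N_pos by (auto simp: is_support_def)

lemma cyc_refl:
  assumes T: "is_support T" and a: "on T a" "a < b" "b < nxt T a"
  shows "cyc T \<circ> refl a b = cyc (insert (b mod N) T)"
proof
  let ?T = "insert (b mod N) T"
  have T': "is_support ?T" using is_support_insert[OF T] .
  have b: "\<not> on T b" using nxt_between a by blast
  have ab: "a mod N \<noteq> b mod N" using a b by auto
  have n1: "nxt ?T a = b"
  proof (rule nxt_eqI)
    fix y assume y: "a < y" "y < b"
    then have "\<not> on T y" using a nxt_between[of a y T] by simp
    moreover have "y mod N \<noteq> b mod N"
    proof
      assume "y mod N = b mod N"
      then have "b mod N = y mod N" by simp
      then obtain q where q: "b = y + q * N" by (rule mod_eqE)
      moreover have "\<not> q \<le> 0" using q y N_pos by (smt (verit) mult_nonpos_nonneg)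
      ultimately have "b \<ge> y + N" using N_pos by (smt (verit) mult_le_cancel_right1)
      then show False using y a nxt_le[OF T, of a] by linarith
    qed
    ultimately show "\<not> on ?T y" by simp
  qed (use a in auto)
  have n2: "nxt ?T b = nxt T a"
  proof (rule nxt_eqI)
    fix y assume y: "b < y" "y < nxt T a"
    then have "\<not> on T y" using a nxt_between[of a y T] by simp
    moreover have "y mod N \<noteq> b mod N"
    proof
      assume "y mod N = b mod N"
      then obtain q where q: "y = b + q * N" by (rule mod_eqE)
      moreover have "\<not> q \<le> 0" using q y N_pos by (smt (verit) mult_nonpos_nonneg)
      ultimately have "y \<ge> b + N" using N_pos by (smt (verit) mult_le_cancel_right1)
      then show False using y a nxt_le[OF T, of a] by linarith
    qed
    ultimately show "\<not> on ?T y" by simp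
  qed (use a nxt_on[OF T] in auto)
  fix x
  consider "x mod N = a mod N" | "x mod N = b mod N" | "x mod N \<noteq> a mod N" "x mod N \<noteq> b mod N" by blast
  then show "(cyc T \<circ> refl a b) x = cyc ?T x"
  proof cases
    case 1
    then obtain q where q: "x = a + q * N" by (rule mod_eqE)
    have "refl a b x = b + q * N" using q by (simp add: refl_def)
    then show ?thesis using q n1 nxt_shift[OF T', of a q] a b by (simp add: cyc_def)
  next
    case 2
    then obtain q where q: "x = b + q * N" by (rule mod_eqE)
    have "refl a b x = a + q * N" using q ab by (simp add: refl_def)
    then show ?thesis using q n2 nxt_shift[OF T', of b q] nxt_shift[OF T, of a q] a b by (simp add: cyc_def)
  next
    case 3
    then have rx: "refl a b x = x" by (simp add: refl_def)
    show ?thesis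
    proof (cases "on T x")
      case True
      have "nxt ?T x = nxt T x"
      proof (rule nxt_eqI)
        fix y assume y: "x < y" "y < nxt T x"
        have "y mod N \<noteq> b mod N"
        proof
          assume "y mod N = b mod N"
          then obtain q where q: "y = b + q * N" by (rule mod_eqE)
          have "a + q * N = x"
            using prev_unique[of "a + q * N" T y x] a q y True nxt_shift[OF T, of a q] by simp
          then show False using 3 by auto
        qed
        then show "\<not> on ?T y" using nxt_between[OF y] by simp
      qed (use nxt_gt nxt_on[OF T] in auto)
      then show ?thesis using rx True by (simp add: cyc_def)
    next
      case False
      then show ?thesis using rx 3 by (simp add: cyc_def)
    qed
  qed
qed

lemma simple_cyc:
  assumes T: "is_support T" "n \<noteq> 1" and M: "on T (M + 1)" "on T (M + 2)"
  shows "is_support (T - {(M + 1) mod N})" "simple_refl n M \<circ> cyc T = cyc (T - {(M + 1) mod N})"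
proof -
  let ?T = "T - {(M + 1) mod N}"
  have ne: "(M + 1) mod N \<noteq> (M + 2) mod N" using mod_Suc_ne[OF T(2), of "M + 1"] by (simp add: add.assoc)
  then have "(M + 2) mod N \<in> ?T" using M by simp
  then show T': "is_support ?T" using T by (auto simp: is_support_def)
  obtain p where p: "on T p" "p \<le> M" "M < nxt T p" using prev_ex[OF T(1)] by blast
  have np: "nxt T p = M + 1" using nxt_le_on[OF M(1), of p] p by simp
  have nM: "nxt T (M + 1) = M + 2" using M by (intro nxt_eqI) auto
  have pM: "p mod N \<noteq> (M + 1) mod N"
  proof
    assume "p mod N = (M + 1) mod N"
    then obtain q where q: "p = M + 1 + q * N" by (rule mod_eqE)
    then have "M + 1 = M + 2 + q * N" using np nM nxt_shift[OF T(1), of "M + 1" q] by simp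
    then have "q * N = - 1" by simp
    then have "N dvd 1" by (metis dvd_minus_iff dvd_triv_right)
    then show False using T(2) N_pos by simp
  qed
  have pT: "on ?T p" using p pM by simp
  have "nxt ?T p > M + 1"
  proof (rule ccontr)
    assume "\<not> ?thesis"
    then have "nxt ?T p \<noteq> M + 1 \<Longrightarrow> nxt ?T p < nxt T p" using np by simp
    moreover have "on ?T (nxt ?T p)" using nxt_on[OF T'] .
    moreover from this have "nxt ?T p \<noteq> M + 1" by auto
    ultimately show False using nxt_between[OF nxt_gt[of p ?T], of T] by simp
  qed
  then have 1: "cyc ?T \<circ> refl p (M + 1) = cyc T"
    using cyc_refl[OF T' pT, of "M + 1"] p M(1) by (simp add: insert_absorb)
  have cP: "cyc T p = M" "cyc T (M + 1) = M + 1" using p np M nM by (auto simp: cyc_def)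
  have "simple_refl n M \<circ> cyc T = cyc T \<circ> refl p (M + 1)"
    using refl_conj[OF cyc_P[OF T(1)], of p "M + 1"] cP simple_refl_eq[OF T(2)] by simp
  also have "\<dots> = cyc ?T" unfolding 1[symmetric] using pM by (simp add: o_assoc[symmetric])
  finally show "simple_refl n M \<circ> cyc T = cyc ?T" .
qed

lemma comp_list_simps [simp]: "comp_list [] = id" "comp_list (f # fs) = f \<circ> comp_list fs"
  by (simp_all add: comp_list_def)

lemma cyc_word_imp:
  fixes w :: "int list"
  assumes "set w \<subseteq> {0..<N}" "distinct w"
    "\<forall>a < length w. \<forall>b < length w. w ! a = (w ! b + 1) mod N \<longrightarrow> a < b"
  defines "T \<equiv> \<lambda>w. {t \<in> {0..<N}. (t - 1) mod N \<notin> set w}"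
  shows "is_support (T w) \<and> comp_list (map (simple_refl n) w) = cyc (T w)"
  using assms(1-3)
proof (induction w)
  case Nil
  have "T [] = {0..<N}" by (auto simp: T_def)
  then show ?case using cyc_full N_pos by (simp add: is_support_def)
next
  case (Cons M w)
  have IH: "is_support (T w) \<and> comp_list (map (simple_refl n) w) = cyc (T w)"
  proof (rule Cons.IH)
    show "\<forall>a<length w. \<forall>b<length w. w ! a = (w ! b + 1) mod N \<longrightarrow> a < b"
    proof (intro allI impI)
      fix a b assume "a < length w" "b < length w" "w ! a = (w ! b + 1) mod N"
      then show "a < b" using Cons.prems(3)[rule_format, of "Suc a" "Suc b"] by simp
    qed
  qed (use Cons.prems in auto)
  have M: "0 \<le> M" "M < N" "M \<notin> set w" using Cons.prems by auto
  have n1: "n \<noteq> 1"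
  proof
    assume "n = 1" then show False using Cons.prems(3)[rule_format, of 0 0] M by simp
  qed
  have M1: "(M + 1) mod N \<notin> set w"
  proof
    assume "(M + 1) mod N \<in> set w"
    then obtain a where "a < length w" "w ! a = (M + 1) mod N" by (auto simp: in_set_conv_nth)
    then show False using Cons.prems(3)[rule_format, of "Suc a" 0] by simp
  qed
  have "on (T w) (M + 1)" "on (T w) (M + 2)"
    using M M1 N_pos by (auto simp: T_def mod_simps add.commute)
  note * = simple_cyc[OF conjunct1[OF IH] n1 this]
  have "T (M # w) = T w - {(M + 1) mod N}"
  proof -
    have "(t - 1) mod N = M \<longleftrightarrow> t = (M + 1) mod N" if "t \<in> {0..<N}" for t
    proof
      assume "(t - 1) mod N = M"
      then have "(M + 1) mod N = t mod N" by (metis mod_add_left_eq diff_add_cancel)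
      then show "t = (M + 1) mod N" using that by simp
    next
      assume "t = (M + 1) mod N"
      then show "(t - 1) mod N = M" using M by (simp add: mod_simps)
    qed
    then show ?thesis by (auto simp: T_def)
  qed
  then show ?case using * IH by simp
qed

lemma cyc_imp_word:
  assumes "is_support T"
  shows "\<exists>w. set w = {l \<in> {0..<N}. \<not> on T (l + 1)} \<and> distinct w \<and>
    (\<forall>a < length w. \<forall>b < length w. w ! a = (w ! b + 1) mod N \<longrightarrow> a < b) \<and>
    cyc T = comp_list (map (simple_refl n) w)"
  using assms
proof (induction "n - card T" arbitrary: T)
  case 0
  have "T = {0..<N}"
  proof (rule card_subset_eq)
    show "T \<subseteq> {0..<N}" using 0(2) by (simp add: is_support_def)
    have "card T = n" using card_is_support(2)[OF 0(2)] 0(1) by linarith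
    then show "card T = card {0..<N}" by simp
  qed simp
  then show ?case using cyc_full N_pos by (intro exI[of _ "[]"]) auto
next
  case (Suc m)
  note T = Suc.prems
  have "T \<noteq> {0..<N}" using Suc.hyps(2) by auto
  then obtain b0 where b0: "\<not> on T b0" using T unfolding is_support_def
    by (metis atLeastLessThan_iff mod_pos_pos_trivial subsetI subset_antisym)
  define b where "b = nxt T b0 - 1"
  have b: "\<not> on T b"
  proof (cases "b = b0")
    case False
    then show ?thesis using nxt_between[of b0 b T] nxt_gt[of b0 T] by (simp add: b_def)
  qed (use b0 in simp)
  have "on T (b + 1)" using nxt_on[OF T, of b0] by (simp add: b_def)
  note b = b this
  define M where "M = (b - 1) mod N"
  have n1: "n \<noteq> 1"
  proof
    assume "n = 1" then show False using b by simp
  qed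
  define T' where "T' = insert (b mod N) T"
  have T': "is_support T'" unfolding T'_def using is_support_insert[OF T] .
  have "card T' = Suc (card T)" using b card_is_support[OF T] by (simp add: T'_def)
  then have "m = n - card T'" using Suc.hyps(2) by simp
  from Suc.hyps(1)[OF this T'] obtain w where
    w: "set w = {l \<in> {0..<N}. \<not> on T' (l + 1)}" "distinct w"
    "\<forall>a < length w. \<forall>b < length w. w ! a = (w ! b + 1) mod N \<longrightarrow> a < b"
    "cyc T' = comp_list (map (simple_refl n) w)" by blast
  have Mb: "(M + 1) mod N = b mod N" "(M + 2) mod N = (b + 1) mod N" "0 \<le> M" "M < N"
    using N_pos by (auto simp: M_def mod_simps add.commute)
  have TT: "T' - {(M + 1) mod N} = T" using b Mb by (simp add: T'_def)
  have c1: "cyc T = simple_refl n M \<circ> cyc T'"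
    using simple_cyc[OF T' n1, of M] Mb b TT by (simp add: T'_def)
  have c2: "set (M # w) = {l \<in> {0..<N}. \<not> on T (l + 1)}"
  proof -
    have *: "l = M" if "l \<in> {0..<N}" "(l + 1) mod N = b mod N" for l
    proof -
      have "(l + 1 - 1) mod N = (b - 1) mod N" using that(2) by (rule mod_diff_cong) simp
      then show "l = M" using that by (simp add: M_def)
    qed
    show ?thesis
    proof (rule Set.set_eqI)
      fix l
      show "l \<in> set (M # w) \<longleftrightarrow> l \<in> {l \<in> {0..<N}. \<not> on T (l + 1)}"
      proof (cases "l = M")
        case True
        then show ?thesis using Mb b by simp
      next
        case False
        then have "l \<in> set (M # w) \<longleftrightarrow> l \<in> {0..<N} \<and> \<not> on T' (l + 1)" by (simp add: w(1))
        then show ?thesis using *[of l] False unfolding T'_def by blast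
      qed
    qed
  qed
  have c3: "M \<notin> set w" using w(1) Mb by (simp add: T'_def)
  have c4: "\<forall>a < length (M # w). \<forall>c < length (M # w). (M # w) ! a = ((M # w) ! c + 1) mod N \<longrightarrow> a < c"
  proof (intro allI impI)
    fix a c assume ac: "a < length (M # w)" "c < length (M # w)" "(M # w) ! a = ((M # w) ! c + 1) mod N"
    show "a < c"
    proof (cases c)
      case 0
      then have "(M # w) ! a = (M + 1) mod N" using ac by simp
      moreover have "(M + 1) mod N \<noteq> M" using mod_Suc_ne[OF n1, of M] Mb by auto
      moreover have "(M + 1) mod N \<notin> set w" using w(1) Mb b by (simp add: T'_def mod_simps add.assoc)
      ultimately show ?thesis using ac(1) by (cases a) (auto dest: nth_mem)
    next
      case (Suc c')
      then show ?thesis using ac w(3)[rule_format, of "a - 1" c'] by (cases a) auto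
    qed
  qed
  have "distinct (M # w)" using c3 w(2) by simp
  moreover have "cyc T = comp_list (map (simple_refl n) (M # w))" using c1 w(4) by simp
  ultimately show ?case using c2 c4 by blast
qed

lemma cyc_decreasing_iff: "cyc_decreasing n f \<longleftrightarrow> (\<exists>T. is_support T \<and> f = cyc T)"
proof
  assume "cyc_decreasing n f"
  then show "\<exists>T. is_support T \<and> f = cyc T" unfolding cyc_decreasing_def using cyc_word_imp by blast
next
  assume "\<exists>T. is_support T \<and> f = cyc T"
  then obtain T where T: "is_support T" "f = cyc T" by blast
  from cyc_imp_word[OF T(1)] T(2) show "cyc_decreasing n f"
    unfolding cyc_decreasing_def by (metis (no_types, lifting) mem_Collect_eq subsetI)
qed

lemma displ_cyc: assumes "is_support T" shows "displ (cyc T) = 0"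
proof -
  have "comp_list (map (simple_refl n) w) \<in> P \<and> displ (comp_list (map (simple_refl n) w)) = 0" for w
  proof (induction w)
    case Nil
    show ?case using P_id displ_id by (simp only: list.map comp_list_simps)
  next
    case (Cons a w)
    then show ?case using P_comp[OF simple_refl_P] displ_comp[OF simple_refl_P] displ_simple_refl
      by (simp only: list.map comp_list_simps simp_thms add_0)
  qed
  then show ?thesis using cyc_imp_word[OF assms] by metis
qed

end

section \<open>The ideal generated by the complete homogeneous polynomials\<close>

abbreviation lkp :: "('a \<Rightarrow>\<^sub>0 'b::zero) \<Rightarrow> 'a \<Rightarrow> 'b" where "lkp \<equiv> Poly_Mapping.lookup"

definition var :: "nat \<Rightarrow> int_mpoly" where
  "var i = Poly_Mapping.single (Poly_Mapping.single i 1) 1"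

definition expv :: "nat \<Rightarrow> (nat \<Rightarrow> nat) \<Rightarrow> (nat \<Rightarrow>\<^sub>0 nat)" where
  "expv k e = (\<Sum>i<k. Poly_Mapping.single i (e i))"

lemma lookup_expv: "lkp (expv k e) i = (if i < k then e i else 0)"
  by (simp add: expv_def lookup_sum lookup_single when_def)

lemma lookup_single_mult:
  fixes p :: "('a::cancel_comm_monoid_add) \<Rightarrow>\<^sub>0 int"
  shows "lkp (Poly_Mapping.single a c * p) (a + b) = c * lkp p b"
    "(\<nexists>b. \<alpha> = a + b) \<Longrightarrow> lkp (Poly_Mapping.single a c * p) \<alpha> = 0"
proof -
  have *: "lkp (Poly_Mapping.single a c * p) \<alpha> = c * (\<Sum>q. lkp p q when \<alpha> = a + q)" for \<alpha>
    by (simp add: lookup_mult lookup_single when_mult)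
  show "lkp (Poly_Mapping.single a c * p) (a + b) = c * lkp p b"
    unfolding * by simp
  show "(\<nexists>b. \<alpha> = a + b) \<Longrightarrow> lkp (Poly_Mapping.single a c * p) \<alpha> = 0"
    unfolding * by simp
qed

lemma lookup_monom_mult:
  fixes p :: int_mpoly
  shows "lkp (Poly_Mapping.single a c * p) \<alpha> = (if \<forall>i. lkp a i \<le> lkp \<alpha> i then c * lkp p (\<alpha> - a) else 0)"
proof (cases "\<forall>i. lkp a i \<le> lkp \<alpha> i")
  case True
  then have "\<alpha> = a + (\<alpha> - a)"
    by (intro poly_mapping_eqI) (simp add: lookup_add lookup_minus)
  then show ?thesis using True lookup_single_mult(1)[of a c p "\<alpha> - a"] by simp
next
  case False
  then have "\<nexists>b. \<alpha> = a + b" by (auto simp: lookup_add)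
  from lookup_single_mult(2)[OF this, of c p] show ?thesis using False by (simp only: if_False)
qed

lemma prod_var: "(\<Prod>i=0..<k. var i ^ e i) = Poly_Mapping.single (expv k e) 1"
proof (induction k)
  case (Suc k)
  have "var k ^ m = Poly_Mapping.single (Poly_Mapping.single k m) 1" for m
    by (induction m) (simp_all add: var_def mult_single single_add[symmetric])
  then show ?case using Suc by (simp add: mult_single expv_def)
qed (simp add: expv_def)

subsection \<open>Alternants\<close>

definition alternant :: "nat \<Rightarrow> (nat \<Rightarrow> nat) \<Rightarrow> int_mpoly" where
  "alternant k \<gamma> = det (mat k k (\<lambda>(i, j). var i ^ \<gamma> j))"

lemma alternant_sum:
  "alternant k \<gamma> = (\<Sum>\<sigma> | \<sigma> permutes {0..<k}. Poly_Mapping.single (expv k (\<lambda>i. \<gamma> (\<sigma> i))) (sign \<sigma>))"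
proof -
  have "of_int (sign \<sigma>) * (\<Prod>i = 0..<k. mat k k (\<lambda>(i, j). var i ^ \<gamma> j) $$ (i, \<sigma> i))
      = Poly_Mapping.single (expv k (\<lambda>i. \<gamma> (\<sigma> i))) (sign \<sigma>)" if "\<sigma> permutes {0..<k}" for \<sigma>
  proof -
    have "(\<Prod>i = 0..<k. mat k k (\<lambda>(i, j). var i ^ \<gamma> j) $$ (i, \<sigma> i)) = (\<Prod>i = 0..<k. var i ^ \<gamma> (\<sigma> i))"
      using permutes_in_image[OF that] by (intro prod.cong) auto
    also have "\<dots> = Poly_Mapping.single (expv k (\<lambda>i. \<gamma> (\<sigma> i))) 1" by (rule prod_var)
    finally show ?thesis
      by (simp add: mult_single flip: single_of_int)
  qed
  then show ?thesis unfolding alternant_def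
    by (subst det_def'[of _ k]) (simp, intro sum.cong refl, simp)
qed

lemma lookup_alternant:
  "lkp (alternant k \<gamma>) \<alpha> = (\<Sum>\<sigma> | \<sigma> permutes {0..<k}. if \<alpha> = expv k (\<lambda>i. \<gamma> (\<sigma> i)) then sign \<sigma> else 0)"
  by (simp add: alternant_sum lookup_sum lookup_single when_def eq_commute[of \<alpha>])

lemma lookup_mult_alternant:
  "lkp (p * alternant k id) \<alpha> = (\<Sum>\<sigma> | \<sigma> permutes {0..<k}.
     if \<forall>i<k. \<sigma> i \<le> lkp \<alpha> i then sign \<sigma> * lkp p (\<alpha> - expv k \<sigma>) else 0)"
proof -
  have "(\<forall>i. lkp (expv k \<sigma>) i \<le> lkp \<alpha> i) \<longleftrightarrow> (\<forall>i<k. \<sigma> i \<le> lkp \<alpha> i)" for \<sigma>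
    by (auto simp: lookup_expv)
  then show ?thesis
    by (simp add: alternant_sum sum_distrib_left lookup_sum mult.commute[of p] lookup_monom_mult)
qed

definition overflow :: "nat \<Rightarrow> int_mpoly \<Rightarrow> bool" where
  "overflow n p \<longleftrightarrow> (\<forall>\<alpha>. (\<forall>i. lkp \<alpha> i < n) \<longrightarrow> lkp p \<alpha> = 0)"

lemma overflow_mult: assumes "overflow n p" shows "overflow n (s * p)"
  unfolding overflow_def
proof (intro allI impI)
  fix \<alpha> :: "nat \<Rightarrow>\<^sub>0 nat" assume \<alpha>: "\<forall>i. lkp \<alpha> i < n"
  have "lkp p q = 0" if "\<alpha> = l + q" for l q
  proof -
    have "lkp q i < n" for i using \<alpha>[rule_format, of i] that by (simp add: lookup_add)
    then show ?thesis using assms by (simp add: overflow_def)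
  qed
  then have "(lkp p q when \<alpha> = l + q) = 0" for l q by (simp add: when_def)
  then show "lkp (s * p) \<alpha> = 0" by (simp add: lookup_mult)
qed

lemma overflow_add: "overflow n p \<Longrightarrow> overflow n q \<Longrightarrow> overflow n (p + q)"
  by (simp add: overflow_def lookup_add)

lemma overflow_uminus: "overflow n p \<Longrightarrow> overflow n (- p)"
  by (simp add: overflow_def)

subsection \<open>The Jacobi--Trudi identity\<close>

lemma lookup_complete_hom:
  "lkp (complete_hom k d) \<alpha> = (if Poly_Mapping.keys \<alpha> \<subseteq> {..<k} \<and> (\<Sum>i<k. lkp \<alpha> i) = d then 1 else 0)"
  unfolding complete_hom_def using finite_exponents[of k d]
  by (simp add: lookup_sum lookup_single when_def)

lemma complete_hom_Suc:
  "complete_hom (Suc k) d = complete_hom k d + (if d = 0 then 0 else var k * complete_hom (Suc k) (d - 1))"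
proof (rule poly_mapping_eqI)
  fix \<alpha> :: "nat \<Rightarrow>\<^sub>0 nat"
  let ?e = "Poly_Mapping.single k 1 :: nat \<Rightarrow>\<^sub>0 nat"
  have keys_iff: "Poly_Mapping.keys \<beta> \<subseteq> {..<m} \<longleftrightarrow> (\<forall>i\<ge>m. lkp \<beta> i = 0)" for \<beta> :: "nat \<Rightarrow>\<^sub>0 nat" and m
    unfolding subset_iff in_keys_iff lessThan_iff by (meson not_le)
  have le: "(\<forall>i. lkp ?e i \<le> lkp \<alpha> i) \<longleftrightarrow> lkp \<alpha> k \<ge> 1"
    by (auto simp: lookup_single when_def)
  have xk: "lkp (var k * q) \<alpha> = (if lkp \<alpha> k = 0 then 0 else lkp q (\<alpha> - ?e))" for q
    using le unfolding var_def lookup_monom_mult by auto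
  show "lkp (complete_hom (Suc k) d) \<alpha>
      = lkp (complete_hom k d + (if d = 0 then 0 else var k * complete_hom (Suc k) (d - 1))) \<alpha>"
  proof (cases "lkp \<alpha> k = 0")
    case True
    have "(\<forall>i\<ge>Suc k. lkp \<alpha> i = 0) \<longleftrightarrow> (\<forall>i\<ge>k. lkp \<alpha> i = 0)"
      using True by (metis Suc_leD le_antisym not_less_eq_eq)
    then show ?thesis using True
      by (simp add: lookup_complete_hom lookup_add keys_iff xk)
  next
    case False
    have 1: "\<not> (\<forall>i\<ge>k. lkp \<alpha> i = 0)" using False by auto
    have 2: "(\<forall>i\<ge>Suc k. lkp (\<alpha> - ?e) i = 0) \<longleftrightarrow> (\<forall>i\<ge>Suc k. lkp \<alpha> i = 0)"
      by (auto simp: lookup_minus lookup_single when_def)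
    have "(\<Sum>i<k. lkp (\<alpha> - ?e) i) = (\<Sum>i<k. lkp \<alpha> i)"
      by (rule sum.cong) (auto simp: lookup_minus lookup_single when_def)
    then have 3: "(\<Sum>i<Suc k. lkp (\<alpha> - ?e) i) = (\<Sum>i<Suc k. lkp \<alpha> i) - 1" "(\<Sum>i<Suc k. lkp \<alpha> i) \<ge> 1"
      using False by (simp_all add: lookup_minus)
    have 4: "d \<noteq> 0 \<Longrightarrow> (\<Sum>i<Suc k. lkp \<alpha> i) - 1 = d - 1 \<longleftrightarrow> (\<Sum>i<Suc k. lkp \<alpha> i) = d"
      "d = 0 \<Longrightarrow> (\<Sum>i<Suc k. lkp \<alpha> i) \<noteq> d" using 3(2) by arith+
    show ?thesis
    proof (cases "d = 0")
      case True
      then show ?thesis unfolding lookup_add lookup_complete_hom keys_iff using 1 4(2) by simp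
    next
      case d: False
      have "lkp (complete_hom k d + (if d = 0 then 0 else var k * complete_hom (Suc k) (d - 1))) \<alpha>
          = lkp (complete_hom (Suc k) (d - 1)) (\<alpha> - ?e)"
        using d False 1 by (simp add: lookup_add xk lookup_complete_hom[of k] keys_iff)
      also have "\<dots> = lkp (complete_hom (Suc k) d) \<alpha>"
        unfolding lookup_complete_hom keys_iff 2 3(1) 4(1)[OF d] ..
      finally show ?thesis by simp
    qed
  qed
qed

lemma complete_hom_0: "complete_hom 0 d = (if d = 0 then 1 else 0)"
  by (rule poly_mapping_eqI) (auto simp: lookup_complete_hom lookup_one when_def)

lemma complete_hom_zero: "complete_hom k 0 = 1"
proof (induction k)
  case (Suc k)
  then show ?case using complete_hom_Suc[of k 0] by simp
qed (simp add: complete_hom_0)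

lemma complete_hom_gf:
  "Abs_fps (complete_hom k) * (\<Prod>j<k. 1 - fps_const (var j) * fps_X) = 1"
proof (induction k)
  case 0
  have "Abs_fps (complete_hom 0) = 1"
    by (rule fps_ext) (simp add: complete_hom_0)
  then show ?case by simp
next
  case (Suc k)
  have "Abs_fps (complete_hom (Suc k)) * (1 - fps_const (var k) * fps_X) = Abs_fps (complete_hom k)"
  proof (rule fps_ext)
    fix d
    have "Abs_fps (complete_hom (Suc k)) * (1 - fps_const (var k) * fps_X)
      = Abs_fps (complete_hom (Suc k)) - fps_X * (fps_const (var k) * Abs_fps (complete_hom (Suc k)))"
      by (simp add: algebra_simps)
    then show "fps_nth (Abs_fps (complete_hom (Suc k)) * (1 - fps_const (var k) * fps_X)) d = fps_nth (Abs_fps (complete_hom k)) d"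
      using complete_hom_Suc[of k d] by (cases d) simp_all
  qed
  then show ?case using Suc by (simp add: mult.assoc[symmetric] mult.commute mult.left_commute)
qed

lemma prod_linear_fps_nth:
  assumes "finite S" "l > card S"
  shows "fps_nth (\<Prod>j\<in>S. 1 - fps_const (c j :: 'a :: comm_ring_1) * fps_X) l = 0"
  using assms
proof (induction S arbitrary: l rule: finite_induct)
  case (insert a S)
  let ?p = "\<Prod>j\<in>S. 1 - fps_const (c j) * fps_X"
  have "(\<Prod>j\<in>insert a S. 1 - fps_const (c j) * fps_X) = (1 - fps_const (c a) * fps_X) * ?p"
    using insert.hyps by (rule prod.insert)
  also have "\<dots> = ?p - fps_X * (fps_const (c a) * ?p)"
    by (simp add: algebra_simps)
  finally have e: "(\<Prod>j\<in>insert a S. 1 - fps_const (c j) * fps_X) = ?p - fps_X * (fps_const (c a) * ?p)" .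
  obtain m where m: "l = Suc m" "m > card S" "l > card S"
    using insert.prems insert.hyps by (cases l) auto
  then show ?case unfolding e using insert.IH[of m] insert.IH[of l] by simp
qed simp

definition h_entry :: "nat \<Rightarrow> nat \<Rightarrow> nat \<Rightarrow> int_mpoly" where
  "h_entry k m l = (if l \<le> m then complete_hom k (m - l) else 0)"

definition JT :: "nat \<Rightarrow> (nat \<Rightarrow> nat) \<Rightarrow> int_mpoly" where
  "JT k \<gamma> = det (mat k k (\<lambda>(l, j). h_entry k (\<gamma> j) l))"

definition elem_omit :: "nat \<Rightarrow> nat \<Rightarrow> nat \<Rightarrow> int_mpoly" where
  "elem_omit k i l = fps_nth (\<Prod>j\<in>{..<k} - {i}. 1 - fps_const (var j) * fps_X) l"

lemma var_power_expand:
  assumes "i < k" shows "var i ^ m = (\<Sum>l<k. elem_omit k i l * h_entry k m l)"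
proof -
  let ?H = "Abs_fps (complete_hom k)" and ?L = "1 - fps_const (var i) * fps_X"
  let ?F = "\<Prod>j\<in>{..<k} - {i}. 1 - fps_const (var j) * fps_X"
  let ?G = "Abs_fps (\<lambda>m. var i ^ m)"
  have G: "?L * ?G = 1"
  proof (rule fps_ext)
    fix d
    have "?L * ?G = ?G - fps_X * (fps_const (var i) * ?G)" by (simp add: algebra_simps)
    then show "fps_nth (?L * ?G) d = fps_nth 1 d" by (cases d) simp_all
  qed
  have "(\<Prod>j<k. 1 - fps_const (var j) * fps_X) = ?L * ?F"
    using assms by (intro prod.remove) auto
  then have "?H * (?L * ?F) = 1" using complete_hom_gf[of k] by simp
  then have "(?H * (?L * ?F)) * ?G = ?G" by simp
  moreover have "(?H * (?L * ?F)) * ?G = ?F * ?H * (?L * ?G)" by (simp only: mult_ac)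
  ultimately have "?F * ?H = ?G" by (simp only: G mult_1_right)
  then have "var i ^ m = fps_nth (?F * ?H) m" by simp
  also have "\<dots> = (\<Sum>l=0..m. elem_omit k i l * complete_hom k (m - l))"
    by (simp add: fps_mult_nth elem_omit_def)
  also have "\<dots> = (\<Sum>l=0..m. elem_omit k i l * h_entry k m l)"
    by (rule sum.cong) (auto simp: h_entry_def)
  also have "\<dots> = (\<Sum>l\<in>{0..m} \<union> {..<k}. elem_omit k i l * h_entry k m l)"
    by (rule sum.mono_neutral_left) (auto simp: h_entry_def)
  also have "\<dots> = (\<Sum>l<k. elem_omit k i l * h_entry k m l)"
  proof (rule sum.mono_neutral_right)
    have "elem_omit k i l = 0" if "l \<ge> k" for l
      unfolding elem_omit_def using that assms by (intro prod_linear_fps_nth) auto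
    then show "\<forall>l\<in>{0..m} \<union> {..<k} - {..<k}. elem_omit k i l * h_entry k m l = 0" by simp
  qed auto
  finally show ?thesis .
qed

lemma alternant_factor:
  "alternant k \<gamma> = det (mat k k (\<lambda>(i, l). elem_omit k i l)) * JT k \<gamma>"
proof -
  have "mat k k (\<lambda>(i, j). var i ^ \<gamma> j) = mat k k (\<lambda>(i, l). elem_omit k i l) * mat k k (\<lambda>(l, j). h_entry k (\<gamma> j) l)"
    by (rule eq_matI) (auto simp: scalar_prod_def var_power_expand atLeast0LessThan)
  then show ?thesis unfolding alternant_def JT_def by (simp add: det_mult[of _ k])
qed

lemma JT_triangular:
  assumes "\<And>l j. j < l \<Longrightarrow> l < k \<Longrightarrow> \<gamma> j < l" and "\<And>j. j < k \<Longrightarrow> j \<le> \<gamma> j"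
  shows "JT k \<gamma> = (\<Prod>j<k. complete_hom k (\<gamma> j - j))"
proof -
  let ?A = "mat k k (\<lambda>(l, j). h_entry k (\<gamma> j) l)"
  have "upper_triangular ?A" unfolding upper_triangular_def
  proof (intro allI impI)
    fix l j assume "j < l" "l < dim_row ?A"
    then show "?A $$ (l, j) = 0" using assms(1)[of j l] by (simp add: h_entry_def)
  qed
  then have "JT k \<gamma> = prod_list (diag_mat ?A)" unfolding JT_def by (rule det_upper_triangular) auto
  also have "diag_mat ?A = map (\<lambda>j. complete_hom k (\<gamma> j - j)) [0..<k]"
    using assms(2) by (auto simp: diag_mat_def h_entry_def)
  also have "prod_list \<dots> = (\<Prod>j<k. complete_hom k (\<gamma> j - j))"
    by (simp add: prod.list_conv_set_nth atLeast0LessThan)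
  finally show ?thesis .
qed

lemma jacobi_trudi: "alternant k \<gamma> = JT k \<gamma> * alternant k id"
proof -
  have "JT k id = 1" by (subst JT_triangular) (auto simp: complete_hom_zero)
  then show ?thesis using alternant_factor[of k \<gamma>] alternant_factor[of k id] by simp
qed

subsection \<open>Characterization of the ideal\<close>

lemma sym_ring_simps [simp]:
  "carrier (sym_ring k) = sym_polys k" "p \<oplus>\<^bsub>sym_ring k\<^esub> q = p + q" "p \<otimes>\<^bsub>sym_ring k\<^esub> q = p * q"
  "\<zero>\<^bsub>sym_ring k\<^esub> = 0" "\<one>\<^bsub>sym_ring k\<^esub> = 1"
  by (simp_all add: sym_ring_def)

lemma sym_polys_add: "p \<in> sym_polys k \<Longrightarrow> q \<in> sym_polys k \<Longrightarrow> p + q \<in> sym_polys k"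
  using cring.cring_simprules(1)[OF sym_ring_cring[of k], of p q] by simp

lemma sym_polys_0: "0 \<in> sym_polys k"
  using cring.cring_simprules(2)[OF sym_ring_cring[of k]] by simp

lemma sym_polys_1: "1 \<in> sym_polys k"
  using cring.cring_simprules(6)[OF sym_ring_cring[of k]] by simp

lemma sym_polys_uminus: "p \<in> sym_polys k \<Longrightarrow> - p \<in> sym_polys k"
  by (auto simp: sym_polys_def)

lemma sym_polys_sum: "(\<And>x. x \<in> A \<Longrightarrow> f x \<in> sym_polys k) \<Longrightarrow> sum f A \<in> sym_polys k"
  by (induction A rule: infinite_finite_induct) (simp_all add: sym_polys_0 sym_polys_add)

lemma sym_polys_prod: "(\<And>x. x \<in> A \<Longrightarrow> f x \<in> sym_polys k) \<Longrightarrow> prod f A \<in> sym_polys k"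
  by (induction A rule: infinite_finite_induct) (simp_all add: sym_polys_1 sym_polys_mult)

lemma sym_polys_sign: "of_int (sign \<sigma>) \<in> sym_polys k"
  by (simp add: sign_def sym_polys_1 sym_polys_uminus)

lemma sym_ring_ring: "ring (sym_ring k)"
  using sym_ring_cring cring.axioms(1) by blast

lemma sym_ring_minus: assumes "p \<in> sym_polys k" shows "\<ominus>\<^bsub>sym_ring k\<^esub> p = - p"
proof -
  interpret ring "sym_ring k" by (rule sym_ring_ring)
  show ?thesis using minus_equality[of "- p" p] assms sym_polys_uminus by simp
qed

lemma JT_sym: "JT k \<gamma> \<in> sym_polys k"
proof -
  have "mat k k (\<lambda>(l, j). h_entry k (\<gamma> j) l) $$ (i, \<sigma> i) \<in> sym_polys k"
    if "\<sigma> permutes {0..<k}" "i < k" for \<sigma> i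
    using permutes_in_image[OF that(1), of i] that(2) complete_hom_sym sym_polys_0 by (auto simp: h_entry_def)
  then show ?thesis unfolding JT_def
    by (subst det_def'[of _ k])
       (auto intro!: sym_polys_sum sym_polys_mult sym_polys_sign sym_polys_prod)
qed

lemma lookup_map_key: "\<pi> permutes {..<k} \<Longrightarrow> lkp (Poly_Mapping.map_key \<pi> \<alpha>) i = lkp \<alpha> (\<pi> i)"
  by (simp add: map_key.rep_eq permutes_inj)

definition asym :: "nat \<Rightarrow> int_mpoly \<Rightarrow> bool" where
  "asym k q \<longleftrightarrow> (\<forall>\<alpha>\<in>Poly_Mapping.keys q. Poly_Mapping.keys \<alpha> \<subseteq> {..<k}) \<and>
     (\<forall>\<pi>. \<pi> permutes {..<k} \<longrightarrow> (\<forall>\<alpha>. lkp q (Poly_Mapping.map_key \<pi> \<alpha>) = sign \<pi> * lkp q \<alpha>))"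

lemma keys_alternant:
  assumes "\<alpha> \<in> Poly_Mapping.keys (alternant k \<gamma>)"
  shows "\<exists>\<sigma>. \<sigma> permutes {0..<k} \<and> \<alpha> = expv k (\<lambda>i. \<gamma> (\<sigma> i))"
proof (rule ccontr)
  assume "\<not> ?thesis"
  then have "lkp (alternant k \<gamma>) \<alpha> = 0" unfolding lookup_alternant by (intro sum.neutral) auto
  then show False using assms by (simp add: in_keys_iff)
qed

lemma keys_expv: "Poly_Mapping.keys (expv k e) \<subseteq> {..<k}"
  by (auto simp: in_keys_iff lookup_expv split: if_splits)

lemma asym_mult_alternant:
  assumes p: "p \<in> sym_polys k" shows "asym k (p * alternant k id)"
  unfolding asym_def
proof (intro conjI ballI allI impI)
  fix \<alpha> assume "\<alpha> \<in> Poly_Mapping.keys (p * alternant k id)"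
  then obtain a b where ab: "\<alpha> = a + b" "a \<in> Poly_Mapping.keys p" "b \<in> Poly_Mapping.keys (alternant k id)"
    using keys_mult[of p "alternant k id"] by blast
  have "Poly_Mapping.keys a \<subseteq> {..<k}" using p ab by (auto simp: sym_polys_def)
  moreover have "Poly_Mapping.keys b \<subseteq> {..<k}" using keys_alternant[OF ab(3)] keys_expv by blast
  ultimately show "Poly_Mapping.keys \<alpha> \<subseteq> {..<k}"
    using Poly_Mapping.keys_add[of a b] ab(1) by blast
next
  fix \<pi> and \<alpha> :: "nat \<Rightarrow>\<^sub>0 nat" assume \<pi>: "\<pi> permutes {..<k}"
  let ?m = "Poly_Mapping.map_key \<pi> :: (nat \<Rightarrow>\<^sub>0 nat) \<Rightarrow> _"
  let ?S = "{\<sigma>. \<sigma> permutes {0..<k}}"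
  have \<pi>0: "\<pi> permutes {0..<k}" using \<pi> by (simp add: atLeast0LessThan)
  have sym: "lkp p (?m \<beta>) = lkp p \<beta>" for \<beta> using p \<pi> by (auto simp: sym_polys_def)
  define g where "g \<alpha> \<sigma> = (if \<forall>i<k. \<sigma> i \<le> lkp \<alpha> i then sign \<sigma> * lkp p (\<alpha> - expv k \<sigma>) else 0)" for \<alpha> \<sigma>
  have "g (?m \<alpha>) (\<tau> \<circ> \<pi>) = sign \<pi> * g \<alpha> \<tau>" if \<tau>: "\<tau> permutes {0..<k}" for \<tau>
  proof -
    have 1: "(\<forall>i<k. (\<tau> \<circ> \<pi>) i \<le> lkp (?m \<alpha>) i) \<longleftrightarrow> (\<forall>i<k. \<tau> i \<le> lkp \<alpha> i)"
    proof
      assume L: "\<forall>i<k. (\<tau> \<circ> \<pi>) i \<le> lkp (?m \<alpha>) i"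
      show "\<forall>i<k. \<tau> i \<le> lkp \<alpha> i"
      proof (intro allI impI)
        fix i assume "i < k"
        then obtain j where "j < k" "\<pi> j = i"
          using permutes_image[OF \<pi>] by (metis imageE lessThan_iff)
        then show "\<tau> i \<le> lkp \<alpha> i" using L lookup_map_key[OF \<pi>, of \<alpha> j] by auto
      qed
    next
      assume "\<forall>i<k. \<tau> i \<le> lkp \<alpha> i"
      then show "\<forall>i<k. (\<tau> \<circ> \<pi>) i \<le> lkp (?m \<alpha>) i"
        using permutes_in_image[OF \<pi>] by (auto simp: lookup_map_key[OF \<pi>])
    qed
    have 2: "?m \<alpha> - expv k (\<tau> \<circ> \<pi>) = ?m (\<alpha> - expv k \<tau>)"
      by (rule poly_mapping_eqI)
         (use permutes_in_image[OF \<pi>] in \<open>auto simp: lookup_minus lookup_map_key[OF \<pi>] lookup_expv\<close>)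
    have 3: "sign (\<tau> \<circ> \<pi>) = sign \<pi> * sign \<tau>"
      using sign_compose[of \<tau> \<pi>] \<tau> \<pi>0 permutation_permutes by (metis finite_atLeastLessThan mult.commute)
    show ?thesis unfolding g_def 1 2 3 sym by (auto simp only: if_True if_False mult.assoc mult_zero_right split: if_split)
  qed
  moreover have "sum (g (?m \<alpha>)) ?S = sum (\<lambda>\<tau>. g (?m \<alpha>) (\<tau> \<circ> \<pi>)) ?S"
    using sum_permutations_compose_right[OF \<pi>0, of "g (?m \<alpha>)"] by simp
  ultimately show "lkp (p * alternant k id) (?m \<alpha>) = sign \<pi> * lkp (p * alternant k id) \<alpha>"
    unfolding lookup_mult_alternant g_def[symmetric] by (simp add: sum_distrib_left)
qed

lemma ideal_Lambda: "ideal (Lambda_ideal m k) (sym_ring k)"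
  unfolding Lambda_ideal_def
  by (rule ring.genideal_ideal[OF sym_ring_ring]) (auto simp: complete_hom_sym)

lemma Lambda_ideal_gen: assumes "d > m" shows "complete_hom k d \<in> Lambda_ideal m k"
proof -
  have "{complete_hom k d | d. d > m} \<subseteq> Lambda_ideal m k"
    unfolding Lambda_ideal_def by (rule ring.genideal_self[OF sym_ring_ring]) (auto simp: complete_hom_sym)
  then show ?thesis using assms by blast
qed

lemma Lambda_ideal_mult: "p \<in> Lambda_ideal m k \<Longrightarrow> q \<in> sym_polys k \<Longrightarrow> q * p \<in> Lambda_ideal m k"
  using ideal.I_l_closed[OF ideal_Lambda, of p m k q] by simp

lemma Lambda_ideal_add: "p \<in> Lambda_ideal m k \<Longrightarrow> q \<in> Lambda_ideal m k \<Longrightarrow> p + q \<in> Lambda_ideal m k"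
  using additive_subgroup.a_closed[OF ideal.axioms(1)[OF ideal_Lambda], of p m k q] by simp

lemma Lambda_ideal_0: "0 \<in> Lambda_ideal m k"
  using additive_subgroup.zero_closed[OF ideal.axioms(1)[OF ideal_Lambda[of m k]]] by simp

lemma Lambda_ideal_sum: "(\<And>x. x \<in> A \<Longrightarrow> f x \<in> Lambda_ideal m k) \<Longrightarrow> sum f A \<in> Lambda_ideal m k"
  by (induction A rule: infinite_finite_induct) (simp_all add: Lambda_ideal_0 Lambda_ideal_add)

lemma JT_in_ideal:
  assumes k: "k \<le> n" and j: "j < k" "n \<le> \<gamma> j" shows "JT k \<gamma> \<in> Lambda_ideal (n - k) k"
proof -
  let ?A = "mat k k (\<lambda>(l, j). h_entry k (\<gamma> j) l)"
  have "of_int (sign \<sigma>) * (\<Prod>i = 0..<k. ?A $$ (i, \<sigma> i)) \<in> Lambda_ideal (n - k) k"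
    if \<sigma>: "\<sigma> permutes {0..<k}" for \<sigma>
  proof -
    obtain i where i: "i < k" "\<sigma> i = j" using j permutes_image[OF \<sigma>] by (metis imageE atLeastLessThan_iff zero_le)
    have "?A $$ (i, \<sigma> i) = complete_hom k (\<gamma> j - i)" using i j k by (simp add: h_entry_def)
    moreover have "\<gamma> j - i > n - k" using i j k by linarith
    ultimately have 1: "?A $$ (i, \<sigma> i) \<in> Lambda_ideal (n - k) k" using Lambda_ideal_gen by simp
    have 2: "(\<Prod>i \<in> {0..<k} - {i}. ?A $$ (i, \<sigma> i)) \<in> sym_polys k"
    proof (rule sym_polys_prod)
      fix l assume "l \<in> {0..<k} - {i}"
      then show "?A $$ (l, \<sigma> l) \<in> sym_polys k"
        using permutes_in_image[OF \<sigma>, of l] complete_hom_sym sym_polys_0 by (auto simp: h_entry_def)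
    qed
    have "(\<Prod>i = 0..<k. ?A $$ (i, \<sigma> i)) = ?A $$ (i, \<sigma> i) * (\<Prod>i \<in> {0..<k} - {i}. ?A $$ (i, \<sigma> i))"
      using i by (intro prod.remove) auto
    then show ?thesis
      using Lambda_ideal_mult[OF Lambda_ideal_mult[OF 1 2] sym_polys_sign[of \<sigma> k]] by (simp only: mult.commute)
  qed
  then show ?thesis unfolding JT_def by (subst det_def'[of _ k]) (auto intro!: Lambda_ideal_sum)
qed

lemma asym_overflow_factor:
  assumes k: "k \<le> n" and n: "0 < n"
  shows "asym k q \<Longrightarrow> overflow n q \<Longrightarrow> \<exists>s\<in>Lambda_ideal (n - k) k. q = s * alternant k id"
proof (induction "card (Poly_Mapping.keys q)" arbitrary: q rule: less_induct)
  case less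
  show ?case
  proof (cases "q = 0")
    case True
    then show ?thesis using Lambda_ideal_0 by (intro bexI[of _ 0]) auto
  next
    case False
    then obtain \<beta> where \<beta>: "\<beta> \<in> Poly_Mapping.keys q" by (meson ex_in_conv keys_eq_empty)
    define c where "c = lkp q \<beta>"
    define \<gamma> where "\<gamma> = lkp \<beta>"
    have c0: "c \<noteq> 0" using \<beta> by (simp add: c_def in_keys_iff)
    have kb: "Poly_Mapping.keys \<beta> \<subseteq> {..<k}" using less.prems(1) \<beta> by (simp add: asym_def)
    have as: "lkp q (Poly_Mapping.map_key \<pi> \<alpha>) = sign \<pi> * lkp q \<alpha>" if "\<pi> permutes {..<k}" for \<pi> \<alpha>
      using less.prems(1) that by (simp add: asym_def)
    have inj: "inj_on \<gamma> {..<k}"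
    proof (rule inj_onI, rule ccontr)
      fix i j assume ij: "i \<in> {..<k}" "j \<in> {..<k}" "\<gamma> i = \<gamma> j" "i \<noteq> j"
      let ?\<pi> = "Transposition.transpose i j"
      have \<pi>: "?\<pi> permutes {..<k}" using ij(1,2) by (rule permutes_swap_id)
      have "Poly_Mapping.map_key ?\<pi> \<beta> = \<beta>"
      proof (rule poly_mapping_eqI)
        fix l
        have "\<gamma> (?\<pi> l) = \<gamma> l" using ij(3) by (simp add: Transposition.transpose_def)
        then show "lkp (Poly_Mapping.map_key ?\<pi> \<beta>) l = lkp \<beta> l" by (simp only: lookup_map_key[OF \<pi>] \<gamma>_def)
      qed
      then have "c = sign ?\<pi> * c" using as[OF \<pi>, of \<beta>] by (simp add: c_def)
      moreover have "sign ?\<pi> = - 1" using ij(4) by (simp add: sign_swap_id)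
      ultimately show False using c0 by simp
    qed
    have ex: "expv k (\<lambda>i. \<gamma> (\<sigma> i)) = Poly_Mapping.map_key \<sigma> \<beta>" if "\<sigma> permutes {..<k}" for \<sigma>
    proof (rule poly_mapping_eqI)
      fix i
      have "lkp \<beta> i = 0" if "i \<ge> k" using kb that by (force simp: in_keys_iff subset_iff)
      moreover have "\<sigma> i = i" if "i \<ge> k" using permutes_not_in[OF \<open>\<sigma> permutes {..<k}\<close>, of i] that by simp
      ultimately show "lkp (expv k (\<lambda>i. \<gamma> (\<sigma> i))) i = lkp (Poly_Mapping.map_key \<sigma> \<beta>) i"
        by (simp add: lookup_expv lookup_map_key[OF that] \<gamma>_def)
    qed
    define q' where "q' = q - Poly_Mapping.single 0 c * alternant k \<gamma>"
    have lq': "lkp q' \<alpha> = lkp q \<alpha> - c * lkp (alternant k \<gamma>) \<alpha>" for \<alpha>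
      using lookup_monom_mult[of 0 c "alternant k \<gamma>" \<alpha>] by (simp add: q'_def lookup_minus)
    have on: "lkp (alternant k \<gamma>) (Poly_Mapping.map_key \<sigma> \<beta>) = sign \<sigma>" if \<sigma>: "\<sigma> permutes {..<k}" for \<sigma>
    proof -
      have "(Poly_Mapping.map_key \<sigma> \<beta> = expv k (\<lambda>i. \<gamma> (\<tau> i))) \<longleftrightarrow> \<tau> = \<sigma>" if \<tau>: "\<tau> permutes {0..<k}" for \<tau>
      proof
        have \<tau>': "\<tau> permutes {..<k}" using \<tau> by (simp add: atLeast0LessThan)
        assume "Poly_Mapping.map_key \<sigma> \<beta> = expv k (\<lambda>i. \<gamma> (\<tau> i))"
        then have "expv k (\<lambda>i. \<gamma> (\<sigma> i)) = expv k (\<lambda>i. \<gamma> (\<tau> i))" using ex[OF \<sigma>] by simp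
        then have e: "\<gamma> (\<sigma> i) = \<gamma> (\<tau> i)" if "i < k" for i using that lookup_expv by metis
        show "\<tau> = \<sigma>"
        proof
          fix i show "\<tau> i = \<sigma> i"
          proof (cases "i < k")
            case True
            then have "\<sigma> i \<in> {..<k}" "\<tau> i \<in> {..<k}"
              using permutes_in_image[OF \<sigma>] permutes_in_image[OF \<tau>'] by auto
            then show ?thesis using e[OF True] inj by (metis inj_onD)
          qed (use permutes_not_in[OF \<sigma>] permutes_not_in[OF \<tau>'] in auto)
        qed
      qed (use ex[OF \<sigma>] in simp)
      then have "lkp (alternant k \<gamma>) (Poly_Mapping.map_key \<sigma> \<beta>)
          = (\<Sum>\<tau> | \<tau> permutes {0..<k}. if \<tau> = \<sigma> then sign \<tau> else 0)"
        unfolding lookup_alternant by (intro sum.cong) auto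
      also have "\<dots> = sign \<sigma>"
        using \<sigma> by (subst sum.delta) (auto simp: finite_permutations atLeast0LessThan)
      finally show ?thesis .
    qed
    have sub: "Poly_Mapping.keys q' \<subseteq> Poly_Mapping.keys q - {\<beta>}"
    proof
      fix \<alpha> assume \<alpha>: "\<alpha> \<in> Poly_Mapping.keys q'"
      have "\<not> (\<exists>\<sigma>. \<sigma> permutes {..<k} \<and> \<alpha> = Poly_Mapping.map_key \<sigma> \<beta>)"
        using \<alpha> on as by (auto simp: in_keys_iff lq' c_def)
      moreover have "Poly_Mapping.map_key id \<beta> = \<beta>" using map_key_id[of \<beta>] by (simp only: id_def)
      moreover have "id permutes {..<k}" by (rule permutes_id)
      ultimately have "\<alpha> \<noteq> \<beta>" "\<alpha> \<notin> Poly_Mapping.keys (alternant k \<gamma>)"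
        using keys_alternant[of \<alpha> k \<gamma>] ex by (metis, metis atLeast0LessThan)
      then show "\<alpha> \<in> Poly_Mapping.keys q - {\<beta>}" using \<alpha> by (simp add: in_keys_iff lq')
    qed
    have "card (Poly_Mapping.keys q') < card (Poly_Mapping.keys q)"
      using sub \<beta> by (intro psubset_card_mono) auto
    moreover have "asym k q'"
    proof -
      have "asym k (alternant k \<gamma>)"
        unfolding jacobi_trudi[of k \<gamma>] by (rule asym_mult_alternant[OF JT_sym])
      then have "lkp q' (Poly_Mapping.map_key \<pi> \<alpha>) = sign \<pi> * lkp q' \<alpha>" if "\<pi> permutes {..<k}" for \<pi> \<alpha>
        using that as[OF that] by (simp add: lq' asym_def algebra_simps)
      moreover have "\<forall>\<alpha>\<in>Poly_Mapping.keys q'. Poly_Mapping.keys \<alpha> \<subseteq> {..<k}"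
        using sub less.prems(1) unfolding asym_def by blast
      ultimately show ?thesis by (simp add: asym_def)
    qed
    moreover have "overflow n q'"
    proof -
      have "lkp q' \<alpha> = 0" if "\<forall>i. lkp \<alpha> i < n" for \<alpha>
        using less.prems(2) that sub by (metis Diff_iff in_keys_iff overflow_def subsetD)
      then show ?thesis by (simp add: overflow_def)
    qed
    ultimately obtain s where s: "s \<in> Lambda_ideal (n - k) k" "q' = s * alternant k id"
      using less.hyps by blast
    obtain j where j: "lkp \<beta> j \<ge> n" using less.prems(2) c0 unfolding overflow_def c_def by (meson not_le)
    show ?thesis
    proof (cases "j < k")
      case True
      have 1: "JT k \<gamma> \<in> Lambda_ideal (n - k) k" using JT_in_ideal[OF k True] j by (simp add: \<gamma>_def)
      have 2: "Poly_Mapping.single 0 c \<in> sym_polys k"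
      proof -
        have "Poly_Mapping.map_key \<pi> \<alpha> = 0 \<longleftrightarrow> \<alpha> = 0" if "\<pi> permutes {..<k}" for \<pi> and \<alpha> :: "nat \<Rightarrow>\<^sub>0 nat"
        proof
          assume *: "Poly_Mapping.map_key \<pi> \<alpha> = 0"
          show "\<alpha> = 0"
          proof (rule poly_mapping_eqI)
            fix i
            from permutes_surj[OF \<open>\<pi> permutes {..<k}\<close>] obtain j where "\<pi> j = i" by (metis surjD)
            then show "lkp \<alpha> i = lkp 0 i" using * lookup_map_key[OF \<open>\<pi> permutes {..<k}\<close>, of \<alpha> j] by simp
          qed
        next
          assume "\<alpha> = 0"
          then show "Poly_Mapping.map_key \<pi> \<alpha> = 0"
            by (intro poly_mapping_eqI) (simp add: lookup_map_key[OF that])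
        qed
        then show ?thesis by (auto simp: sym_polys_def lookup_single when_def)
      qed
      have "q = (s + Poly_Mapping.single 0 c * JT k \<gamma>) * alternant k id"
        using s(2) jacobi_trudi[of k \<gamma>] by (simp add: q'_def algebra_simps)
      then show ?thesis using Lambda_ideal_add[OF s(1) Lambda_ideal_mult[OF 1 2]] by blast
    next
      case False
      then have "lkp \<beta> j = 0" using kb by (force simp: in_keys_iff subset_iff)
      then show ?thesis using j n by simp
    qed
  qed
qed

lemma alternant_ne_0: "alternant k id \<noteq> 0"
proof -
  have "(expv k id = expv k \<sigma>) \<longleftrightarrow> \<sigma> = id" if \<sigma>: "\<sigma> permutes {0..<k}" for \<sigma>
  proof
    assume e: "expv k id = expv k \<sigma>"
    show "\<sigma> = id"
    proof
      fix i show "\<sigma> i = id i"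
      proof (cases "i < k")
        case True
        then show ?thesis using e lookup_expv[of k id i] lookup_expv[of k \<sigma> i] by simp
      qed (use permutes_not_in[OF \<sigma>] in auto)
    qed
  qed simp
  then have "lkp (alternant k id) (expv k id) = (\<Sum>\<tau> | \<tau> permutes {0..<k}. if \<tau> = id then sign \<tau> else 0)"
    unfolding lookup_alternant by (intro sum.cong) auto
  also have "\<dots> = 1"
    by (subst sum.delta) (auto simp: finite_permutations permutes_id)
  finally show ?thesis by auto
qed

lemma gen_overflow:
  assumes "k \<le> n" "d > n - k" shows "overflow n (complete_hom k d * alternant k id)"
proof (cases "k = 0")
  case True
  then show ?thesis using assms by (simp add: complete_hom_0 overflow_def)
next
  case False
  define \<gamma> where "\<gamma> j = (if j = k - 1 then k - 1 + d else j)" for j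
  have "JT k \<gamma> = (\<Prod>j<k. complete_hom k (\<gamma> j - j))"
    by (rule JT_triangular) (auto simp: \<gamma>_def)
  also have "\<dots> = (\<Prod>j\<in>{k - 1}. complete_hom k (\<gamma> j - j))"
    using False by (intro prod.mono_neutral_right) (auto simp: \<gamma>_def complete_hom_zero)
  also have "\<dots> = complete_hom k d" by (simp add: \<gamma>_def)
  finally have e: "complete_hom k d * alternant k id = alternant k \<gamma>" using jacobi_trudi[of k \<gamma>] by simp
  show ?thesis unfolding e overflow_def
  proof (intro allI impI, rule ccontr)
    fix \<alpha> :: "nat \<Rightarrow>\<^sub>0 nat" assume \<alpha>: "\<forall>i. lkp \<alpha> i < n" "lkp (alternant k \<gamma>) \<alpha> \<noteq> 0"
    then obtain \<sigma> where \<sigma>: "\<sigma> permutes {0..<k}" "\<alpha> = expv k (\<lambda>i. \<gamma> (\<sigma> i))"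
      using keys_alternant[of \<alpha> k \<gamma>] by (auto simp: in_keys_iff)
    have "k - 1 \<in> {0..<k}" using False by simp
    then have "k - 1 \<in> \<sigma> ` {0..<k}" using permutes_image[OF \<sigma>(1)] by simp
    then obtain i where "i < k" "\<sigma> i = k - 1" by auto
    then have "lkp \<alpha> i = k - 1 + d" using \<sigma>(2) by (simp add: lookup_expv \<gamma>_def)
    then show False using \<alpha>(1)[rule_format, of i] assms False by linarith
  qed
qed

lemma Lambda_ideal_iff:
  assumes k: "k \<le> n" and n: "0 < n"
  shows "p \<in> Lambda_ideal (n - k) k \<longleftrightarrow> p \<in> sym_polys k \<and> overflow n (p * alternant k id)"
proof
  assume "p \<in> sym_polys k \<and> overflow n (p * alternant k id)"
  then obtain s where s: "s \<in> Lambda_ideal (n - k) k" "p * alternant k id = s * alternant k id"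
    using asym_overflow_factor[OF k n asym_mult_alternant] by blast
  then have "p = s" using alternant_ne_0[of k] by simp
  then show "p \<in> Lambda_ideal (n - k) k" using s by simp
next
  define J where "J = {p \<in> sym_polys k. overflow n (p * alternant k id)}"
  have "ideal J (sym_ring k)"
  proof (rule idealI[OF sym_ring_ring])
    show "subgroup J (add_monoid (sym_ring k))"
    proof
      show "J \<subseteq> carrier (add_monoid (sym_ring k))" by (auto simp: J_def)
      fix x y assume "x \<in> J" "y \<in> J"
      then show "x \<otimes>\<^bsub>add_monoid (sym_ring k)\<^esub> y \<in> J"
        using overflow_add by (auto simp: J_def sym_polys_add distrib_right)
    next
      show "\<one>\<^bsub>add_monoid (sym_ring k)\<^esub> \<in> J" by (simp add: J_def sym_polys_0 overflow_def)
    next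
      fix x assume x: "x \<in> J"
      then have "inv\<^bsub>add_monoid (sym_ring k)\<^esub> x = - x"
        using sym_ring_minus[of x k] by (simp add: J_def a_inv_def)
      then show "inv\<^bsub>add_monoid (sym_ring k)\<^esub> x \<in> J"
        using x overflow_uminus[of n "x * alternant k id"] by (simp add: J_def sym_polys_uminus)
    qed
  next
    fix a x assume a: "a \<in> J" and x: "x \<in> carrier (sym_ring k)"
    then show 1: "x \<otimes>\<^bsub>sym_ring k\<^esub> a \<in> J"
      using overflow_mult[of n "a * alternant k id" x] by (simp add: J_def sym_polys_mult mult.assoc)
    then show "a \<otimes>\<^bsub>sym_ring k\<^esub> x \<in> J" by (simp add: mult.commute)
  qed
  moreover have "{complete_hom k d | d. d > n - k} \<subseteq> J"
    using gen_overflow[OF k] by (auto simp: J_def complete_hom_sym)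
  ultimately have "Lambda_ideal (n - k) k \<subseteq> J"
    unfolding Lambda_ideal_def by (rule ring.genideal_minimal[OF sym_ring_ring])
  moreover assume "p \<in> Lambda_ideal (n - k) k"
  ultimately show "p \<in> sym_polys k \<and> overflow n (p * alternant k id)" by (auto simp: J_def)
qed

lemma G_class_zero_iff:
  "G_class n f k = \<zero>\<^bsub>Lambda_ring (n - k) k\<^esub> \<longleftrightarrow> affine_stanley_poly n k f \<in> Lambda_ideal (n - k) k"
proof -
  let ?I = "Lambda_ideal (n - k) k" and ?p = "affine_stanley_poly n k f"
  have z: "\<zero>\<^bsub>Lambda_ring (n - k) k\<^esub> = ?I" by (simp add: Lambda_ring_def FactRing_def)
  have c: "G_class n f k = (\<lambda>i. i + ?p) ` ?I"
    by (auto simp: G_class_def a_r_coset_def r_coset_def)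
  have "(\<lambda>i. i + ?p) ` ?I = ?I" if p: "?p \<in> ?I"
  proof
    show "(\<lambda>i. i + ?p) ` ?I \<subseteq> ?I" using p Lambda_ideal_add by auto
    show "?I \<subseteq> (\<lambda>i. i + ?p) ` ?I"
    proof
      fix q assume q: "q \<in> ?I"
      have "- ?p \<in> ?I"
        using Lambda_ideal_mult[OF p sym_polys_uminus[OF sym_polys_1]] by simp
      then have "q + - ?p \<in> ?I" using q Lambda_ideal_add by blast
      then show "q \<in> (\<lambda>i. i + ?p) ` ?I" by (intro image_eqI[of _ _ "q + - ?p"]) auto
    qed
  qed
  moreover have "?p \<in> ?I" if "(\<lambda>i. i + ?p) ` ?I = ?I"
  proof -
    have "0 + ?p \<in> (\<lambda>i. i + ?p) ` ?I" using Lambda_ideal_0 by (intro imageI)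
    then show ?thesis using that by simp
  qed
  ultimately show ?thesis unfolding z c by blast
qed

context affine
begin

section \<open>The affine nil-Coxeter operators\<close>

definition supports :: "nat \<Rightarrow> int set set" where
  "supports r = {T. is_support T \<and> n - card T = r}"

lemma finite_is_support: "finite {T. is_support T}"
  by (rule finite_subset[of _ "Pow {0..<N}"]) (auto simp: is_support_def)

lemma finite_supports: "finite (supports r)"
  using finite_is_support by (rule rev_finite_subset) (auto simp: supports_def)

lemma supports_D: assumes "T \<in> supports r" shows "is_support T" "cyc T \<in> P" "len (cyc T) = r" "card T = n - r" "r < n"
proof -
  show T: "is_support T" using assms by (simp add: supports_def)
  show "cyc T \<in> P" using cyc_P[OF T] .
  show "len (cyc T) = r" using len_cyc[OF T] assms by (simp add: supports_def)
  show "card T = n - r" "r < n" using card_is_support[OF T] assms by (auto simp: supports_def)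
qed

text \<open>A function \<open>F\<close> on affine permutations stands for the element \<open>\<Sum>w. F w \<cdot> w\<close> of the affine nil-Coxeter algebra,
  and \<open>left_op z\<close> for left multiplication by \<open>z\<close>.\<close>

definition left_op :: "(int \<Rightarrow> int) \<Rightarrow> ((int \<Rightarrow> int) \<Rightarrow> int) \<Rightarrow> (int \<Rightarrow> int) \<Rightarrow> int" where
  "left_op z F w = (if w \<in> P \<and> len w = len z + len (iv z \<circ> w) then F (iv z \<circ> w) else 0)"

definition U :: "nat \<Rightarrow> ((int \<Rightarrow> int) \<Rightarrow> int) \<Rightarrow> (int \<Rightarrow> int) \<Rightarrow> int" where
  "U r F w = (\<Sum>T\<in>supports r. left_op (cyc T) F w)"

definition V :: "nat \<Rightarrow> ((int \<Rightarrow> int) \<Rightarrow> int) \<Rightarrow> (int \<Rightarrow> int) \<Rightarrow> int" where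
  "V r F w = (\<Sum>T\<in>supports r. left_op (iv (cyc T)) F w)"

lemma iv_comp: assumes "f \<in> P" "g \<in> P" shows "iv (f \<circ> g) = iv g \<circ> iv f"
  using P_bij[OF assms(1)] P_bij[OF assms(2)] by (rule o_inv_distrib)

lemma left_op_left_op:
  assumes z: "z1 \<in> P" "z2 \<in> P"
  shows "left_op z1 (left_op z2 F) w = (if len (z1 \<circ> z2) = len z1 + len z2 then left_op (z1 \<circ> z2) F w else 0)"
proof (cases "w \<in> P")
  case w: True
  define y1 where "y1 = iv z1 \<circ> w"
  define y2 where "y2 = iv z2 \<circ> y1"
  have yP: "y1 \<in> P" "y2 \<in> P" unfolding y1_def y2_def using P_comp P_inv z w by auto
  have y2': "iv (z1 \<circ> z2) \<circ> w = y2" unfolding y2_def y1_def iv_comp[OF z] by (simp only: o_assoc)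
  have w1: "w = z1 \<circ> y1" unfolding y1_def using z by (auto simp: fun_eq_iff)
  have w2: "y1 = z2 \<circ> y2" unfolding y2_def using z by (auto simp: fun_eq_iff)
  have w3: "w = (z1 \<circ> z2) \<circ> y2" unfolding o_assoc[symmetric] w2[symmetric] by (rule w1)
  have "len w \<le> len z1 + len y1" using len_mult_le[OF z(1) yP(1)] w1 by metis
  moreover have "len y1 \<le> len z2 + len y2" using len_mult_le[OF z(2) yP(2)] w2 by metis
  moreover have "len w \<le> len (z1 \<circ> z2) + len y2" using len_mult_le[OF P_comp[OF z] yP(2)] w3 by metis
  moreover have "len (z1 \<circ> z2) \<le> len z1 + len z2" using len_mult_le[OF z] .
  ultimately have "(len w = len z1 + len y1 \<and> len y1 = len z2 + len y2) \<longleftrightarrow>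
    (len (z1 \<circ> z2) = len z1 + len z2 \<and> len w = len (z1 \<circ> z2) + len y2)" by linarith
  then show ?thesis unfolding left_op_def y2' y1_def[symmetric] y2_def[symmetric] using w yP by auto
qed (simp add: left_op_def)

lemma left_op_sum: "left_op z (\<lambda>w. \<Sum>i\<in>A. G i w) w = (\<Sum>i\<in>A. left_op z (G i) w)"
proof (cases "w \<in> P \<and> len w = len z + len (iv z \<circ> w)")
  case True
  then show ?thesis by (simp add: left_op_def)
next
  case False
  then show ?thesis unfolding left_op_def if_not_P[OF False] by simp
qed

lemma left_op_scale: "left_op z (\<lambda>w. c * G w) w = c * left_op z G w"
  by (simp add: left_op_def)

lemma left_op_add: "left_op z (\<lambda>w. F w + G w) w = left_op z F w + left_op z G w"
  by (simp add: left_op_def)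

lemma left_op_zero: "left_op z (\<lambda>w. 0) w = 0"
  by (simp add: left_op_def)

lemma sum_fibres:
  fixes g :: "'c \<Rightarrow> int"
  assumes "finite S" "finite S'" and c: "\<And>z. card {p \<in> S. f p = z} = card {p \<in> S'. f' p = z}"
  shows "(\<Sum>p\<in>S. g (f p)) = (\<Sum>p\<in>S'. g (f' p))"
proof -
  let ?Z = "f ` S \<union> f' ` S'"
  have Z: "finite ?Z" using assms by simp
  have "(\<Sum>p\<in>S. g (f p)) = (\<Sum>z\<in>?Z. \<Sum>p | p \<in> S \<and> f p = z. g (f p))"
    by (rule sum.group[symmetric]) (use assms Z in auto)
  also have "\<dots> = (\<Sum>z\<in>?Z. int (card {p \<in> S. f p = z}) * g z)" by (intro sum.cong) auto
  also have "\<dots> = (\<Sum>z\<in>?Z. int (card {p \<in> S'. f' p = z}) * g z)" by (simp only: c)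
  also have "\<dots> = (\<Sum>z\<in>?Z. \<Sum>p | p \<in> S' \<and> f' p = z. g (f' p))" by (intro sum.cong) auto
  also have "\<dots> = (\<Sum>p\<in>S'. g (f' p))"
    by (rule sum.group) (use assms Z in auto)
  finally show ?thesis .
qed

subsection \<open>The alternating relation between the two kinds of operators\<close>

lemma cyc_cut: assumes T: "is_support T" and t: "on T t" shows "cyc T x < t \<longleftrightarrow> x < t"
proof
  assume "x < t"
  then show "cyc T x < t" using nxt_le_on[OF t, of x] by (auto simp: cyc_def)
next
  assume c: "cyc T x < t"
  show "x < t"
  proof (rule ccontr)
    assume "\<not> x < t"
    then have "x = t" using c cyc_ge[where T=T and x=x] by linarith
    then show False using c t cyc_on_iff[where T=T and x=x] by simp
  qed
qed

lemma cyc_not_on: "\<not> on T t \<Longrightarrow> cyc T t = t - 1" by (simp add: cyc_def)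

definition EHpairs :: "nat \<Rightarrow> (int \<Rightarrow> int) \<Rightarrow> (int set \<times> int set) set" where
  "EHpairs r z = {(A, B). is_support A \<and> is_support B \<and> (n - card A) + (n - card B) = r \<and>
     iv (cyc A) \<circ> cyc B = z \<and> len z = r}"

lemma EHpairs_cut:
  assumes r: "r < n" and AB: "(A, B) \<in> EHpairs r z"
  shows "\<exists>t. 0 \<le> t \<and> t < N \<and> (\<forall>(T1, T2) \<in> EHpairs r z. t \<in> T1 \<and> t \<in> T2)"
proof -
  have A: "is_support A" "is_support B" "(n - card A) + (n - card B) = r" "iv (cyc A) \<circ> cyc B = z"
    using AB by (auto simp: EHpairs_def)
  have "A \<inter> B \<noteq> {}"
  proof
    assume "A \<inter> B = {}"
    then have "card (A \<union> B) = card A + card B" using card_is_support(3)[OF A(1)] card_is_support(3)[OF A(2)] by (simp add: card_Un_disjoint)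
    moreover have "card (A \<union> B) \<le> card {0..<N}" using A(1,2) by (intro card_mono) (auto simp: is_support_def)
    ultimately have "card A + card B \<le> n" by simp
    then show False using A(3) r card_is_support(2)[OF A(1)] card_is_support(2)[OF A(2)] by linarith
  qed
  then obtain t where t: "t \<in> A" "t \<in> B" by blast
  have t0: "0 \<le> t" "t < N" using A(1) t by (auto simp: is_support_def)
  have tm: "t mod N = t" using t0 by simp
  have cut: "(x < t) = (z x < t)" for x
  proof -
    have "cyc A (z x) = cyc B x" using inv_P_app(2)[OF cyc_P[OF A(1)], of "cyc B x"] A(4) by (simp add: fun_eq_iff)
    then show ?thesis using cyc_cut[OF A(1), of t "z x"] cyc_cut[OF A(2), of t x] t tm by simp
  qed
  have "t \<in> T1 \<and> t \<in> T2" if "(T1, T2) \<in> EHpairs r z" for T1 T2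
  proof -
    have T: "is_support T1" "is_support T2" "(n - card T1) + (n - card T2) = r" "iv (cyc T1) \<circ> cyc T2 = z" "len z = r"
      using that by (auto simp: EHpairs_def)
    have P1: "cyc T1 \<in> P" "cyc T2 \<in> P" using cyc_P T by auto
    have zx: "z x = iv (cyc T1) (cyc T2 x)" for x using T(4) by auto
    have add: "len (iv (cyc T1) \<circ> cyc T2) = len (iv (cyc T1)) + len (cyc T2)"
      using T len_inv[OF P1(1)] len_cyc[OF T(1)] len_cyc[OF T(2)] by simp
    have 2: "on T2 t"
    proof (rule ccontr)
      assume nt: "\<not> on T2 t"
      obtain a where a: "on T2 a" "a \<le> t" "t < nxt T2 a" using prev_ex[OF T(2)] by blast
      have "a < t" using a nt by (cases "a = t") auto
      moreover have "cyc T2 a > cyc T2 t" using a nt by (simp add: cyc_def)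
      ultimately have "z a > z t" using additiveD[OF P_inv[OF P1(1)] P1(2) add, of a t] zx by simp
      then show False using cut[of a] cut[of t] \<open>a < t\<close> by linarith
    qed
    have "on T1 t"
    proof (rule ccontr)
      assume nt: "\<not> on T1 t"
      define x where "x = iv (cyc T2) (cyc T1 t)"
      have x: "cyc T2 x = t - 1" unfolding x_def using P1(2) cyc_not_on[OF nt] by simp
      then have "x < t" using cyc_cut[OF T(2) 2, of x] by simp
      then have "z x < t" using cut by simp
      moreover have "z x = t" unfolding zx x cyc_not_on[OF nt, symmetric] using P1(1) by simp
      ultimately show False by simp
    qed
    then show ?thesis using 2 tm by simp
  qed
  then show ?thesis using t0 by blast
qed

lemma EH_zero:
  assumes r: "0 < r" "r < n"
  shows "(\<Sum>(T1, T2) \<in> EHpairs r z. (- 1) ^ (n - card T1) :: int) = 0"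
proof (cases "EHpairs r z = {}")
  case False
  then obtain A B where AB: "(A, B) \<in> EHpairs r z" by auto
  obtain t where t: "0 \<le> t" "t < N" and tin: "\<And>T1 T2. (T1, T2) \<in> EHpairs r z \<Longrightarrow> t \<in> T1 \<and> t \<in> T2"
    using EHpairs_cut[OF r(2) AB] by blast
  have n1: "n \<noteq> 1" using r by linarith
  define D where "D T1 T2 = {y \<in> {t + 1..t + N - 1}. \<not> (on T1 y \<and> on T2 y)}" for T1 T2
  define Y where "Y T1 T2 = Max (D T1 T2)" for T1 T2
  define \<phi> where "\<phi> = (\<lambda>(T1, T2). let y = Y T1 T2 mod N in
     if y \<in> T1 then (T1 - {y}, insert y T2) else (insert y T1, T2 - {y}))"
  have main: "\<phi> (T1, T2) \<in> EHpairs r z \<and> \<phi> (\<phi> (T1, T2)) = (T1, T2) \<and>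
      (- 1 :: int) ^ (n - card (fst (\<phi> (T1, T2)))) = - ((- 1) ^ (n - card T1))"
    if T12: "(T1, T2) \<in> EHpairs r z" for T1 T2
  proof -
    have T: "is_support T1" "is_support T2" "(n - card T1) + (n - card T2) = r" "iv (cyc T1) \<circ> cyc T2 = z" "len z = r"
      using T12 by (auto simp: EHpairs_def)
    have tt: "t \<in> T1" "t \<in> T2" using tin[OF T12] by auto
    have fin: "finite (D T1 T2)" by (rule finite_subset[of _ "{t + 1..t + N - 1}"]) (auto simp: D_def)
    have "D T1 T2 \<noteq> {}"
    proof
      assume e: "D T1 T2 = {}"
      have "x \<in> T1 \<and> x \<in> T2" if x: "x \<in> {0..<N}" for x
      proof (cases "x \<le> t")
        case True
        show ?thesis
        proof (cases "x = t")
          case False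
          then have "x + N \<in> {t + 1..t + N - 1}" using True x t by auto
          then have "on T1 (x + N) \<and> on T2 (x + N)" using e unfolding D_def by blast
          then show ?thesis using x by simp
        qed (use tt in simp)
      next
        case False
        then have "x \<in> {t + 1..t + N - 1}" using x t by auto
        then have "on T1 x \<and> on T2 x" using e by (auto simp: D_def)
        then show ?thesis using x by simp
      qed
      then have "T1 = {0..<N}" "T2 = {0..<N}" using T(1,2) by (auto simp: is_support_def)
      then show False using T(3) r by simp
    qed
    then have Yin: "Y T1 T2 \<in> D T1 T2" unfolding Y_def using fin by (intro Max_in)
    define y where "y = Y T1 T2"
    define m where "m = y mod N"
    have yr: "t + 1 \<le> y" "y \<le> t + N - 1" "\<not> (m \<in> T1 \<and> m \<in> T2)"
      using Yin by (auto simp: D_def y_def m_def)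
    have ysuc: "on T1 (y + 1) \<and> on T2 (y + 1)"
    proof (cases "y = t + N - 1")
      case True
      then have "(y + 1) mod N = t" using t by simp
      then show ?thesis using tt by simp
    next
      case False
      then have "y + 1 \<in> {t + 1..t + N - 1}" using yr by simp
      moreover have "y + 1 \<notin> D T1 T2" using Max_ge[OF fin, of "y + 1"] by (auto simp: y_def Y_def)
      ultimately show ?thesis by (auto simp: D_def)
    qed
    have m: "m \<in> {0..<N}" using N_pos by (simp add: m_def)
    define M where "M = y - 1"
    have yM: "M + 1 = y" "M + 2 = y + 1" by (simp_all add: M_def)
    let ?s = "simple_refl n M"
    have ss: "?s \<circ> ?s = id" using simple_refl_eq[OF n1] mod_Suc_ne[OF n1] by simp
    have sP: "?s \<in> P" by (rule simple_refl_P)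
    have ivs: "iv ?s = ?s" using ss by (metis inv_unique_comp)
    have del: "is_support (S - {m}) \<and> ?s \<circ> cyc S = cyc (S - {m})" if "is_support S" "m \<in> S" "on S (y + 1)" for S
      using simple_cyc[OF that(1) n1, of M] that(2,3) yM by (simp add: m_def)
    have cancel: "iv (?s \<circ> f) \<circ> (?s \<circ> g) = iv f \<circ> g" if "f \<in> P" for f g
      unfolding iv_comp[OF sP that] ivs using ss by (metis o_assoc comp_id)
    have sfl: "?s \<circ> (?s \<circ> f) = f" for f using ss by (metis o_assoc id_comp)
    have ins: "is_support (insert m S)" "m \<notin> S \<Longrightarrow> ?s \<circ> cyc (insert m S) = cyc S" "m \<notin> S \<Longrightarrow> ?s \<circ> cyc S = cyc (insert m S)"
      if "is_support S" "on S (y + 1)" for S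
    proof -
      show 1: "is_support (insert m S)" using is_support_insert[OF that(1), of y] by (simp add: m_def)
      assume "m \<notin> S"
      then have "insert m S - {m} = S" by simp
      then show 2: "?s \<circ> cyc (insert m S) = cyc S" using del[OF 1] that(2) by simp
      show "?s \<circ> cyc S = cyc (insert m S)" unfolding 2[symmetric] by (rule sfl)
    qed
    have notboth: "m \<in> T1 \<or> m \<in> T2"
    proof (rule ccontr)
      assume nb: "\<not> ?thesis"
      have "z = iv (cyc (insert m T1)) \<circ> cyc (insert m T2)"
        using cancel[OF cyc_P[OF T(1)], of "cyc T2"] ins(3)[OF T(1)] ins(3)[OF T(2)] nb ysuc T(4) by simp
      then have "len z \<le> len (iv (cyc (insert m T1))) + len (cyc (insert m T2))"
        using len_mult_le[OF P_inv[OF cyc_P[OF ins(1)[OF T(1)]]] cyc_P[OF ins(1)[OF T(2)]]] ysuc by simp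
      also have "\<dots> = (n - card (insert m T1)) + (n - card (insert m T2))"
        using len_inv[OF cyc_P[OF ins(1)[OF T(1)]]] len_cyc[OF ins(1)[OF T(1)]] len_cyc[OF ins(1)[OF T(2)]] ysuc by simp
      also have "\<dots> < r" 
        using card_is_support[OF ins(1)[OF T(1)]] card_is_support[OF ins(1)[OF T(2)]] card_is_support(3)[OF T(1)] card_is_support(3)[OF T(2)] nb ysuc T(3)
        by simp
      finally show False using T(5) by simp
    qed
    show ?thesis
    proof (cases "m \<in> T1")
      case True
      then have m2: "m \<notin> T2" using yr by blast
      have ph: "\<phi> (T1, T2) = (T1 - {m}, insert m T2)" using True by (simp add: \<phi>_def Let_def m_def y_def)
      have 1: "is_support (T1 - {m})" "?s \<circ> cyc T1 = cyc (T1 - {m})" using del[OF T(1) True] ysuc by auto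
      have 2: "is_support (insert m T2)" "?s \<circ> cyc T2 = cyc (insert m T2)" using ins[OF T(2)] m2 ysuc by auto
      have "iv (cyc (T1 - {m})) \<circ> cyc (insert m T2) = z"
        unfolding 1(2)[symmetric] 2(2)[symmetric] cancel[OF cyc_P[OF T(1)]] by (rule T(4))
      moreover have cards: "card (T1 - {m}) = card T1 - 1" "card (insert m T2) = card T2 + 1" "card T1 \<ge> 1" "card T2 + 1 \<le> n" "card T1 \<le> n"
        using True m2 card_is_support[OF T(1)] card_is_support[OF T(2)] card_is_support(2)[OF 2(1)] by auto
      ultimately have in1: "\<phi> (T1, T2) \<in> EHpairs r z"
        unfolding ph EHpairs_def using 1(1) 2(1) T(3,5) by simp
      have "D (T1 - {m}) (insert m T2) = D T1 T2"
        using True m2 by (auto simp: D_def)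
      then have "Y (T1 - {m}) (insert m T2) = y" by (simp add: Y_def y_def)
      then have "\<phi> (\<phi> (T1, T2)) = (T1, T2)"
        unfolding ph using True m2 by (auto simp: \<phi>_def Let_def m_def[symmetric])
      moreover have "(- 1 :: int) ^ (n - card (T1 - {m})) = - ((- 1) ^ (n - card T1))"
      proof -
        have "n - card (T1 - {m}) = Suc (n - card T1)" using cards by linarith
        then show ?thesis by simp
      qed
      ultimately show ?thesis using in1 ph by simp
    next
      case False
      then have m2: "m \<in> T2" using notboth by blast
      have ph: "\<phi> (T1, T2) = (insert m T1, T2 - {m})" using False by (simp add: \<phi>_def Let_def m_def y_def)
      have 1: "is_support (T2 - {m})" "?s \<circ> cyc T2 = cyc (T2 - {m})" using del[OF T(2) m2] ysuc by auto
      have 2: "is_support (insert m T1)" "?s \<circ> cyc T1 = cyc (insert m T1)" using ins[OF T(1)] False ysuc by auto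
      have "iv (cyc (insert m T1)) \<circ> cyc (T2 - {m}) = z"
        unfolding 1(2)[symmetric] 2(2)[symmetric] cancel[OF cyc_P[OF T(1)]] by (rule T(4))
      moreover have cards: "card (T2 - {m}) = card T2 - 1" "card (insert m T1) = card T1 + 1" "card T2 \<ge> 1" "card T1 + 1 \<le> n" "card T2 \<le> n"
        using False m2 card_is_support[OF T(1)] card_is_support[OF T(2)] card_is_support(2)[OF 2(1)] by auto
      ultimately have in1: "\<phi> (T1, T2) \<in> EHpairs r z"
        unfolding ph EHpairs_def using 1(1) 2(1) T(3,5) by simp
      have "D (insert m T1) (T2 - {m}) = D T1 T2"
        using False m2 by (auto simp: D_def)
      then have "Y (insert m T1) (T2 - {m}) = y" by (simp add: Y_def y_def)
      then have "\<phi> (\<phi> (T1, T2)) = (T1, T2)"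
        unfolding ph using False m2 by (auto simp: \<phi>_def Let_def m_def[symmetric])
      moreover have "(- 1 :: int) ^ (n - card (insert m T1)) = - ((- 1) ^ (n - card T1))"
      proof -
        have "n - card T1 = Suc (n - card (insert m T1))" using cards by linarith
        then show ?thesis by simp
      qed
      ultimately show ?thesis using in1 ph by simp
    qed
  qed
  let ?f = "\<lambda>(T1, T2). (- 1) ^ (n - card T1) :: int"
  have "sum ?f (EHpairs r z) = sum (\<lambda>p. - ?f p) (EHpairs r z)"
  proof (rule sum.reindex_bij_witness[of _ \<phi> \<phi>])
    fix p assume p: "p \<in> EHpairs r z"
    obtain T1 T2 where T: "p = (T1, T2)" by (cases p)
    note m = main[OF p[unfolded T]]
    show "\<phi> (\<phi> p) = p" "\<phi> p \<in> EHpairs r z" using m T by auto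
    then show "\<phi> (\<phi> p) = p" "\<phi> p \<in> EHpairs r z" by auto
    show "- ?f (\<phi> p) = ?f p" using m T by (simp add: case_prod_beta)
  qed
  then show ?thesis by (simp add: sum_negf)
qed simp

lemma V_U_relation:
  assumes r: "0 < r" "r < n"
  shows "(\<Sum>i\<le>r. (- 1) ^ i * V i (U (r - i) F) w) = 0"
proof -
  let ?Q = "{(A, B). is_support A \<and> is_support B \<and> (n - card A) + (n - card B) = r \<and> len (iv (cyc A) \<circ> cyc B) = r}"
  let ?z = "\<lambda>(A, B). iv (cyc A) \<circ> cyc B"
  let ?e = "\<lambda>(A :: int set, B :: int set). (- 1) ^ (n - card A) :: int"
  have fQ: "finite ?Q" by (rule finite_subset[of _ "{T. is_support T} \<times> {T. is_support T}"]) (auto simp: finite_is_support)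
  define G where "G p = (if len (?z p) = r then ?e p * left_op (?z p) F w else 0)" for p
  have 1: "(- 1) ^ i * V i (U (r - i) F) w = (\<Sum>p\<in>supports i \<times> supports (r - i). G p)" if i: "i \<le> r" for i
  proof -
    have "V i (U (r - i) F) w = (\<Sum>A\<in>supports i. \<Sum>B\<in>supports (r - i). left_op (iv (cyc A)) (left_op (cyc B) F) w)"
      unfolding V_def U_def left_op_sum ..
    then have "(- 1) ^ i * V i (U (r - i) F) w
        = (\<Sum>A\<in>supports i. \<Sum>B\<in>supports (r - i). (- 1) ^ i * left_op (iv (cyc A)) (left_op (cyc B) F) w)"
      by (simp only: sum_distrib_left)
    also have "\<dots> = (\<Sum>A\<in>supports i. \<Sum>B\<in>supports (r - i). G (A, B))"
    proof (intro sum.cong refl)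
      fix A B assume A: "A \<in> supports i" and B: "B \<in> supports (r - i)"
      have "n - card A = i" using A by (simp add: supports_def)
      moreover have "len (iv (cyc A)) + len (cyc B) = r"
        using supports_D(3)[OF A] supports_D(3)[OF B] len_inv[OF supports_D(2)[OF A]] i by simp
      ultimately show "(- 1) ^ i * left_op (iv (cyc A)) (left_op (cyc B) F) w = G (A, B)"
        unfolding left_op_left_op[OF P_inv[OF supports_D(2)[OF A]] supports_D(2)[OF B]] G_def by simp
    qed
    also have "\<dots> = (\<Sum>p\<in>supports i \<times> supports (r - i). G p)" by (simp add: sum.cartesian_product)
    finally show ?thesis .
  qed
  have "(\<Sum>i\<le>r. (- 1) ^ i * V i (U (r - i) F) w) = (\<Sum>i\<le>r. \<Sum>p\<in>supports i \<times> supports (r - i). G p)"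
    using 1 by (intro sum.cong) auto
  also have "\<dots> = (\<Sum>p\<in>(\<Union>i\<in>{..r}. supports i \<times> supports (r - i)). G p)"
  proof (rule sum.UNION_disjoint[symmetric])
    show "\<forall>i\<in>{..r}. finite (supports i \<times> supports (r - i))" using finite_supports by blast
    show "\<forall>i\<in>{..r}. \<forall>j\<in>{..r}. i \<noteq> j \<longrightarrow> supports i \<times> supports (r - i) \<inter> supports j \<times> supports (r - j) = {}"
      unfolding supports_def by blast
  qed simp
  also have "\<dots> = (\<Sum>p\<in>?Q. G p)"
  proof (rule sum.mono_neutral_right)
    show "finite (\<Union>i\<in>{..r}. supports i \<times> supports (r - i))" using finite_supports by blast
    show "?Q \<subseteq> (\<Union>i\<in>{..r}. supports i \<times> supports (r - i))"
    proof
      fix p assume "p \<in> ?Q"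
      then obtain A B where p: "p = (A, B)" "is_support A" "is_support B" "(n - card A) + (n - card B) = r" by blast
      then have "n - card A \<le> r" "n - card B = r - (n - card A)" by linarith+
      then show "p \<in> (\<Union>i\<in>{..r}. supports i \<times> supports (r - i))" using p unfolding supports_def by blast
    qed
    show "\<forall>p\<in>(\<Union>i\<in>{..r}. supports i \<times> supports (r - i)) - ?Q. G p = 0"
    proof
      fix p assume p: "p \<in> (\<Union>i\<in>{..r}. supports i \<times> supports (r - i)) - ?Q"
      then obtain i A B where i: "i \<le> r" "p = (A, B)" "A \<in> supports i" "B \<in> supports (r - i)" by blast
      then have "is_support A" "is_support B" "(n - card A) + (n - card B) = r" by (auto simp: supports_def)
      then have "len (iv (cyc A) \<circ> cyc B) \<noteq> r" using p i(2) by blast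
      then show "G p = 0" by (simp only: G_def i(2) case_prod_conv if_False)
    qed
  qed
  also have "\<dots> = (\<Sum>p\<in>?Q. ?e p * left_op (?z p) F w)"
    by (intro sum.cong refl) (auto simp: G_def)
  also have "\<dots> = (\<Sum>z\<in>?z ` ?Q. \<Sum>p | p \<in> ?Q \<and> ?z p = z. ?e p * left_op (?z p) F w)"
    by (rule sum.group[symmetric]) (use fQ in auto)
  also have "\<dots> = 0"
  proof (rule sum.neutral, rule ballI)
    fix z assume "z \<in> ?z ` ?Q"
    have e: "{p. p \<in> ?Q \<and> ?z p = z} = EHpairs r z" by (auto simp: EHpairs_def)
    have "(\<Sum>p | p \<in> ?Q \<and> ?z p = z. ?e p * left_op (?z p) F w) = (\<Sum>p | p \<in> ?Q \<and> ?z p = z. ?e p * left_op z F w)"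
      by (intro sum.cong) auto
    also have "\<dots> = (\<Sum>p\<in>EHpairs r z. ?e p) * left_op z F w" unfolding e by (rule sum_distrib_right[symmetric])
    also have "\<dots> = 0" using EH_zero[OF r, of z] by simp
    finally show "(\<Sum>p | p \<in> ?Q \<and> ?z p = z. ?e p * left_op (?z p) F w) = 0" .
  qed
  finally show ?thesis .
qed

end

section \<open>Commutation of the operators\<close>

text \<open>A product of two cyclically decreasing elements is built up by two carriers moving over the
  sites \<open>n, \<dots>, 1\<close>: at every site a carrier either exchanges its load with the value at the site or,
  if its load is larger, skips the site.  Skips of the two carriers have weights \<open>x\<close> and \<open>y\<close>.  The local
  transition weights satisfy a Yang--Baxter relation, so the partition function on the circle is
  symmetric in \<open>x\<close> and \<open>y\<close>.\<close>

definition step_to :: "int \<Rightarrow> bool \<Rightarrow> bool \<Rightarrow> int \<times> int \<Rightarrow> int \<times> int" where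
  "step_to a p q s = (if p then a else fst s, if q then (if p then fst s else a) else snd s)"

definition valid_step :: "int \<Rightarrow> int \<Rightarrow> bool \<Rightarrow> bool \<Rightarrow> int \<times> int \<Rightarrow> bool" where
  "valid_step a e p q s \<longleftrightarrow> (p \<or> fst s > a) \<and>
     (if q then e = snd s else snd s > (if p then fst s else a) \<and> e = (if p then fst s else a))"

definition step_wt :: "'a::comm_ring_1 \<Rightarrow> 'a \<Rightarrow> bool \<Rightarrow> bool \<Rightarrow> 'a" where
  "step_wt x y p q = (if p then 1 else x) * (if q then 1 else y)"

definition local_term :: "int \<Rightarrow> int \<Rightarrow> 'a::comm_ring_1 \<Rightarrow> 'a \<Rightarrow> int \<times> int \<Rightarrow> int \<times> int \<Rightarrow> bool \<Rightarrow> bool \<Rightarrow> 'a" where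
  "local_term a e x y s s' p q = (if valid_step a e p q s \<and> step_to a p q s = s' then step_wt x y p q else 0)"

definition local_wt :: "int \<Rightarrow> int \<Rightarrow> 'a::comm_ring_1 \<Rightarrow> 'a \<Rightarrow> int \<times> int \<Rightarrow> int \<times> int \<Rightarrow> 'a" where
  "local_wt a e x y s s' = local_term a e x y s s' True True + local_term a e x y s s' True False +
     local_term a e x y s s' False True + local_term a e x y s s' False False"

lemma yang_baxter:
  "local_wt a e x y (c, d) (c', d') + (if d' < c' then (y - x) * local_wt a e x y (c, d) (d', c') else 0)
   = local_wt a e y x (c, d) (c', d') + (if c < d then (y - x) * local_wt a e y x (d, c) (c', d') else 0)"
proof -
  define D where "D p q r = (if c' = p \<and> d' = q \<and> e = r then 1 else 0 :: 'a)" for p q r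
  have L: "local_wt a e x y (c, d) (c', d') = D a c d + (if c < d then y * D a d c else 0)
      + (if a < c then x * D c a d else 0) + (if a < c \<and> a < d then x * y * D c d a else 0)" for x y c d
  proof -
    have "local_term a e x y (c, d) (c', d') True True = D a c d"
      "local_term a e x y (c, d) (c', d') True False = (if c < d then y * D a d c else 0)"
      "local_term a e x y (c, d) (c', d') False True = (if a < c then x * D c a d else 0)"
      "local_term a e x y (c, d) (c', d') False False = (if a < c \<and> a < d then x * y * D c d a else 0)"
      unfolding local_term_def valid_step_def step_to_def step_wt_def D_def by auto
    then show ?thesis unfolding local_wt_def by simp
  qed
  have L': "(if d' < c' then (y - x) * local_wt a e x y (c, d) (d', c') else 0)
      = (y - x) * ((if a < c then D c a d else 0) + (if c < d \<and> a < d then y * D d a c else 0)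
      + (if a < c \<and> a < d \<and> c < d then x * y * D d c a else 0))"
  proof -
    have "(if d' < c' then local_term a e x y (c, d) (d', c') True True else 0) = (if a < c then D c a d else 0)"
      "(if d' < c' then local_term a e x y (c, d) (d', c') True False else 0) = (if c < d \<and> a < d then y * D d a c else 0)"
      "(if d' < c' then local_term a e x y (c, d) (d', c') False True else 0) = 0"
      "(if d' < c' then local_term a e x y (c, d) (d', c') False False else 0) = (if a < c \<and> a < d \<and> c < d then x * y * D d c a else 0)"
      unfolding local_term_def valid_step_def step_to_def step_wt_def D_def by auto
    then show ?thesis unfolding local_wt_def by (cases "d' < c'") (simp_all only: if_True if_False add_0_right mult_zero_right)
  qed
  show ?thesis unfolding L L'
    by (cases "a < c"; cases "a < d"; cases "c < d"; simp add: algebra_simps)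
qed

fun part_fn :: "int set \<Rightarrow> (int \<Rightarrow> int) \<Rightarrow> 'a::comm_ring_1 \<Rightarrow> 'a \<Rightarrow> nat \<Rightarrow> int \<times> int \<Rightarrow> int \<times> int \<Rightarrow> 'a" where
  "part_fn B z x y 0 s s'' = (if s = s'' then 1 else 0)"
| "part_fn B z x y (Suc m) s s'' = (\<Sum>s'\<in>B \<times> B. local_wt (int (Suc m) - 2) (z (int (Suc m))) x y s s' * part_fn B z x y m s' s'')"

lemma sum_swap_pairs: "(\<Sum>s\<in>B \<times> B. f s) = (\<Sum>s\<in>B \<times> B. f (prod.swap s))"
  by (rule sum.reindex_bij_witness[of _ prod.swap prod.swap]) auto

lemma part_fn_intertwine:
  shows "part_fn B z x y m (c, d) (c', d') + (if d' < c' then (y - x) * part_fn B z x y m (c, d) (d', c') else 0)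
   = part_fn B z y x m (c, d) (c', d') + (if c < d then (y - x) * part_fn B z y x m (d, c) (c', d') else 0)"
proof (induction m arbitrary: c d)
  case 0
  then show ?case by auto
next
  case (Suc m)
  let ?L = "local_wt (int (Suc m) - 2) (z (int (Suc m)))"
  let ?sg = "\<lambda>s :: int \<times> int. if fst s < snd s then y - x else 0"
  let ?t = "if d' < c' then y - x else 0"
  have IH: "part_fn B z x y m s (c', d') + ?t * part_fn B z x y m s (d', c')
      = part_fn B z y x m s (c', d') + ?sg s * part_fn B z y x m (prod.swap s) (c', d')" for s
    using Suc[of "fst s" "snd s"] by (cases s) auto
  have YB: "?L x y (c, d) s + ?sg (prod.swap s) * ?L x y (c, d) (prod.swap s)
      = ?L y x (c, d) s + ?sg (c, d) * ?L y x (d, c) s" for s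
    using yang_baxter[of "int (Suc m) - 2" "z (int (Suc m))" x y c d "fst s" "snd s"] by (cases s) auto
  have "part_fn B z x y (Suc m) (c, d) (c', d') + ?t * part_fn B z x y (Suc m) (c, d) (d', c')
      = (\<Sum>s\<in>B \<times> B. ?L x y (c, d) s * (part_fn B z x y m s (c', d') + ?t * part_fn B z x y m s (d', c')))"
    by (simp only: part_fn.simps sum_distrib_left sum.distrib distrib_left mult.left_commute)
  also have "\<dots> = (\<Sum>s\<in>B \<times> B. ?L x y (c, d) s * part_fn B z y x m s (c', d'))
      + (\<Sum>s\<in>B \<times> B. ?sg s * ?L x y (c, d) s * part_fn B z y x m (prod.swap s) (c', d'))"
    unfolding IH by (simp only: sum.distrib distrib_left mult_ac)
  also have "(\<Sum>s\<in>B \<times> B. ?sg s * ?L x y (c, d) s * part_fn B z y x m (prod.swap s) (c', d'))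
      = (\<Sum>s\<in>B \<times> B. ?sg (prod.swap s) * ?L x y (c, d) (prod.swap s) * part_fn B z y x m s (c', d'))"
    by (subst sum_swap_pairs) (simp only: swap_swap)
  also have "(\<Sum>s\<in>B \<times> B. ?L x y (c, d) s * part_fn B z y x m s (c', d')) + \<dots>
      = (\<Sum>s\<in>B \<times> B. (?L x y (c, d) s + ?sg (prod.swap s) * ?L x y (c, d) (prod.swap s)) * part_fn B z y x m s (c', d'))"
    by (simp only: sum.distrib distrib_right)
  also have "\<dots> = (\<Sum>s\<in>B \<times> B. (?L y x (c, d) s + ?sg (c, d) * ?L y x (d, c) s) * part_fn B z y x m s (c', d'))"
    unfolding YB ..
  also have "\<dots> = part_fn B z y x (Suc m) (c, d) (c', d') + ?sg (c, d) * part_fn B z y x (Suc m) (d, c) (c', d')"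
    by (simp only: part_fn.simps sum_distrib_left sum.distrib distrib_right mult.assoc)
  finally show ?case
    by (cases "d' < c'"; cases "c < d") (simp_all only: if_True if_False mult_zero_left add_0_right fst_conv snd_conv)
qed

lemma part_fn_trace_comm:
  fixes x y :: "'a::comm_ring_1" and N :: int
  shows "(\<Sum>(c, d)\<in>C \<times> C. part_fn B z x y m (c, d) (c - N, d - N)) = (\<Sum>(c, d)\<in>C \<times> C. part_fn B z y x m (c, d) (c - N, d - N))"
proof -
  let ?Z = "part_fn B z x y m" and ?Z' = "part_fn B z y x m"
  have off: "?Z (c, d) (d - N, c - N) = ?Z' (c, d) (d - N, c - N)" if "d < c" for c d
    using part_fn_intertwine[of B z x y m c d "d - N" "c - N"] that by simp
  have di: "?Z (c, d) (c - N, d - N) + (if d < c then (y - x) * ?Z (c, d) (d - N, c - N) else 0)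
      = ?Z' (c, d) (c - N, d - N) + (if c < d then (y - x) * ?Z' (d, c) (c - N, d - N) else 0)" for c d
    using part_fn_intertwine[of B z x y m c d "c - N" "d - N"] by simp
  have "(\<Sum>s\<in>C \<times> C. ?Z s (fst s - N, snd s - N)) + (\<Sum>s\<in>C \<times> C. if snd s < fst s then (y - x) * ?Z s (snd s - N, fst s - N) else 0)
    = (\<Sum>s\<in>C \<times> C. ?Z' s (fst s - N, snd s - N)) + (\<Sum>s\<in>C \<times> C. if fst s < snd s then (y - x) * ?Z' (prod.swap s) (fst s - N, snd s - N) else 0)"
    unfolding sum.distrib[symmetric]
  proof (intro sum.cong refl)
    fix s :: "int \<times> int"
    show "?Z s (fst s - N, snd s - N) + (if snd s < fst s then (y - x) * ?Z s (snd s - N, fst s - N) else 0)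
      = ?Z' s (fst s - N, snd s - N) + (if fst s < snd s then (y - x) * ?Z' (prod.swap s) (fst s - N, snd s - N) else 0)"
      using di[of "fst s" "snd s"] by (simp only: prod.swap_def prod.collapse)
  qed
  also have "(\<Sum>s\<in>C \<times> C. if fst s < snd s then (y - x) * ?Z' (prod.swap s) (fst s - N, snd s - N) else 0)
    = (\<Sum>s\<in>C \<times> C. if snd s < fst s then (y - x) * ?Z' s (snd s - N, fst s - N) else 0)"
    by (subst sum_swap_pairs) (simp only: swap_swap fst_swap snd_swap)
  also have "\<dots> = (\<Sum>s\<in>C \<times> C. if snd s < fst s then (y - x) * ?Z s (snd s - N, fst s - N) else 0)"
  proof (intro sum.cong refl)
    fix s :: "int \<times> int"
    show "(if snd s < fst s then (y - x) * ?Z' s (snd s - N, fst s - N) else 0)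
      = (if snd s < fst s then (y - x) * ?Z s (snd s - N, fst s - N) else 0)"
      using off[of "snd s" "fst s"] by (simp only: prod.collapse split: if_split) simp
  qed
  finally show ?thesis by (simp add: case_prod_beta)
qed

fun run :: "int set \<Rightarrow> (int \<Rightarrow> int) \<Rightarrow> nat set \<Rightarrow> nat set \<Rightarrow> nat \<Rightarrow> int \<times> int \<Rightarrow> int \<times> int \<Rightarrow> bool" where
  "run B z A T 0 s s'' \<longleftrightarrow> s = s''"
| "run B z A T (Suc m) s s'' \<longleftrightarrow>
     valid_step (int (Suc m) - 2) (z (int (Suc m))) (Suc m \<in> A) (Suc m \<in> T) s \<and>
     step_to (int (Suc m) - 2) (Suc m \<in> A) (Suc m \<in> T) s \<in> B \<times> B \<and>
     run B z A T m (step_to (int (Suc m) - 2) (Suc m \<in> A) (Suc m \<in> T) s) s''"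

lemma run_cong: "A \<inter> {1..m} = A' \<inter> {1..m} \<Longrightarrow> T \<inter> {1..m} = T' \<inter> {1..m} \<Longrightarrow> run B z A T m s s'' = run B z A' T' m s s''"
proof (induction m arbitrary: s)
  case (Suc m)
  have e: "S \<inter> {1..m} = (S \<inter> {1..Suc m}) \<inter> {1..m}" for S :: "nat set" by auto
  have 1: "A \<inter> {1..m} = A' \<inter> {1..m}" "T \<inter> {1..m} = T' \<inter> {1..m}"
    using Suc.prems e[of A] e[of A'] e[of T] e[of T'] by (simp_all only:)
  have "Suc m \<in> {1..Suc m}" by simp
  then have 2: "Suc m \<in> A \<longleftrightarrow> Suc m \<in> A'" "Suc m \<in> T \<longleftrightarrow> Suc m \<in> T'" using Suc.prems by blast+
  show ?case unfolding run.simps 2 Suc.IH[OF 1] ..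
qed simp

lemma sum_Pow_insert:
  assumes "finite S" "a \<notin> S"
  shows "(\<Sum>A\<in>Pow (insert a S). f A) = (\<Sum>A\<in>Pow S. f (insert a A) + f A)"
proof -
  have "(\<Sum>A\<in>Pow (insert a S). f A) = (\<Sum>A\<in>Pow S. f A) + (\<Sum>A\<in>insert a ` Pow S. f A)"
    unfolding Pow_insert using assms by (intro sum.union_disjoint) auto
  also have "(\<Sum>A\<in>insert a ` Pow S. f A) = (\<Sum>A\<in>Pow S. f (insert a A))"
    using assms by (intro sum.reindex_cong[of "insert a"]) (auto simp: inj_on_def insert_eq_iff)
  finally show ?thesis by (simp add: sum.distrib add.commute)
qed

lemma sum_Pow_insert2:
  assumes "finite S" "a \<notin> S"
  shows "(\<Sum>A\<in>Pow S. \<Sum>T\<in>Pow S. f (insert a A) (insert a T) + f (insert a A) T + f A (insert a T) + f A T)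
    = (\<Sum>A\<in>Pow (insert a S). \<Sum>T\<in>Pow (insert a S). f A T)"
  by (simp only: sum_Pow_insert[OF assms] sum.distrib add_ac)

lemma part_fn_expand:
  assumes "finite B"
  shows "part_fn B z x y m s s'' = (\<Sum>A\<in>Pow {1..m}. \<Sum>T\<in>Pow {1..m}.
     if run B z A T m s s'' then x ^ (m - card A) * y ^ (m - card T) else 0)"
proof (induction m arbitrary: s)
  case (Suc m)
  let ?a = "int (Suc m) - 2" and ?e = "z (int (Suc m))"
  let ?f = "\<lambda>m A T s. if run B z A T m s s'' then x ^ (m - card A) * y ^ (m - card T) else 0"
  have part: "(\<Sum>s'\<in>B \<times> B. local_term ?a ?e x y s s' p q * part_fn B z x y m s' s'')
     = (\<Sum>A\<in>Pow {1..m}. \<Sum>T\<in>Pow {1..m}. ?f (Suc m) (if p then insert (Suc m) A else A) (if q then insert (Suc m) T else T) s)" for p q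
  proof -
    let ?s = "step_to ?a p q s"
    have "(\<Sum>s'\<in>B \<times> B. local_term ?a ?e x y s s' p q * part_fn B z x y m s' s'')
      = (\<Sum>s'\<in>B \<times> B. if s' = ?s then (if valid_step ?a ?e p q s then step_wt x y p q * part_fn B z x y m ?s s'' else 0) else 0)"
      by (intro sum.cong) (auto simp: local_term_def)
    also have "\<dots> = (if ?s \<in> B \<times> B \<and> valid_step ?a ?e p q s then step_wt x y p q * part_fn B z x y m ?s s'' else 0)"
      using assms by (subst sum.delta) auto
    also have "\<dots> = (\<Sum>A\<in>Pow {1..m}. \<Sum>T\<in>Pow {1..m}. if ?s \<in> B \<times> B \<and> valid_step ?a ?e p q s then step_wt x y p q * ?f m A T ?s else 0)"
    proof (cases "?s \<in> B \<times> B \<and> valid_step ?a ?e p q s")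
      case True
      show ?thesis unfolding if_P[OF True] Suc by (simp only: sum_distrib_left)
    next
      case False
      show ?thesis unfolding if_not_P[OF False] by simp
    qed
    also have "\<dots> = (\<Sum>A\<in>Pow {1..m}. \<Sum>T\<in>Pow {1..m}. ?f (Suc m) (if p then insert (Suc m) A else A) (if q then insert (Suc m) T else T) s)"
    proof (intro sum.cong refl)
      fix A T assume A: "A \<in> Pow {1..m}" and T: "T \<in> Pow {1..m}"
      let ?A = "if p then insert (Suc m) A else A" and ?T = "if q then insert (Suc m) T else T"
      have fin: "finite A" "finite T" using A T finite_subset by auto
      have nin: "Suc m \<notin> A" "Suc m \<notin> T" using A T by auto
      have mem: "(Suc m \<in> ?A) = p" "(Suc m \<in> ?T) = q" using nin by auto
      have Rc: "run B z ?A ?T m ?s s'' = run B z A T m ?s s''" by (rule run_cong) auto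
      have cA: "card A \<le> m" "card T \<le> m" using A T card_mono[of "{1..m}"] by auto
      have w: "x ^ (Suc m - card ?A) * y ^ (Suc m - card ?T) = step_wt x y p q * (x ^ (m - card A) * y ^ (m - card T))"
        using fin nin cA by (auto simp: step_wt_def Suc_diff_le mult_ac)
      show "(if ?s \<in> B \<times> B \<and> valid_step ?a ?e p q s then step_wt x y p q * ?f m A T ?s else 0) = ?f (Suc m) ?A ?T s"
        unfolding run.simps mem Rc w by auto
    qed
    finally show ?thesis .
  qed
  have "part_fn B z x y (Suc m) s s'' = (\<Sum>s'\<in>B \<times> B. local_term ?a ?e x y s s' True True * part_fn B z x y m s' s'')
     + (\<Sum>s'\<in>B \<times> B. local_term ?a ?e x y s s' True False * part_fn B z x y m s' s'')
     + (\<Sum>s'\<in>B \<times> B. local_term ?a ?e x y s s' False True * part_fn B z x y m s' s'')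
     + (\<Sum>s'\<in>B \<times> B. local_term ?a ?e x y s s' False False * part_fn B z x y m s' s'')"
    by (simp only: part_fn.simps local_wt_def sum.distrib distrib_right)
  also have "\<dots> = (\<Sum>A\<in>Pow {1..m}. \<Sum>T\<in>Pow {1..m}. ?f (Suc m) (insert (Suc m) A) (insert (Suc m) T) s + ?f (Suc m) (insert (Suc m) A) T s
     + ?f (Suc m) A (insert (Suc m) T) s + ?f (Suc m) A T s)"
    unfolding part by (simp only: sum.distrib if_True if_False)
  also have "\<dots> = (\<Sum>A\<in>Pow (insert (Suc m) {1..m}). \<Sum>T\<in>Pow (insert (Suc m) {1..m}). ?f (Suc m) A T s)"
    by (rule sum_Pow_insert2) auto
  also have "insert (Suc m) {1..m} = {1..Suc m}" by auto
  finally show ?case .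
qed simp

lemma run_path:
  "run B z A T m s s'' \<longleftrightarrow> (\<exists>\<sigma>. \<sigma> m = s \<and> \<sigma> 0 = s'' \<and> (\<forall>j<m. \<sigma> j \<in> B \<times> B \<and>
     \<sigma> j = step_to (int (Suc j) - 2) (Suc j \<in> A) (Suc j \<in> T) (\<sigma> (Suc j)) \<and>
     valid_step (int (Suc j) - 2) (z (int (Suc j))) (Suc j \<in> A) (Suc j \<in> T) (\<sigma> (Suc j))))"
proof (induction m arbitrary: s)
  case 0
  show ?case by (auto intro: exI[of _ "\<lambda>_. s"])
next
  case (Suc m)
  let ?s = "step_to (int (Suc m) - 2) (Suc m \<in> A) (Suc m \<in> T) s"
  show ?case (is "?l \<longleftrightarrow> (\<exists>\<sigma>. ?Q \<sigma>)")
  proof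
    assume l: ?l
    then obtain \<sigma> where \<sigma>: "\<sigma> m = ?s" "\<sigma> 0 = s''" "\<forall>j<m. \<sigma> j \<in> B \<times> B \<and>
     \<sigma> j = step_to (int (Suc j) - 2) (Suc j \<in> A) (Suc j \<in> T) (\<sigma> (Suc j)) \<and>
     valid_step (int (Suc j) - 2) (z (int (Suc j))) (Suc j \<in> A) (Suc j \<in> T) (\<sigma> (Suc j))"
      unfolding run.simps Suc by blast
    have "?Q (\<sigma>(Suc m := s))"
    proof (intro conjI allI impI)
      fix j assume j: "j < Suc m"
      let ?\<sigma> = "\<sigma>(Suc m := s)"
      show "?\<sigma> j \<in> B \<times> B" "?\<sigma> j = step_to (int (Suc j) - 2) (Suc j \<in> A) (Suc j \<in> T) (?\<sigma> (Suc j))"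
        "valid_step (int (Suc j) - 2) (z (int (Suc j))) (Suc j \<in> A) (Suc j \<in> T) (?\<sigma> (Suc j))"
        using \<sigma> j l by (cases "j = m"; simp del: of_nat_Suc)+
    qed (use \<sigma> in auto)
    then show "\<exists>\<sigma>. ?Q \<sigma>" by blast
  next
    assume "\<exists>\<sigma>. ?Q \<sigma>"
    then obtain \<sigma> where \<sigma>: "?Q \<sigma>" by blast
    have s: "\<sigma> (Suc m) = s" using \<sigma> by blast
    have sm: "\<sigma> m = ?s" "\<sigma> m \<in> B \<times> B" "valid_step (int (Suc m) - 2) (z (int (Suc m))) (Suc m \<in> A) (Suc m \<in> T) s"
      using \<sigma> s by (metis lessI)+
    have "\<forall>j<m. \<sigma> j \<in> B \<times> B \<and>
     \<sigma> j = step_to (int (Suc j) - 2) (Suc j \<in> A) (Suc j \<in> T) (\<sigma> (Suc j)) \<and>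
     valid_step (int (Suc j) - 2) (z (int (Suc j))) (Suc j \<in> A) (Suc j \<in> T) (\<sigma> (Suc j))"
      using \<sigma> by (meson less_SucI)
    then have "run B z A T m ?s s''" unfolding Suc using sm(1) \<sigma> by blast
    then show ?l unfolding run.simps using sm by simp
  qed
qed

context affine
begin

definition siteA :: "int set \<Rightarrow> nat set" where "siteA A = {j \<in> {1..n}. on A (int j - 1)}"
definition siteT :: "int set \<Rightarrow> nat set" where "siteT T = {j \<in> {1..n}. on T (int j)}"

definition carriers :: "int set \<Rightarrow> int set \<Rightarrow> int \<Rightarrow> int \<times> int" where
  "carriers A T i = (nxt A (i - 1) - 1, cyc A (nxt T i - 1))"

abbreviation box :: "int set" where "box \<equiv> {-1..3 * N}"

lemma nxt_step: assumes T: "is_support T" shows "nxt T (j - 1) = (if on T j then j else nxt T j)"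
proof (cases "on T j")
  case True
  then show ?thesis by (auto intro: nxt_eqI)
next
  case False
  have "nxt T (j - 1) = nxt T j"
  proof (rule nxt_eqI)
    show "j - 1 < nxt T j" using nxt_gt[of j T] by simp
    show "on T (nxt T j)" using nxt_on[OF T] .
    fix y assume y: "j - 1 < y" "y < nxt T j"
    show "\<not> on T y"
    proof (cases "y = j")
      case False
      then show ?thesis using y nxt_between[of j y T] by simp
    qed (use \<open>\<not> on T j\<close> in simp)
  qed
  then show ?thesis using False by simp
qed

lemma cyc_shift: assumes "is_support T" shows "cyc T (x + q * N) = cyc T x + q * N"
  using P_shift_mult[OF cyc_P[OF assms]] .

lemma carriers_step:
  assumes A: "is_support A" and T: "is_support T"
  shows "carriers A T (j - 1) = step_to (j - 2) (on A (j - 1)) (on T j) (carriers A T j)"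
    "(if on A (j - 1) then fst (carriers A T j) else j - 2) = cyc A (j - 1)"
    "on A (j - 1) \<or> fst (carriers A T j) > j - 2"
    "on T j \<Longrightarrow> snd (carriers A T j) = cyc A (cyc T j)"
proof -
  have a: "nxt A (j - 1 - 1) = (if on A (j - 1) then j - 1 else nxt A (j - 1))" by (rule nxt_step[OF A])
  have t: "nxt T (j - 1) = (if on T j then j else nxt T j)" by (rule nxt_step[OF T])
  show site: "(if on A (j - 1) then fst (carriers A T j) else j - 2) = cyc A (j - 1)"
    by (simp add: carriers_def cyc_def)
  show "on A (j - 1) \<or> fst (carriers A T j) > j - 2"
    using nxt_gt[of "j - 1" A] by (simp add: carriers_def)
  show "on T j \<Longrightarrow> snd (carriers A T j) = cyc A (cyc T j)"
    by (simp add: carriers_def cyc_def)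
  have 1: "fst (carriers A T (j - 1)) = (if on A (j - 1) then j - 2 else fst (carriers A T j))"
    unfolding carriers_def fst_conv a by simp
  have 2: "snd (carriers A T (j - 1)) = (if on T j then cyc A (j - 1) else snd (carriers A T j))"
    unfolding carriers_def snd_conv t by simp
  show "carriers A T (j - 1) = step_to (j - 2) (on A (j - 1)) (on T j) (carriers A T j)"
    unfolding step_to_def site by (rule prod_eqI) (simp_all only: 1 2 fst_conv snd_conv)
qed

lemma carriers_shift: assumes "is_support A" "is_support T"
  shows "carriers A T (i - N) = (fst (carriers A T i) - N, snd (carriers A T i) - N)"
proof -
  have 1: "nxt A (i - N - 1) = nxt A (i - 1) - N"
    using nxt_shift[OF assms(1), of "i - 1" "- 1"] by (simp add: algebra_simps)
  have 2: "nxt T (i - N) = nxt T i - N"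
    using nxt_shift[OF assms(2), of i "- 1"] by simp
  have 3: "cyc A (nxt T i - N - 1) = cyc A (nxt T i - 1) - N"
    using cyc_shift[OF assms(1), of "nxt T i - 1" "- 1"] by (simp add: algebra_simps)
  show ?thesis by (simp only: carriers_def 1 2 3 fst_conv snd_conv) simp
qed

lemma carriers_box: assumes A: "is_support A" and T: "is_support T" and i: "0 \<le> i" "i \<le> N"
  shows "carriers A T i \<in> box \<times> box"
proof -
  have 1: "i - 1 < nxt A (i - 1)" "nxt A (i - 1) \<le> i - 1 + N" using nxt_gt nxt_le[OF A] by auto
  have 2: "i < nxt T i" "nxt T i \<le> i + N" using nxt_gt nxt_le[OF T] by auto
  have 3: "cyc A (nxt T i - 1) \<ge> nxt T i - 2" using cyc_ge[where T=A and x="nxt T i - 1"] by simp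
  have 4: "cyc A (nxt T i - 1) \<le> nxt T i - 2 + N"
    using nxt_le[OF A, of "nxt T i - 1"] N_pos by (simp add: cyc_def)
  show ?thesis using 1 2 3 4 i by (simp add: carriers_def)
qed

lemma closed_run_iff:
  assumes A: "is_support A" and T: "is_support T" and z: "z \<in> P"
  shows "run box z (siteA A) (siteT T) n s (fst s - N, snd s - N) \<longleftrightarrow>
     s = carriers A T N \<and> cyc A \<circ> cyc T = z \<and> len z = len (cyc A) + len (cyc T)"
proof
  assume R: "run box z (siteA A) (siteT T) n s (fst s - N, snd s - N)"
  then obtain \<sigma> where \<sigma>: "\<sigma> n = s" "\<sigma> 0 = (fst s - N, snd s - N)" and st: "\<And>j. j < n \<Longrightarrow>
     \<sigma> j = step_to (int (Suc j) - 2) (Suc j \<in> siteA A) (Suc j \<in> siteT T) (\<sigma> (Suc j)) \<and>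
     valid_step (int (Suc j) - 2) (z (int (Suc j))) (Suc j \<in> siteA A) (Suc j \<in> siteT T) (\<sigma> (Suc j))"
    unfolding run_path by blast
  have mem: "(Suc j \<in> siteA A) = on A (int j)" "(Suc j \<in> siteT T) = on T (int j + 1)" if "j < n" for j
    using that by (simp_all add: siteA_def siteT_def add.commute)
  have st': "\<sigma> j = step_to (int j - 1) (on A (int j)) (on T (int j + 1)) (\<sigma> (Suc j))"
     "valid_step (int j - 1) (z (int j + 1)) (on A (int j)) (on T (int j + 1)) (\<sigma> (Suc j))" if "j < n" for j
  proof -
    have "int (Suc j) - 2 = int j - 1" "int (Suc j) = int j + 1" by simp_all
    then show "\<sigma> j = step_to (int j - 1) (on A (int j)) (on T (int j + 1)) (\<sigma> (Suc j))"
     "valid_step (int j - 1) (z (int j + 1)) (on A (int j)) (on T (int j + 1)) (\<sigma> (Suc j))"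
      using st[OF that] unfolding mem[OF that] by metis+
  qed
  let ?c = "\<lambda>i. carriers A T (int i)"
  have ca: "?c j = step_to (int j - 1) (on A (int j)) (on T (int j + 1)) (?c (Suc j))" for j
    using carriers_step(1)[OF A T, of "int j + 1"] by (simp add: add.commute)
  have site: "(if on A (int j) then fst (?c (Suc j)) else int j - 1) = cyc A (int j)" for j
  proof -
    have e: "int (Suc j) - 1 = int j" "int (Suc j) - 2 = int j - 1" by simp_all
    show ?thesis using carriers_step(2)[OF A T, of "int (Suc j)"] unfolding e .
  qed
  have c0: "?c 0 = (fst (?c n) - N, snd (?c n) - N)"
    using carriers_shift[OF A T, of N] by simp
  obtain ja where ja: "ja < n" "on A (int ja)" using ex_on[OF A, of 0] by auto
  obtain jt where jt: "jt < n" "on T (int jt + 1)" using ex_on[OF T, of 1] by (auto simp: add.commute)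
  have f1: "fst (\<sigma> j) = fst (?c j)" if "j \<le> m" "m \<le> n" "fst (\<sigma> m) = fst (?c m)" for j m
    using that(1)
  proof (induction rule: inc_induct)
    case base
    show ?case by (rule that(3))
  next
    case (step i)
    then have "i < n" using that by simp
    then show ?case using st'(1)[of i] ca[of i] step.IH by (simp add: step_to_def del: of_nat_Suc)
  qed
  have "fst (\<sigma> ja) = fst (?c ja)" using st'(1)[OF ja(1)] ca[of ja] ja(2) by (simp add: step_to_def)
  then have "fst (\<sigma> 0) = fst (?c 0)" using f1[of 0 ja] ja by simp
  then have "fst (\<sigma> n) = fst (?c n)" unfolding c0 \<sigma> by simp
  then have f2: "fst (\<sigma> j) = fst (?c j)" if "j \<le> n" for j using f1[of j n] that by simp
  have s1: "snd (\<sigma> j) = snd (?c j)" if "j \<le> m" "m \<le> n" "snd (\<sigma> m) = snd (?c m)" for j m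
    using that(1)
  proof (induction rule: inc_induct)
    case base
    show ?case by (rule that(3))
  next
    case (step i)
    then have "i < n" using that by simp
    then show ?case using st'(1)[of i] ca[of i] step.IH f2[of "Suc i"] by (simp add: step_to_def del: of_nat_Suc)
  qed
  have "snd (\<sigma> jt) = snd (?c jt)" using st'(1)[OF jt(1)] ca[of jt] jt f2[of "Suc jt"] by (simp add: step_to_def del: of_nat_Suc)
  then have "snd (\<sigma> 0) = snd (?c 0)" using s1[of 0 jt] jt by simp
  then have "snd (\<sigma> n) = snd (?c n)" unfolding c0 \<sigma> by simp
  then have s2: "snd (\<sigma> j) = snd (?c j)" if "j \<le> n" for j using s1[of j n] that by simp
  have eq: "\<sigma> j = ?c j" if "j \<le> n" for j using f2[OF that] s2[OF that] by (rule prod_eqI)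
  have s: "s = carriers A T N" using eq[of n] \<sigma> by simp
  have v: "valid_step (int j - 1) (z (int j + 1)) (on A (int j)) (on T (int j + 1)) (?c (Suc j))" if "j < n" for j
    using st'(2)[OF that] eq[of "Suc j"] that by simp
  have vz: "z (int j + 1) = cyc A (cyc T (int j + 1))"
    "\<not> on T (int j + 1) \<Longrightarrow> cyc A (nxt T (int j + 1) - 1) > cyc A (int j)" if "j < n" for j
  proof -
    have sn: "snd (?c (Suc j)) = cyc A (nxt T (int j + 1) - 1)" by (simp add: carriers_def add.commute)
    show "z (int j + 1) = cyc A (cyc T (int j + 1))"
      using v[OF that] unfolding valid_step_def site sn by (cases "on T (int j + 1)") (simp_all add: cyc_def[of T])
    show "\<not> on T (int j + 1) \<Longrightarrow> cyc A (nxt T (int j + 1) - 1) > cyc A (int j)"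
      using v[OF that] unfolding valid_step_def site sn by simp
  qed
  have dec: "\<exists>j q. j < n \<and> x = int j + 1 + q * N" for x
  proof -
    have "x = (x - 1) mod N + 1 + (x - 1) div N * N" by simp
    moreover have "0 \<le> (x - 1) mod N" "(x - 1) mod N < N" using N_pos by simp_all
    ultimately show ?thesis by (intro exI[of _ "nat ((x - 1) mod N)"] exI[of _ "(x - 1) div N"]) simp
  qed
  have "cyc A (cyc T x) = z x" for x
  proof -
    obtain j q where jq: "j < n" "x = int j + 1 + q * N" using dec by blast
    then show ?thesis using vz(1)[OF jq(1)] P_shift_mult[OF z] cyc_shift[OF A] cyc_shift[OF T] by simp
  qed
  then have zz: "cyc A \<circ> cyc T = z" by (simp add: fun_eq_iff)
  have "len (cyc A \<circ> cyc T) = len (cyc A) + len (cyc T)"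
  proof (rule additiveI[OF cyc_P[OF A] cyc_P[OF T]])
    fix i x assume ix: "i < x" "cyc T i > cyc T x"
    then have "(i, x) \<in> Inv (cyc T)" by (simp add: Inv_def)
    then have i: "on T i" "\<not> on T x" "x < nxt T i" unfolding Inv_cyc[OF T] by auto
    obtain j q where jq: "j < n" "x = int j + 1 + q * N" using dec by blast
    have nx: "nxt T x = nxt T i"
      using i ix nxt_on[OF T] nxt_between[of i _ T] by (intro nxt_eqI) auto
    have "\<not> on T (int j + 1)" using i jq by simp
    then have "cyc A (nxt T (int j + 1) - 1 + q * N) > cyc A (int j + q * N)"
      using vz(2)[OF jq(1)] unfolding cyc_shift[OF A] by simp
    moreover have "nxt T (int j + 1) - 1 + q * N = cyc T i" "int j + q * N = cyc T x"
      using nx i jq nxt_shift[OF T, of "int j + 1" q] by (simp_all add: cyc_def)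
    ultimately show "cyc A (cyc T i) > cyc A (cyc T x)" by simp
  qed
  then show "s = carriers A T N \<and> cyc A \<circ> cyc T = z \<and> len z = len (cyc A) + len (cyc T)"
    using s zz by simp
next
  assume H: "s = carriers A T N \<and> cyc A \<circ> cyc T = z \<and> len z = len (cyc A) + len (cyc T)"
  then have zx: "z x = cyc A (cyc T x)" for x by auto
  show "run box z (siteA A) (siteT T) n s (fst s - N, snd s - N)"
    unfolding run_path
  proof (intro exI[of _ "\<lambda>i. carriers A T (int i)"] conjI allI impI)
    show "carriers A T (int n) = s" using H by simp
    show "carriers A T (int 0) = (fst s - N, snd s - N)"
      using carriers_shift[OF A T, of N] H by simp
    fix j assume j: "j < n"
    show "carriers A T (int j) \<in> box \<times> box" using carriers_box[OF A T, of "int j"] j by simp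
    have mem: "(Suc j \<in> siteA A) = on A (int (Suc j) - 1)" "(Suc j \<in> siteT T) = on T (int (Suc j))"
      using j by (simp_all add: siteA_def siteT_def)
    show "carriers A T (int j) = step_to (int (Suc j) - 2) (Suc j \<in> siteA A) (Suc j \<in> siteT T) (carriers A T (int (Suc j)))"
      unfolding mem using carriers_step(1)[OF A T, of "int (Suc j)"] by simp
    show "valid_step (int (Suc j) - 2) (z (int (Suc j))) (Suc j \<in> siteA A) (Suc j \<in> siteT T) (carriers A T (int (Suc j)))"
      unfolding mem valid_step_def carriers_step(2)[OF A T] zx
    proof (intro conjI)
      let ?j = "int (Suc j)"
      show "on A (?j - 1) \<or> ?j - 2 < fst (carriers A T ?j)" by (rule carriers_step(3)[OF A T])
      show "if on T ?j then cyc A (cyc T ?j) = snd (carriers A T ?j)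
        else cyc A (?j - 1) < snd (carriers A T ?j) \<and> cyc A (cyc T ?j) = cyc A (?j - 1)"
      proof (cases "on T ?j")
        case True
        then show ?thesis using carriers_step(4)[OF A T True] by (simp del: of_nat_Suc)
      next
        case False
        obtain a where a: "on T a" "a \<le> ?j" "?j < nxt T a" using prev_ex[OF T] by blast
        have "a < ?j" using a False by (cases "a = ?j") auto
        moreover have nx: "nxt T ?j = nxt T a"
          using a \<open>a < ?j\<close> nxt_on[OF T] nxt_between[of a _ T] by (intro nxt_eqI) auto
        moreover have "cyc T a > cyc T ?j" using a False by (simp add: cyc_def)
        ultimately have "cyc A (cyc T a) > cyc A (cyc T ?j)"
          using additiveD[OF cyc_P[OF A] cyc_P[OF T], of a ?j] H by simp
        then show ?thesis using False a nx by (simp add: cyc_def[of T] carriers_def del: of_nat_Suc)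
      qed
    qed
  qed
qed

definition closed_runs :: "(int \<Rightarrow> int) \<Rightarrow> nat \<Rightarrow> nat \<Rightarrow> ((int \<times> int) \<times> nat set \<times> nat set) set" where
  "closed_runs z a b = {(s, A, T). s \<in> {N - 1..3 * N} \<times> {N - 1..3 * N} \<and> A \<subseteq> {1..n} \<and> T \<subseteq> {1..n} \<and>
     n - card A = a \<and> n - card T = b \<and> run box z A T n s (fst s - N, snd s - N)}"

lemma coeff_trace:
  assumes ab: "a \<le> n" "b \<le> n" and ex: "\<And>i j. i \<le> n \<Longrightarrow> j \<le> n \<Longrightarrow> ex * i + ey * j = D \<longleftrightarrow> i = a \<and> j = b"
  shows "Polynomial.coeff (\<Sum>(c, d)\<in>{N - 1..3 * N} \<times> {N - 1..3 * N}.
     part_fn box z (Polynomial.monom (1::int) ex) (Polynomial.monom 1 ey) n (c, d) (c - N, d - N)) D = int (card (closed_runs z a b))"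
proof -
  let ?C = "{N - 1..3 * N} \<times> {N - 1..3 * N}" and ?S = "Pow {1..n} :: nat set set"
  let ?R = "\<lambda>s A T. run box z A T n s (fst s - N, snd s - N)"
  have "Polynomial.coeff (if ?R s A T then Polynomial.monom (1::int) ex ^ (n - card A) * Polynomial.monom 1 ey ^ (n - card T) else 0) D
      = (if ?R s A T \<and> n - card A = a \<and> n - card T = b then 1 else 0)" for s A T
  proof -
    have "Polynomial.coeff (Polynomial.monom (1::int) ex ^ (n - card A) * Polynomial.monom 1 ey ^ (n - card T)) D
        = (if ex * (n - card A) + ey * (n - card T) = D then 1 else 0)"
      by (simp add: Polynomial.monom_power Polynomial.mult_monom)
    also have "\<dots> = (if n - card A = a \<and> n - card T = b then 1 else 0)"
      using ex[of "n - card A" "n - card T"] by (simp only: diff_le_self)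
    finally show ?thesis by (cases "?R s A T") (simp_all only: if_True if_False simp_thms Polynomial.coeff_0)
  qed
  then have "Polynomial.coeff (\<Sum>(c, d)\<in>?C. part_fn box z (Polynomial.monom (1::int) ex) (Polynomial.monom 1 ey) n (c, d) (c - N, d - N)) D
    = (\<Sum>s\<in>?C. \<Sum>A\<in>?S. \<Sum>T\<in>?S. if ?R s A T \<and> n - card A = a \<and> n - card T = b then 1 else 0)"
    unfolding Polynomial.coeff_sum
    by (intro sum.cong refl) (auto simp: part_fn_expand Polynomial.coeff_sum)
  also have "\<dots> = (\<Sum>p\<in>?C \<times> ?S \<times> ?S. if ?R (fst p) (fst (snd p)) (snd (snd p)) \<and> n - card (fst (snd p)) = a \<and> n - card (snd (snd p)) = b then 1 else 0)"
    by (simp add: sum.cartesian_product case_prod_beta)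
  also have "\<dots> = int (card {p \<in> ?C \<times> ?S \<times> ?S. ?R (fst p) (fst (snd p)) (snd (snd p)) \<and> n - card (fst (snd p)) = a \<and> n - card (snd (snd p)) = b})"
    by (subst sum.inter_filter[symmetric]) auto
  also have "{p \<in> ?C \<times> ?S \<times> ?S. ?R (fst p) (fst (snd p)) (snd (snd p)) \<and> n - card (fst (snd p)) = a \<and> n - card (snd (snd p)) = b} = closed_runs z a b"
    by (auto simp: closed_runs_def)
  finally show ?thesis .
qed

lemma closed_runs_comm:
  assumes "a \<le> n" "b \<le> n" shows "card (closed_runs z a b) = card (closed_runs z b a)"
proof -
  let ?K = "Suc n"
  have u: "i + ?K * j = a + ?K * b \<longleftrightarrow> i = a \<and> j = b" if "i \<le> n" "j \<le> n" for i j
  proof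
    assume e: "i + ?K * j = a + ?K * b"
    have "(i + ?K * j) mod ?K = i" "(a + ?K * b) mod ?K = a"
      using that assms by (simp_all only: mod_mult_self2 mod_less less_Suc_eq_le)
    then have "i = a" using e by metis
    then have "?K * j = ?K * b" using e by (simp only: add_left_cancel)
    then show "i = a \<and> j = b" using \<open>i = a\<close> by (simp only: mult_left_cancel simp_thms nat.simps mult_cancel1)
  qed simp
  let ?x = "Polynomial.monom (1::int) 1" and ?y = "Polynomial.monom (1::int) ?K"
  let ?C = "{N - 1..3 * N} \<times> {N - 1..3 * N}"
  have "int (card (closed_runs z a b)) = Polynomial.coeff (\<Sum>(c, d)\<in>?C. part_fn box z ?x ?y n (c, d) (c - N, d - N)) (a + ?K * b)"
    by (rule coeff_trace[symmetric]) (use assms u in auto)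
  also have "(\<Sum>(c, d)\<in>?C. part_fn box z ?x ?y n (c, d) (c - N, d - N)) = (\<Sum>(c, d)\<in>?C. part_fn box z ?y ?x n (c, d) (c - N, d - N))"
    by (rule part_fn_trace_comm)
  also have "Polynomial.coeff \<dots> (a + ?K * b) = int (card (closed_runs z b a))"
  proof (rule coeff_trace)
    fix i j assume "i \<le> n" "j \<le> n"
    then show "?K * i + 1 * j = a + ?K * b \<longleftrightarrow> i = b \<and> j = a" using u[of j i] by (simp only: add.commute mult_1) blast
  qed (use assms in auto)
  finally show ?thesis by simp
qed

definition cpairs :: "(int \<Rightarrow> int) \<Rightarrow> nat \<Rightarrow> nat \<Rightarrow> (int set \<times> int set) set" where
  "cpairs z a b = {(A, T). A \<in> supports a \<and> T \<in> supports b \<and> cyc A \<circ> cyc T = z \<and> len z = a + b}"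

lemma card_siteT: assumes "T \<subseteq> {0..<N}" shows "card (siteT T) = card T"
proof -
  have "card (siteT T) = card {x \<in> {1..N}. on T x}"
  proof (rule bij_betw_same_card)
    show "bij_betw int (siteT T) {x \<in> {1..N}. on T x}"
      by (rule bij_betw_byWitness[where f'=nat]) (auto simp: siteT_def)
  qed
  then show ?thesis using card_residues[OF assms] by simp
qed

lemma card_siteA: assumes "A \<subseteq> {0..<N}" shows "card (siteA A) = card A"
proof -
  have "bij_betw (\<lambda>t. nat t + 1) A (siteA A)"
    by (rule bij_betw_byWitness[where f'="\<lambda>j. int j - 1"]) (use assms in \<open>auto simp: siteA_def subset_iff\<close>)
  then show ?thesis by (metis bij_betw_same_card)
qed

lemma card_closed_runs:
  assumes z: "z \<in> P" and ab: "a < n" "b < n"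
  shows "card (closed_runs z a b) = card (cpairs z a b)"
proof (rule bij_betw_same_card[symmetric])
  let ?f = "\<lambda>(A, T). (carriers A T N, siteA A, siteT T)"
  let ?A = "\<lambda>S. (\<lambda>j. int j - 1) ` S" and ?T = "\<lambda>S. (\<lambda>j. int j mod N) ` S"
  have invA: "?A (siteA A) = A" if "A \<subseteq> {0..<N}" for A
  proof
    show "?A (siteA A) \<subseteq> A" by (auto simp: siteA_def)
    show "A \<subseteq> ?A (siteA A)"
    proof
      fix t assume "t \<in> A"
      then show "t \<in> ?A (siteA A)" using that by (intro image_eqI[of _ _ "nat t + 1"]) (auto simp: siteA_def)
    qed
  qed
  have invT: "?T (siteT T) = T" if T: "T \<subseteq> {0..<N}" for T
  proof
    show "?T (siteT T) \<subseteq> T" by (auto simp: siteT_def)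
    show "T \<subseteq> ?T (siteT T)"
    proof
      fix t assume t: "t \<in> T"
      then have t0: "0 \<le> t" "t < N" using T by auto
      show "t \<in> ?T (siteT T)"
      proof (cases "t = 0")
        case True
        then show ?thesis using t N_pos by (intro image_eqI[of _ _ n]) (auto simp: siteT_def)
      next
        case False
        then show ?thesis using t t0 by (intro image_eqI[of _ _ "nat t"]) (auto simp: siteT_def)
      qed
    qed
  qed
  have invA': "siteA (?A S) = S" if S: "S \<subseteq> {1..n}" for S
  proof -
    have "on (?A S) (int j - 1) \<longleftrightarrow> j \<in> S" if "j \<in> {1..n}" for j
    proof -
      have "(int j - 1) mod N = int j - 1" using that by simp
      then show ?thesis by auto
    qed
    then show ?thesis using S by (auto simp: siteA_def)
  qed
  have invT': "siteT (?T S) = S" if S: "S \<subseteq> {1..n}" for S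
  proof -
    have "on (?T S) (int j) \<longleftrightarrow> j \<in> S" if j: "j \<in> {1..n}" for j
    proof
      assume "on (?T S) (int j)"
      then obtain i where i: "i \<in> S" "int j mod N = int i mod N" by auto
      then obtain q where q: "int j = int i + q * N" using mod_eqE by blast
      have "1 \<le> int i" "int i \<le> N" using i S by (auto simp: subset_iff)
      then have "q = 0" using rep_shift_zero[of "int i" q] q j by auto
      then show "j \<in> S" using q i by simp
    qed auto
    then show ?thesis using S by (auto simp: siteT_def)
  qed
  show "bij_betw ?f (cpairs z a b) (closed_runs z a b)"
  proof (rule bij_betw_byWitness[where f'="\<lambda>(s, A, T). (?A A, ?T T)"])
    show "\<forall>p\<in>cpairs z a b. (\<lambda>(s, A, T). (?A A, ?T T)) (?f p) = p"
    proof
      fix p assume "p \<in> cpairs z a b"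
      then obtain A T where p: "p = (A, T)" "is_support A" "is_support T" by (auto simp: cpairs_def supports_def)
      then show "(\<lambda>(s, A, T). (?A A, ?T T)) (?f p) = p" using invA[of A] invT[of T] by (simp add: is_support_def)
    qed
    show "?f ` cpairs z a b \<subseteq> closed_runs z a b"
    proof
      fix p assume "p \<in> ?f ` cpairs z a b"
      then obtain A T where p: "p = (carriers A T N, siteA A, siteT T)" and AT: "A \<in> supports a" "T \<in> supports b" "cyc A \<circ> cyc T = z" "len z = a + b"
        by (auto simp: cpairs_def)
      note tA = supports_D[OF AT(1)] and tT = supports_D[OF AT(2)]
      have "run box z (siteA A) (siteT T) n (carriers A T N) (fst (carriers A T N) - N, snd (carriers A T N) - N)"
        unfolding closed_run_iff[OF tA(1) tT(1) z] using AT tA tT by simp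
      moreover have "carriers A T N \<in> {N - 1..3 * N} \<times> {N - 1..3 * N}"
        using carriers_box[OF tA(1) tT(1), of N] carriers_box[OF tA(1) tT(1), of 0] carriers_shift[OF tA(1) tT(1), of N] N_pos
        by (cases "carriers A T N") auto
      moreover have "n - card (siteA A) = a" "n - card (siteT T) = b"
        using card_siteA[of A] card_siteT[of T] AT tA(1) tT(1) by (simp_all add: supports_def is_support_def)
      ultimately show "p \<in> closed_runs z a b" unfolding p closed_runs_def by (auto simp: siteA_def siteT_def)
    qed
    have pre: "\<exists>A T. p = ?f (A, T) \<and> (A, T) \<in> cpairs z a b" if pin: "p \<in> closed_runs z a b" for p
    proof -
      obtain s S1 S2 where p: "p = (s, S1, S2)" "S1 \<subseteq> {1..n}" "S2 \<subseteq> {1..n}" "n - card S1 = a" "n - card S2 = b"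
        "run box z S1 S2 n s (fst s - N, snd s - N)" using pin unfolding closed_runs_def by blast
      have ne: "S1 \<noteq> {}" "S2 \<noteq> {}" using p(4,5) ab by auto
      define A where "A = ?A S1"
      define T where "T = ?T S2"
      have A: "is_support A" using ne p(2) by (auto simp: A_def is_support_def subset_iff)
      have T: "is_support T" using ne p(3) N_pos by (auto simp: T_def is_support_def subset_iff)
      have S: "siteA A = S1" "siteT T = S2" using invA'[OF p(2)] invT'[OF p(3)] by (auto simp: A_def T_def)
      have c: "n - card A = a" "n - card T = b"
        using card_siteA[of A] card_siteT[of T] A T S p(4,5) by (simp_all add: is_support_def)
      have "s = carriers A T N \<and> cyc A \<circ> cyc T = z \<and> len z = len (cyc A) + len (cyc T)"
        using p(6) closed_run_iff[OF A T z, of s] S by simp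
      then show ?thesis using p(1) S A T c len_cyc[OF A] len_cyc[OF T]
        by (intro exI[of _ A] exI[of _ T]) (simp add: cpairs_def supports_def)
    qed
    show "\<forall>p\<in>closed_runs z a b. ?f ((\<lambda>(s, A, T). (?A A, ?T T)) p) = p"
    proof
      fix p assume "p \<in> closed_runs z a b"
      then obtain A T where p: "p = ?f (A, T)" "(A, T) \<in> cpairs z a b" using pre by blast
      then have "A \<subseteq> {0..<N}" "T \<subseteq> {0..<N}" by (auto simp: cpairs_def supports_def is_support_def)
      then show "?f ((\<lambda>(s, A, T). (?A A, ?T T)) p) = p" unfolding p(1) using invA[of A] invT[of T] by simp
    qed
    show "(\<lambda>(s, A, T). (?A A, ?T T)) ` closed_runs z a b \<subseteq> cpairs z a b"
    proof
      fix q assume "q \<in> (\<lambda>(s, A, T). (?A A, ?T T)) ` closed_runs z a b"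
      then obtain p where q: "p \<in> closed_runs z a b" "q = (\<lambda>(s, A, T). (?A A, ?T T)) p" by blast
      then obtain A T where p: "p = ?f (A, T)" "(A, T) \<in> cpairs z a b" using pre by blast
      then have "A \<subseteq> {0..<N}" "T \<subseteq> {0..<N}" by (auto simp: cpairs_def supports_def is_support_def)
      then show "q \<in> cpairs z a b" unfolding q(2) p(1) using invA[of A] invT[of T] p(2) by simp
    qed
  qed
qed

lemma cpairs_comm: assumes "z \<in> P" shows "card (cpairs z a b) = card (cpairs z b a)"
proof (cases "a < n \<and> b < n")
  case True
  then show ?thesis
    using card_closed_runs[OF assms, of a b] card_closed_runs[OF assms, of b a] closed_runs_comm[of a b z] by simp
next
  case False
  then have "supports a = {} \<or> supports b = {}" using supports_D(5) by blast
  then have "cpairs z a b = {}" "cpairs z b a = {}" by (auto simp: cpairs_def)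
  then show ?thesis by simp
qed

lemma U_U_sum:
  "U a (U b F) w = (\<Sum>p | p \<in> supports a \<times> supports b \<and> len (cyc (fst p) \<circ> cyc (snd p)) = a + b. left_op (cyc (fst p) \<circ> cyc (snd p)) F w)"
proof -
  have "U a (U b F) w = (\<Sum>A\<in>supports a. \<Sum>B\<in>supports b. left_op (cyc A) (left_op (cyc B) F) w)"
    unfolding U_def left_op_sum ..
  also have "\<dots> = (\<Sum>A\<in>supports a. \<Sum>B\<in>supports b. if len (cyc A \<circ> cyc B) = a + b then left_op (cyc A \<circ> cyc B) F w else 0)"
  proof (intro sum.cong refl)
    fix A B assume A: "A \<in> supports a" and B: "B \<in> supports b"
    show "left_op (cyc A) (left_op (cyc B) F) w = (if len (cyc A \<circ> cyc B) = a + b then left_op (cyc A \<circ> cyc B) F w else 0)"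
      unfolding left_op_left_op[OF supports_D(2)[OF A] supports_D(2)[OF B]] supports_D(3)[OF A] supports_D(3)[OF B] ..
  qed
  also have "\<dots> = (\<Sum>p\<in>supports a \<times> supports b. if len (cyc (fst p) \<circ> cyc (snd p)) = a + b then left_op (cyc (fst p) \<circ> cyc (snd p)) F w else 0)"
    by (simp only: sum.cartesian_product case_prod_unfold)
  also have "\<dots> = (\<Sum>p | p \<in> supports a \<times> supports b \<and> len (cyc (fst p) \<circ> cyc (snd p)) = a + b. left_op (cyc (fst p) \<circ> cyc (snd p)) F w)"
    by (rule sum.inter_filter[symmetric]) (simp add: finite_supports)
  finally show ?thesis .
qed

lemma U_comm: "U a (U b F) = U b (U a F)"
proof
  fix w
  let ?z = "\<lambda>p. cyc (fst p) \<circ> cyc (snd p)"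
  let ?S = "\<lambda>a b. {p. p \<in> supports a \<times> supports b \<and> len (?z p) = a + b}"
  have fib: "{p \<in> ?S a b. ?z p = z} = cpairs z a b" for a b z
    unfolding cpairs_def by force
  have e: "card {p \<in> ?S a b. ?z p = z} = card {p \<in> ?S b a. ?z p = z}" for z
  proof (cases "z \<in> P")
    case True
    then show ?thesis unfolding fib by (rule cpairs_comm)
  next
    case False
    have "cpairs z a b = {}" for a b
      using False P_comp supports_D(2) unfolding cpairs_def by blast
    then show ?thesis unfolding fib by simp
  qed
  show "U a (U b F) w = U b (U a F) w"
    unfolding U_U_sum
    by (rule sum_fibres[where g="\<lambda>z. left_op z F w"]) (use e in \<open>simp_all add: finite_supports\<close>)
qed

end

lemma poly_mapping_sum_single: "p = (\<Sum>\<alpha>\<in>Poly_Mapping.keys p. Poly_Mapping.single \<alpha> (lkp p \<alpha>))"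
proof (rule poly_mapping_eqI)
  fix \<beta>
  have "lkp (\<Sum>\<alpha>\<in>Poly_Mapping.keys p. Poly_Mapping.single \<alpha> (lkp p \<alpha>)) \<beta>
      = (\<Sum>\<alpha>\<in>Poly_Mapping.keys p. if \<alpha> = \<beta> then lkp p \<alpha> else 0)"
    by (simp add: lookup_sum lookup_single when_def)
  also have "\<dots> = lkp p \<beta>" by (simp add: sum.delta in_keys_iff)
  finally show "lkp p \<beta> = lkp (\<Sum>\<alpha>\<in>Poly_Mapping.keys p. Poly_Mapping.single \<alpha> (lkp p \<alpha>)) \<beta>" by simp
qed

text \<open>The generators \<open>h_gen r\<close> of a polynomial ring stand for the operators \<open>U r\<close>, and the elements \<open>e_gen r\<close>
  for \<open>(-1) ^ r\<close> times the operators \<open>V r\<close>.\<close>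

definition h_gen :: "nat \<Rightarrow> int_mpoly" where
  "h_gen r = (if r = 0 then 1 else var r)"

function e_gen :: "nat \<Rightarrow> int_mpoly" where
  "e_gen r = (if r = 0 then 1 else - (\<Sum>i\<in>{..<r}. e_gen i * h_gen (r - i)))"
  by auto
termination by (relation "measure id") auto
declare e_gen.simps [simp del]

lemma e_gen_0: "e_gen 0 = 1" by (subst e_gen.simps) simp

lemma e_gen_h_gen: "(\<Sum>i\<le>r. e_gen i * h_gen (r - i)) = (if r = 0 then 1 else 0)"
proof (cases "r = 0")
  case False
  have "(\<Sum>i\<le>r. e_gen i * h_gen (r - i)) = (\<Sum>i<r. e_gen i * h_gen (r - i)) + e_gen r * h_gen 0"
    by (simp add: lessThan_Suc_atMost[symmetric])
  also have "e_gen r = - (\<Sum>i<r. e_gen i * h_gen (r - i))" using False by (subst e_gen.simps) simp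
  finally show ?thesis using False by (simp add: h_gen_def)
qed (simp add: e_gen_0 h_gen_def)

context affine
begin

type_synonym fn = "(int \<Rightarrow> int) \<Rightarrow> int"

definition linear_op :: "(fn \<Rightarrow> fn) \<Rightarrow> bool" where
  "linear_op M \<longleftrightarrow> (\<forall>F G. M (\<lambda>w. F w + G w) = (\<lambda>w. M F w + M G w)) \<and> (\<forall>c F. M (\<lambda>w. c * F w) = (\<lambda>w. c * M F w))"

lemma linear_op_sum: assumes "linear_op M" shows "M (\<lambda>w. \<Sum>i\<in>A. G i w) = (\<lambda>w. \<Sum>i\<in>A. M (G i) w)"
proof -
  have 0: "M (\<lambda>w. 0) = (\<lambda>w. 0)"
  proof -
    have "M (\<lambda>w. 0 * 0) = (\<lambda>w. 0 * M (\<lambda>w. 0) w)"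
      by (rule conjunct2[OF assms[unfolded linear_op_def], rule_format])
    then show ?thesis by (simp only: mult_zero_left)
  qed
  have add: "M (\<lambda>w. F w + G w) = (\<lambda>w. M F w + M G w)" for F G
    by (rule conjunct1[OF assms[unfolded linear_op_def], rule_format])
  show ?thesis
  proof (induction A rule: infinite_finite_induct)
    case (insert i A)
    have "M (\<lambda>w. \<Sum>i\<in>insert i A. G i w) = M (\<lambda>w. G i w + (\<Sum>i\<in>A. G i w))"
      by (simp only: sum.insert[OF insert.hyps])
    also have "\<dots> = (\<lambda>w. M (G i) w + M (\<lambda>w. \<Sum>i\<in>A. G i w) w)" by (rule add)
    finally show ?case unfolding insert.IH by (simp only: sum.insert[OF insert.hyps])
  qed (simp_all only: sum.infinite sum.empty 0 not_False_eq_True)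
qed

lemma linear_op_scale: "linear_op M \<Longrightarrow> M (\<lambda>w. c * F w) = (\<lambda>w. c * M F w)"
  by (simp add: linear_op_def)

lemma linear_op_U: "linear_op (U r)"
  unfolding linear_op_def U_def left_op_add left_op_scale by (simp add: sum.distrib sum_distrib_left)

lemma linear_op_comp: "linear_op M \<Longrightarrow> linear_op M' \<Longrightarrow> linear_op (\<lambda>F. M (M' F))"
  unfolding linear_op_def by simp

lemma linear_op_id: "linear_op (\<lambda>F. F)" unfolding linear_op_def by simp

definition supported :: "fn \<Rightarrow> bool" where "supported F \<longleftrightarrow> (\<forall>w. w \<notin> P \<longrightarrow> F w = 0)"

lemma supported_U: "supported (U r F)" by (simp add: supported_def U_def left_op_def)

lemma supports_0: "supports 0 = {{0..<N}}"
proof -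
  have "T = {0..<N}" if T: "is_support T" "n - card T = 0" for T
  proof (rule card_subset_eq)
    show "T \<subseteq> {0..<N}" using T by (simp add: is_support_def)
    show "card T = card {0..<N}" using card_is_support(2)[OF T(1)] T(2) by simp
  qed simp
  moreover have "is_support {0..<N}" using N_pos by (simp add: is_support_def)
  moreover have "n - card {0..<N} = 0" by simp
  ultimately show ?thesis unfolding supports_def by blast
qed

lemma U_0: assumes "supported F" shows "U 0 F = F"
proof
  fix w
  show "U 0 F w = F w" unfolding U_def supports_0 using assms
    by (simp add: cyc_full left_op_def supported_def del: id_apply)
qed

lemma V_0: assumes "supported F" shows "V 0 F = F"
proof
  fix w
  show "V 0 F w = F w" unfolding V_def supports_0 using assms
    by (simp add: cyc_full left_op_def supported_def del: id_apply)
qed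

fun mono_act_on :: "nat list \<Rightarrow> (nat \<Rightarrow>\<^sub>0 nat) \<Rightarrow> fn \<Rightarrow> fn" where
  "mono_act_on [] \<alpha> F = F"
| "mono_act_on (r # rs) \<alpha> F = (U r ^^ lkp \<alpha> r) (mono_act_on rs \<alpha> F)"

abbreviation mono_act :: "(nat \<Rightarrow>\<^sub>0 nat) \<Rightarrow> fn \<Rightarrow> fn" where "mono_act \<equiv> mono_act_on [1..<n]"

lemma linear_op_pow: "linear_op M \<Longrightarrow> linear_op (M ^^ m)"
proof (induction m)
  case (Suc m)
  then show ?case using linear_op_comp[of M "M ^^ m"] by (simp add: comp_def)
qed (simp add: linear_op_id id_def)

lemma linear_op_mono_act_on: "linear_op (mono_act_on rs \<alpha>)"
proof (induction rs)
  case Nil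
  have "mono_act_on [] \<alpha> = (\<lambda>F. F)" by (simp add: fun_eq_iff)
  then show ?case using linear_op_id by simp
next
  case (Cons r rs)
  have "mono_act_on (r # rs) \<alpha> = (\<lambda>F. (U r ^^ lkp \<alpha> r) (mono_act_on rs \<alpha> F))" by (simp add: fun_eq_iff)
  then show ?case using linear_op_comp[OF linear_op_pow[OF linear_op_U] Cons] by simp
qed

lemma U_pow_comm: "U a ((U b ^^ m) F) = (U b ^^ m) (U a F)"
  by (induction m arbitrary: F) (simp_all add: U_comm[of a b])

lemma U_mono_act_on_comm: "U a (mono_act_on rs \<alpha> F) = mono_act_on rs \<alpha> (U a F)"
  by (induction rs) (simp_all add: U_pow_comm)

lemma U_pow_mono_act_on_comm: "(U a ^^ m) (mono_act_on rs \<alpha> F) = mono_act_on rs \<alpha> ((U a ^^ m) F)"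
  by (induction m) (simp_all add: U_mono_act_on_comm)

lemma mono_act_on_add: "mono_act_on rs (\<alpha> + \<beta>) F = mono_act_on rs \<alpha> (mono_act_on rs \<beta> F)"
proof (induction rs)
  case (Cons r rs)
  have "(U r ^^ (lkp \<alpha> r + lkp \<beta> r)) (mono_act_on rs \<alpha> (mono_act_on rs \<beta> F)) = (U r ^^ lkp \<alpha> r) ((U r ^^ lkp \<beta> r) (mono_act_on rs \<alpha> (mono_act_on rs \<beta> F)))"
    by (simp add: funpow_add)
  also have "\<dots> = (U r ^^ lkp \<alpha> r) (mono_act_on rs \<alpha> ((U r ^^ lkp \<beta> r) (mono_act_on rs \<beta> F)))"
    by (rule arg_cong[OF U_pow_mono_act_on_comm])
  finally show ?case by (simp only: mono_act_on.simps lookup_add Cons.IH)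
qed simp

definition act :: "int_mpoly \<Rightarrow> fn \<Rightarrow> fn" where
  "act p F w = (\<Sum>\<alpha>\<in>Poly_Mapping.keys p. lkp p \<alpha> * mono_act \<alpha> F w)"

lemma act_superset:
  assumes "finite A" "Poly_Mapping.keys p \<subseteq> A" shows "act p F w = (\<Sum>\<alpha>\<in>A. lkp p \<alpha> * mono_act \<alpha> F w)"
  unfolding act_def using assms by (intro sum.mono_neutral_left) (auto simp: in_keys_iff)

lemma act_add: "act (p + q) F w = act p F w + act q F w"
proof -
  let ?A = "Poly_Mapping.keys p \<union> Poly_Mapping.keys q"
  have "Poly_Mapping.keys (p + q) \<subseteq> ?A" by (rule Poly_Mapping.keys_add)
  then show ?thesis using act_superset[of ?A p F w] act_superset[of ?A q F w] act_superset[of ?A "p + q" F w]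
    by (simp add: lookup_add distrib_right sum.distrib)
qed

lemma act_0: "act 0 F w = 0" by (simp add: act_def)

lemma act_sum: "act (\<Sum>i\<in>A. p i) F w = (\<Sum>i\<in>A. act (p i) F w)"
  by (induction A rule: infinite_finite_induct) (simp_all add: act_0 act_add)

lemma act_single: "act (Poly_Mapping.single \<alpha> c) F w = c * mono_act \<alpha> F w"
proof (cases "c = 0")
  case False
  then show ?thesis by (simp add: act_def)
qed (simp add: act_0)

lemma act_mult: "act (p * q) F w = act p (act q F) w"
proof -
  let ?p = "Poly_Mapping.keys p" and ?q = "Poly_Mapping.keys q"
  have "p * q = (\<Sum>\<alpha>\<in>?p. \<Sum>\<beta>\<in>?q. Poly_Mapping.single (\<alpha> + \<beta>) (lkp p \<alpha> * lkp q \<beta>))"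
    by (subst (1) poly_mapping_sum_single[of p], subst (1) poly_mapping_sum_single[of q])
       (simp only: sum_product mult_single)
  then have "act (p * q) F w = (\<Sum>\<alpha>\<in>?p. \<Sum>\<beta>\<in>?q. lkp p \<alpha> * lkp q \<beta> * mono_act \<alpha> (mono_act \<beta> F) w)"
    by (simp only: act_sum act_single mono_act_on_add)
  also have "\<dots> = (\<Sum>\<alpha>\<in>?p. lkp p \<alpha> * mono_act \<alpha> (\<lambda>w. \<Sum>\<beta>\<in>?q. lkp q \<beta> * mono_act \<beta> F w) w)"
    by (simp only: linear_op_sum[OF linear_op_mono_act_on] linear_op_scale[OF linear_op_mono_act_on] sum_distrib_left mult.assoc)
  also have "\<dots> = act p (act q F) w" unfolding act_def ..
  finally show ?thesis .
qed

lemma mono_act_on_single_notin: "r \<notin> set rs \<Longrightarrow> mono_act_on rs (Poly_Mapping.single r m) F = F"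
  by (induction rs) (simp_all add: lookup_single_not_eq)

lemma mono_act_on_single: "distinct rs \<Longrightarrow> r \<in> set rs \<Longrightarrow> mono_act_on rs (Poly_Mapping.single r 1) F = U r F"
proof (induction rs)
  case (Cons a rs)
  show ?case
  proof (cases "a = r")
    case True
    then show ?thesis using Cons.prems mono_act_on_single_notin[of r rs 1 F] by simp
  next
    case False
    then show ?thesis using Cons by (simp add: lookup_single_not_eq)
  qed
qed simp

lemma mono_act_on_0: "mono_act_on rs 0 F = F" by (induction rs) simp_all

lemma act_1: "act 1 F = F"
proof
  fix w show "act 1 F w = F w" using act_single[of 0 1 F w] by (simp add: mono_act_on_0)
qed

lemma act_h_gen: assumes "r < n" "supported F" shows "act (h_gen r) F = U r F"
proof (cases "r = 0")
  case True
  then show ?thesis using U_0[OF assms(2)] act_1 by (simp add: h_gen_def)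
next
  case False
  then have "mono_act (Poly_Mapping.single r 1) F = U r F" using assms by (intro mono_act_on_single) auto
  then show ?thesis using False act_single[of "Poly_Mapping.single r 1" 1 F] by (auto simp: h_gen_def var_def)
qed

lemma supported_mono_act_on: "supported F \<Longrightarrow> supported (mono_act_on rs \<alpha> F)"
proof (induction rs)
  case (Cons r rs)
  then show ?case by (cases "lkp \<alpha> r") (simp_all add: supported_U)
qed simp

lemma supported_act: "supported F \<Longrightarrow> supported (act p F)"
  using supported_mono_act_on unfolding supported_def act_def by simp

lemma act_uminus: "act (- p) F w = - act p F w"
  using act_add[of p "- p" F w] act_0[of F w] by simp

lemma act_e_gen: assumes "r < n" "supported F" shows "act (e_gen r) F w = (- 1) ^ r * V r F w"
  using assms
proof (induction r arbitrary: F w rule: less_induct)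
  case (less r)
  show ?case
  proof (cases "r = 0")
    case True
    then show ?thesis using V_0[OF less.prems(2)] act_1 by (simp add: e_gen_0)
  next
    case False
    have "e_gen r = - (\<Sum>i<r. e_gen i * h_gen (r - i))" using False by (subst e_gen.simps) simp
    then have "act (e_gen r) F w = - (\<Sum>i<r. act (e_gen i) (act (h_gen (r - i)) F) w)"
      by (simp only: act_uminus act_sum act_mult)
    also have "(\<Sum>i<r. act (e_gen i) (act (h_gen (r - i)) F) w) = (\<Sum>i<r. (- 1) ^ i * V i (U (r - i) F) w)"
    proof (intro sum.cong refl)
      fix i assume i: "i \<in> {..<r}"
      have "act (h_gen (r - i)) F = U (r - i) F" using less.prems i by (intro act_h_gen) auto
      then show "act (e_gen i) (act (h_gen (r - i)) F) w = (- 1) ^ i * V i (U (r - i) F) w"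
        using less.IH[of i "U (r - i) F" w] i less.prems(1) supported_U by simp
    qed
    also have "- (\<Sum>i<r. (- 1) ^ i * V i (U (r - i) F) w) = (- 1) ^ r * V r (U 0 F) w"
    proof -
      have "(\<Sum>i\<le>r. (- 1) ^ i * V i (U (r - i) F) w)
        = (\<Sum>i<r. (- 1) ^ i * V i (U (r - i) F) w) + (- 1) ^ r * V r (U 0 F) w"
        by (simp add: lessThan_Suc_atMost[symmetric])
      then show ?thesis using V_U_relation[of r F w] False less.prems(1) by simp
    qed
    finally show ?thesis using U_0[OF less.prems(2)] by simp
  qed
qed

subsection \<open>Counting factorizations\<close>

definition delta_id :: fn where "delta_id w = (if w = id then 1 else 0)"

lemma supported_delta: "supported delta_id" using P_id by (auto simp: supported_def delta_id_def)

fun num_fact :: "nat list \<Rightarrow> fn" where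
  "num_fact [] = delta_id"
| "num_fact (a # as) = U a (num_fact as)"

lemma supported_num_fact: "supported (num_fact as)"
  by (cases as) (simp_all add: supported_U supported_delta)

lemma act_num_fact: "(\<forall>a\<in>set as. a < n) \<Longrightarrow> act (prod_list (map h_gen as)) delta_id = num_fact as"
proof (induction as)
  case (Cons a as)
  have "act (prod_list (map h_gen (a # as))) delta_id = act (h_gen a) (act (prod_list (map h_gen as)) delta_id)"
    by (simp add: fun_eq_iff act_mult)
  then show ?case using Cons act_h_gen[of a "num_fact as"] supported_num_fact by simp
qed (simp add: act_1)

lemma U_zero: "U a (\<lambda>w. 0) = (\<lambda>w. 0)"
  by (rule ext) (simp add: U_def left_op_zero)

lemma num_fact_large: "a \<in> set as \<Longrightarrow> n \<le> a \<Longrightarrow> num_fact as = (\<lambda>w. 0)"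
proof (induction as)
  case (Cons b as)
  show ?case
  proof (cases "a = b")
    case True
    then have "supports b = {}" using supports_D(5)[of _ b] Cons.prems by force
    then show ?thesis by (simp add: U_def fun_eq_iff)
  next
    case False
    then show ?thesis using Cons U_zero by simp
  qed
qed simp

definition fact_lists :: "nat list \<Rightarrow> (int \<Rightarrow> int) \<Rightarrow> (int \<Rightarrow> int) list set" where
  "fact_lists as w = {cs. list_all2 (\<lambda>c a. c \<in> cyc ` supports a) cs as \<and> comp_list cs = w \<and> sum_list as = len w}"

lemma comp_list_fact_lists: "list_all2 (\<lambda>c a. c \<in> cyc ` supports a) cs as \<Longrightarrow> comp_list cs \<in> P \<and> len (comp_list cs) \<le> sum_list as"
proof (induction rule: list_all2_induct)
  case Nil
  show ?case using P_id len_id by (simp only: comp_list_simps(1) simp_thms order_refl sum_list.Nil)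
next
  case (Cons c cs a as)
  then obtain T where T: "T \<in> supports a" "c = cyc T" by blast
  have "len (c \<circ> comp_list cs) \<le> len c + len (comp_list cs)"
    using len_mult_le[of c "comp_list cs"] supports_D(2)[OF T(1)] T(2) Cons.IH by blast
  also have "\<dots> \<le> sum_list (a # as)" using supports_D(3)[OF T(1)] T(2) Cons.IH by simp
  finally show ?case unfolding comp_list_simps(2)
    using P_comp[of c "comp_list cs"] supports_D(2)[OF T(1)] T(2) Cons.IH by blast
qed

lemma fact_lists_Cons:
  assumes w: "w \<in> P"
  shows "fact_lists (a # as) w = (\<Union>T\<in>{T\<in>supports a. len w = len (cyc T) + len (iv (cyc T) \<circ> w)}. (#) (cyc T) ` fact_lists as (iv (cyc T) \<circ> w))"
proof (intro subset_antisym subsetI)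
  fix x assume x: "x \<in> fact_lists (a # as) w"
  then obtain c cs where cs: "x = c # cs" "c \<in> cyc ` supports a" "list_all2 (\<lambda>c a. c \<in> cyc ` supports a) cs as"
    "c \<circ> comp_list cs = w" "a + sum_list as = len w"
    unfolding fact_lists_def by (auto simp: list_all2_Cons2 simp del: comp_apply)
  then obtain T where T: "T \<in> supports a" "c = cyc T" by blast
  have cP: "c \<in> P" "len c = a" using supports_D[OF T(1)] T(2) by auto
  have y: "comp_list cs = iv (cyc T) \<circ> w"
    unfolding cs(4)[symmetric] T(2)[symmetric] o_assoc inv_P_comp(1)[OF cP(1)] by (rule id_comp[symmetric])
  have "len w \<le> a + len (comp_list cs)" "len (comp_list cs) \<le> sum_list as"
    using len_mult_le[OF cP(1), of "comp_list cs"] comp_list_fact_lists[OF cs(3)] cs(4) cP(2) by auto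
  then have l: "len (comp_list cs) = sum_list as" "len w = a + len (comp_list cs)" using cs(5) by auto
  have "cs \<in> fact_lists as (iv (cyc T) \<circ> w)" unfolding fact_lists_def using cs(3) y l(1) by simp
  moreover have "T \<in> {T\<in>supports a. len w = len (cyc T) + len (iv (cyc T) \<circ> w)}" using T l(2) cP(2) y by simp
  ultimately show "x \<in> (\<Union>T\<in>{T\<in>supports a. len w = len (cyc T) + len (iv (cyc T) \<circ> w)}. (#) (cyc T) ` fact_lists as (iv (cyc T) \<circ> w))"
    using cs(1) T(2) by blast
next
  fix x assume "x \<in> (\<Union>T\<in>{T\<in>supports a. len w = len (cyc T) + len (iv (cyc T) \<circ> w)}. (#) (cyc T) ` fact_lists as (iv (cyc T) \<circ> w))"
  then obtain T cs where T: "T \<in> supports a" "len w = len (cyc T) + len (iv (cyc T) \<circ> w)" "x = cyc T # cs" "cs \<in> fact_lists as (iv (cyc T) \<circ> w)"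
    by blast
  have "cyc T \<circ> (iv (cyc T) \<circ> w) = w" unfolding o_assoc inv_P_comp(2)[OF supports_D(2)[OF T(1)]] by (rule id_comp)
  then show "x \<in> fact_lists (a # as) w" using T supports_D(3)[OF T(1)] unfolding fact_lists_def by (simp del: comp_apply)
qed

lemma card_fact_lists: "w \<in> P \<Longrightarrow> finite (fact_lists as w) \<and> int (card (fact_lists as w)) = num_fact as w"
proof (induction as arbitrary: w)
  case Nil
  have "fact_lists [] w = (if w = id then {[]} else {})"
    unfolding fact_lists_def by (auto simp: comp_list_simps(1) simp del: id_apply)
  then show ?case by (simp add: delta_id_def)
next
  case (Cons a as)
  let ?I = "{T\<in>supports a. len w = len (cyc T) + len (iv (cyc T) \<circ> w)}"
  let ?X = "\<lambda>T. (#) (cyc T) ` fact_lists as (iv (cyc T) \<circ> w)"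
  have fI: "finite ?I" using finite_supports by (rule rev_finite_subset) auto
  have yP: "iv (cyc T) \<circ> w \<in> P" if "T \<in> supports a" for T using P_comp[OF P_inv[OF supports_D(2)[OF that]] Cons.prems] .
  have fX: "finite (?X T)" if "T \<in> ?I" for T using Cons.IH[OF yP] that by blast
  have "card (\<Union> (?X ` ?I)) = (\<Sum>T\<in>?I. card (?X T))"
  proof (rule card_UN_disjoint[OF fI])
    show "\<forall>T\<in>?I. finite (?X T)" using fX by blast
    show "\<forall>T\<in>?I. \<forall>T'\<in>?I. T \<noteq> T' \<longrightarrow> ?X T \<inter> ?X T' = {}"
    proof (intro ballI impI)
      fix T T' assume "T \<in> ?I" "T' \<in> ?I" "T \<noteq> T'"
      then have "cyc T \<noteq> cyc T'" using cyc_inj supports_D(1) by blast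
      then show "?X T \<inter> ?X T' = {}" by auto
    qed
  qed
  also have "\<dots> = (\<Sum>T\<in>?I. card (fact_lists as (iv (cyc T) \<circ> w)))"
    by (intro sum.cong refl card_image) simp
  finally have "int (card (fact_lists (a # as) w)) = (\<Sum>T\<in>?I. int (card (fact_lists as (iv (cyc T) \<circ> w))))"
    unfolding fact_lists_Cons[OF Cons.prems] by simp
  also have "\<dots> = (\<Sum>T\<in>?I. num_fact as (iv (cyc T) \<circ> w))"
    using Cons.IH[OF yP] by (intro sum.cong refl) blast
  also have "\<dots> = (\<Sum>T\<in>supports a. if len w = len (cyc T) + len (iv (cyc T) \<circ> w) then num_fact as (iv (cyc T) \<circ> w) else 0)"
    by (rule sum.inter_filter[OF finite_supports])
  also have "\<dots> = num_fact (a # as) w" unfolding num_fact.simps U_def left_op_def using Cons.prems by simp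
  finally have "int (card (fact_lists (a # as) w)) = num_fact (a # as) w" .
  moreover have "finite (fact_lists (a # as) w)" unfolding fact_lists_Cons[OF Cons.prems] using fI fX by blast
  ultimately show ?case by blast
qed

lemma comp_list_append: "comp_list (xs @ ys) = comp_list xs \<circ> comp_list ys"
  by (induction xs) (simp_all add: comp_list_def o_assoc)

lemma comp_list_ids: "(\<And>c. c \<in> set cs \<Longrightarrow> c = id) \<Longrightarrow> comp_list cs = id"
  by (induction cs) (simp_all add: comp_list_def)

lemma affine_stanley_num_fact:
  assumes f: "f \<in> P" and k: "Poly_Mapping.keys \<alpha> \<subseteq> {..<k}"
  shows "affine_stanley n f \<alpha> = num_fact (map (lkp \<alpha>) [0..<k]) (tau_pow (- av n f) \<circ> f)"
proof -
  define g where "g = tau_pow (- av n f) \<circ> f"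
  have g: "g \<in> P" "len g = len f" unfolding g_def using P_comp[OF P_tau f] by simp_all
  let ?as = "map (lkp \<alpha>) [0..<k]"
  let ?C = "{c. affine_factorization n f c \<and> (\<forall>i. len (c i) = lkp \<alpha> i)}"
  have \<alpha>0: "lkp \<alpha> i = 0" if "i \<ge> k" for i using k that by (force simp: in_keys_iff subset_iff)
  have cd: "cyc_decreasing n c \<and> len c = a \<longleftrightarrow> c \<in> cyc ` supports a" for c a
  proof
    assume c: "cyc_decreasing n c \<and> len c = a"
    then obtain T where "is_support T" "c = cyc T" unfolding cyc_decreasing_iff by blast
    then show "c \<in> cyc ` supports a" using c len_cyc[of T] by (simp add: supports_def)
  next
    assume "c \<in> cyc ` supports a"
    then obtain T where "T \<in> supports a" "c = cyc T" by blast
    then show "cyc_decreasing n c \<and> len c = a" using supports_D(1,3)[of T a] unfolding cyc_decreasing_iff by blast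
  qed
  have cd0: "c = id" if "cyc_decreasing n c" "len c = 0" for c
    using cd[of c 0] that supports_0 cyc_full by simp
  have cdid: "cyc_decreasing n id" unfolding cyc_decreasing_iff using cyc_full N_pos by (intro exI[of _ "{0..<N}"]) (simp add: is_support_def)
  have bij: "bij_betw (\<lambda>c. map c [0..<k]) ?C (fact_lists ?as g)"
  proof (rule bij_betw_byWitness[where f'="\<lambda>cs i. if i < k then cs ! i else id"])
    show "\<forall>c\<in>?C. (\<lambda>i. if i < k then map c [0..<k] ! i else id) = c"
    proof
      fix c assume "c \<in> ?C"
      then have "c i = id" if "i \<ge> k" for i
        using cd0[of "c i"] \<alpha>0[OF that] unfolding affine_factorization_def by simp
      then show "(\<lambda>i. if i < k then map c [0..<k] ! i else id) = c" by (auto simp: fun_eq_iff)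
    qed
    show "\<forall>cs\<in>fact_lists ?as g. map (\<lambda>i. if i < k then cs ! i else id) [0..<k] = cs"
    proof
      fix cs assume "cs \<in> fact_lists ?as g"
      then have "length cs = k" unfolding fact_lists_def by (auto dest: list_all2_lengthD)
      then show "map (\<lambda>i. if i < k then cs ! i else id) [0..<k] = cs" by (intro nth_equalityI) auto
    qed
    show "(\<lambda>c. map c [0..<k]) ` ?C \<subseteq> fact_lists ?as g"
    proof
      fix cs assume "cs \<in> (\<lambda>c. map c [0..<k]) ` ?C"
      then obtain c where c: "cs = map c [0..<k]" "affine_factorization n f c" "\<And>i. len (c i) = lkp \<alpha> i" by blast
      from c(2) obtain m where m: "\<And>i. i \<ge> m \<Longrightarrow> c i = id" "comp_list (map c [0..<m]) = g"
        "(\<Sum>i<m. len (c i)) = len f" and cdc: "\<And>i. cyc_decreasing n (c i)"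
        unfolding affine_factorization_def g_def by blast
      have ck: "c i = id" if "i \<ge> k" for i using cd0[OF cdc] c(3) \<alpha>0[OF that] by simp
      have lid: "len id = 0" by (rule len_id)
      let ?M = "max m k"
      have e: "comp_list (map c [0..<?M]) = comp_list (map c [0..<l])" if "l \<le> ?M" "\<And>i. i \<ge> l \<Longrightarrow> c i = id" for l
      proof -
        have "[0..<?M] = [0..<l] @ [l..<?M]" using that(1) by (metis upt_add_eq_append zero_le le_add_diff_inverse)
        moreover have "comp_list (map c [l..<?M]) = id" by (rule comp_list_ids) (use that(2) in auto)
        ultimately show ?thesis by (simp only: map_append comp_list_append comp_id)
      qed
      have "comp_list (map c [0..<k]) = g" using e[of k] e[of m] ck m(1,2) by simp
      moreover have "sum_list ?as = len g"
      proof -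
        have "(\<Sum>i<?M. len (c i)) = (\<Sum>i<l. len (c i))" if "l \<le> ?M" "\<And>i. i \<ge> l \<Longrightarrow> c i = id" for l
          using that lid by (intro sum.mono_neutral_right) (auto simp del: id_apply)
        from this[of k] this[of m] have "(\<Sum>i<k. len (c i)) = len f" using ck m(1,3) by simp
        then show ?thesis using c(3) g(2) by (simp add: interv_sum_list_conv_sum_set_nat atLeast0LessThan)
      qed
      moreover have "list_all2 (\<lambda>c a. c \<in> cyc ` supports a) (map c [0..<k]) ?as"
        using cd[THEN iffD1, OF conjI, OF cdc c(3)] by (simp add: list_all2_conv_all_nth)
      ultimately show "cs \<in> fact_lists ?as g" unfolding fact_lists_def c(1) by blast
    qed
    show "(\<lambda>cs i. if i < k then cs ! i else id) ` fact_lists ?as g \<subseteq> ?C"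
    proof
      fix c assume "c \<in> (\<lambda>cs i. if i < k then cs ! i else id) ` fact_lists ?as g"
      then obtain cs where c: "c = (\<lambda>i. if i < k then cs ! i else id)" and cs: "cs \<in> fact_lists ?as g" by blast
      have l: "length cs = k" using cs unfolding fact_lists_def by (auto dest: list_all2_lengthD)
      have nth: "cs ! i \<in> cyc ` supports (lkp \<alpha> i)" if "i < k" for i
        using cs that l unfolding fact_lists_def by (auto simp: list_all2_conv_all_nth)
      have mc: "map c [0..<k] = cs" using l by (intro nth_equalityI) (auto simp: c)
      have ci: "len (c i) = lkp \<alpha> i \<and> cyc_decreasing n (c i)" for i
      proof (cases "i < k")
        case True
        then show ?thesis using cd[THEN iffD2, OF nth[OF True]] by (simp add: c)
      next
        case False
        have "c i = id" using False by (simp only: c if_False)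
        then show ?thesis using cdid \<alpha>0[of i] False len_id by (simp only: not_less simp_thms)
      qed
      then have len: "len (c i) = lkp \<alpha> i" and "cyc_decreasing n (c i)" for i by blast+
      have "comp_list (map c [0..<k]) = tau_pow (- av n f) \<circ> f" using cs unfolding mc fact_lists_def g_def by blast
      moreover have "(\<Sum>i<k. len (c i)) = len f"
        using cs g(2) unfolding fact_lists_def len by (simp add: interv_sum_list_conv_sum_set_nat atLeast0LessThan)
      moreover have "\<forall>i\<ge>k. c i = id" by (simp add: c del: id_apply)
      ultimately show "c \<in> ?C" unfolding affine_factorization_def using ci by blast
    qed
  qed
  have "card ?C = card (fact_lists ?as g)" using bij by (rule bij_betw_same_card)
  then show ?thesis unfolding affine_stanley_def using card_fact_lists[OF g(1), of ?as] g_def by simp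
qed

section \<open>Symmetry and vanishing\<close>

lemma lookup_stanley_poly:
  assumes "f \<in> P"
  shows "lkp (affine_stanley_poly n k f) \<alpha> =
    (if Poly_Mapping.keys \<alpha> \<subseteq> {..<k} then num_fact (map (lkp \<alpha>) [0..<k]) (tau_pow (- av n f) \<circ> f) else 0)"
  unfolding lookup_affine_stanley_poly using affine_stanley_num_fact[OF assms, of \<alpha> k] by (simp add: when_def)

lemma keys_map_key_iff:
  assumes \<pi>: "\<pi> permutes {..<k}"
  shows "Poly_Mapping.keys (Poly_Mapping.map_key \<pi> (\<alpha> :: nat \<Rightarrow>\<^sub>0 nat)) \<subseteq> {..<k} \<longleftrightarrow> Poly_Mapping.keys \<alpha> \<subseteq> {..<k}"
proof -
  have *: "Poly_Mapping.keys \<beta> \<subseteq> {..<k} \<longleftrightarrow> (\<forall>i\<ge>k. lkp \<beta> i = 0)" for \<beta> :: "nat \<Rightarrow>\<^sub>0 nat"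
    unfolding subset_iff in_keys_iff lessThan_iff by (meson not_le)
  have "\<pi> i = i" if "i \<ge> k" for i using permutes_not_in[OF \<pi>, of i] that by simp
  then show ?thesis unfolding * lookup_map_key[OF \<pi>] by metis
qed

lemma num_fact_perm:
  assumes \<pi>: "\<pi> permutes {..<k}"
  shows "num_fact (map (\<lambda>i. a (\<pi> i)) [0..<k]) = num_fact (map a [0..<k])"
proof -
  have img: "set (map (\<lambda>i. a (\<pi> i)) [0..<k]) = set (map a [0..<k])"
  proof -
    have "set (map (\<lambda>i. a (\<pi> i)) [0..<k]) = a ` (\<pi> ` {..<k})" by (simp add: image_image atLeast0LessThan)
    then show ?thesis unfolding permutes_image[OF \<pi>] by (simp add: atLeast0LessThan)
  qed
  show ?thesis
  proof (cases "\<forall>x\<in>set (map a [0..<k]). x < n")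
    case True
    have "prod_list (map h_gen (map b [0..<k])) = (\<Prod>i<k. h_gen (b i))" for b
      by (simp add: prod.list_conv_set_nth atLeast0LessThan)
    then have pl: "prod_list (map h_gen (map b [0..<k])) = (\<Prod>i<k. h_gen (b i))" for b .
    have "(\<Prod>i<k. h_gen (a (\<pi> i))) = (\<Prod>i<k. h_gen (a i))"
      using prod.permute[OF \<pi>, of "\<lambda>i. h_gen (a i)"] by (simp add: comp_def)
    then have "prod_list (map h_gen (map (\<lambda>i. a (\<pi> i)) [0..<k])) = prod_list (map h_gen (map a [0..<k]))"
      unfolding pl .
    then show ?thesis using act_num_fact[OF True] act_num_fact[of "map (\<lambda>i. a (\<pi> i)) [0..<k]"] True unfolding img by metis
  next
    case False
    then obtain x where x: "x \<in> set (map a [0..<k])" "n \<le> x" by (meson not_le)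
    show ?thesis using num_fact_large[OF x] num_fact_large[of x "map (\<lambda>i. a (\<pi> i)) [0..<k]"] x unfolding img by simp
  qed
qed

lemma stanley_poly_sym:
  assumes f: "f \<in> P" shows "affine_stanley_poly n k f \<in> sym_polys k"
  unfolding sym_polys_def
proof (clarify, intro conjI ballI allI impI)
  fix \<alpha> assume "\<alpha> \<in> Poly_Mapping.keys (affine_stanley_poly n k f)"
  then show "Poly_Mapping.keys \<alpha> \<subseteq> {..<k}" by (simp add: in_keys_iff lookup_stanley_poly[OF f] split: if_splits)
next
  fix \<pi> and \<alpha> :: "nat \<Rightarrow>\<^sub>0 nat" assume \<pi>: "\<pi> permutes {..<k}"
  have m: "map (lkp (Poly_Mapping.map_key \<pi> \<alpha>)) [0..<k] = map (\<lambda>i. lkp \<alpha> (\<pi> i)) [0..<k]"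
    by (simp add: lookup_map_key[OF \<pi>])
  show "lkp (affine_stanley_poly n k f) (Poly_Mapping.map_key \<pi> \<alpha>) = lkp (affine_stanley_poly n k f) \<alpha>"
    unfolding lookup_stanley_poly[OF f] keys_map_key_iff[OF \<pi>] by (simp only: m num_fact_perm[OF \<pi>, of "lkp \<alpha>"])
qed

text \<open>Expanding a Toeplitz minor in the \<open>h_gen\<close> through the inverse Toeplitz matrix, whose entries are the \<open>e_gen\<close>.\<close>

definition h_band :: "nat \<Rightarrow> nat \<Rightarrow> int_mpoly" where "h_band m j = (if j \<le> m then h_gen (m - j) else 0)"
definition e_band :: "nat \<Rightarrow> nat \<Rightarrow> int_mpoly" where "e_band m j = (if j \<le> m then e_gen (m - j) else 0)"

lemma h_band_e_band: assumes "m < n" "j < n" shows "(\<Sum>l<n. h_band m l * e_band l j) = (if m = j then 1 else 0)"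
proof (cases "j \<le> m")
  case True
  have "(\<Sum>l<n. h_band m l * e_band l j) = (\<Sum>l\<in>{j..m}. h_gen (m - l) * e_gen (l - j))"
    using assms by (intro sum.mono_neutral_cong_right) (auto simp: h_band_def e_band_def)
  also have "\<dots> = (\<Sum>i\<le>m - j. e_gen i * h_gen (m - j - i))"
    using True by (intro sum.reindex_bij_witness[of _ "\<lambda>i. i + j" "\<lambda>l. l - j"]) (auto simp: mult.commute)
  also have "\<dots> = (if m - j = 0 then 1 else 0)" by (rule e_gen_h_gen)
  finally show ?thesis using True by auto
next
  case False
  then show ?thesis by (auto simp: h_band_def e_band_def intro!: sum.neutral)
qed

lemma toeplitz_minor:
  assumes k: "k \<le> n" and b: "\<And>i. i < k \<Longrightarrow> b i < n"
  shows "(\<Sum>\<sigma> | \<sigma> permutes {0..<k}. of_int (sign \<sigma>) * (\<Prod>i=0..<k. h_band (b i) (\<sigma> i)))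
    = (\<Sum>\<tau> | \<tau> permutes {0..<n}. of_int (sign \<tau>) *
        ((\<Prod>i=0..<k. if \<tau> i = b i then 1 else 0) * (\<Prod>i=k..<n. e_band i (\<tau> i))))"
proof -
  let ?M1 = "mat n n (\<lambda>(i, j). if i < k then h_band (b i) j else if i = j then 1 else 0)"
  let ?E = "mat n n (\<lambda>(i, j). e_band i j)"
  let ?M2 = "mat n n (\<lambda>(i, j). if i < k then (if j = b i then 1 else 0) else e_band i j)"
  have c: "?M1 \<in> carrier_mat n n" "?E \<in> carrier_mat n n" "?M2 \<in> carrier_mat n n" by auto
  have "?M1 * ?E = ?M2"
  proof (rule eq_matI)
    fix i j assume ij: "i < dim_row ?M2" "j < dim_col ?M2"
    have "(?M1 * ?E) $$ (i, j) = (\<Sum>l<n. (if i < k then h_band (b i) l else if i = l then 1 else 0) * e_band l j)"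
      using ij by (simp add: scalar_prod_def atLeast0LessThan)
    also have "\<dots> = (if i < k then (if j = b i then 1 else 0) else e_band i j)"
    proof (cases "i < k")
      case True
      then show ?thesis using h_band_e_band[OF b[OF True], of j] ij by auto
    next
      case False
      have "(\<Sum>l<n. (if i = l then 1 else 0) * e_band l j) = (\<Sum>l<n. if l = i then e_band i j else 0)"
        by (intro sum.cong) auto
      also have "\<dots> = e_band i j" using ij by (simp add: sum.delta)
      finally show ?thesis using False by simp
    qed
    finally show "(?M1 * ?E) $$ (i, j) = ?M2 $$ (i, j)" using ij by simp
  qed auto
  then have "det ?M1 * det ?E = det ?M2" using det_mult[OF c(1,2)] by simp
  moreover have "det ?E = 1"
  proof -
    have "det ?E = prod_list (diag_mat ?E)"
      by (rule det_lower_triangular[OF _ c(2)]) (simp add: e_band_def)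
    also have "diag_mat ?E = map (\<lambda>j. 1) [0..<n]" by (auto simp: diag_mat_def e_band_def e_gen_0)
    also have "prod_list \<dots> = (1 :: int_mpoly)" by (simp add: prod.list_conv_set_nth)
    finally show ?thesis .
  qed
  ultimately have det: "det ?M1 = det ?M2" by simp
  have split: "{0..<n} = {0..<k} \<union> {k..<n}" "{0..<k} \<inter> {k..<n} = {}" using k by auto
  have "det ?M1 = (\<Sum>\<sigma> | \<sigma> permutes {0..<n}. of_int (sign \<sigma>) * (\<Prod>i=0..<n. ?M1 $$ (i, \<sigma> i)))"
    by (rule det_def'[OF c(1)])
  also have "\<dots> = (\<Sum>\<sigma> | \<sigma> permutes {0..<k}. of_int (sign \<sigma>) * (\<Prod>i=0..<n. ?M1 $$ (i, \<sigma> i)))"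
  proof (rule sum.mono_neutral_right)
    show "{\<sigma>. \<sigma> permutes {0..<k}} \<subseteq> {\<sigma>. \<sigma> permutes {0..<n}}" using k by (auto intro: permutes_subset)
    show "\<forall>\<sigma>\<in>{\<sigma>. \<sigma> permutes {0..<n}} - {\<sigma>. \<sigma> permutes {0..<k}}. of_int (sign \<sigma>) * (\<Prod>i=0..<n. ?M1 $$ (i, \<sigma> i)) = 0"
    proof
      fix \<sigma> assume \<sigma>: "\<sigma> \<in> {\<sigma>. \<sigma> permutes {0..<n}} - {\<sigma>. \<sigma> permutes {0..<k}}"
      then have p: "\<sigma> permutes {0..<n}" by simp
      have "\<exists>i. k \<le> i \<and> i < n \<and> \<sigma> i \<noteq> i"
      proof (rule ccontr)
        assume "\<not> ?thesis"
        then have "\<sigma> permutes {0..<k}"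
          using permutes_superset[OF p, of "{0..<k}"] by auto
        then show False using \<sigma> by simp
      qed
      then obtain i where i: "k \<le> i" "i < n" "\<sigma> i \<noteq> i" by blast
      have "\<sigma> i < n" using permutes_in_image[OF p, of i] i by simp
      then have "?M1 $$ (i, \<sigma> i) = 0" using i by auto
      then have "(\<Prod>i=0..<n. ?M1 $$ (i, \<sigma> i)) = 0" using i(2) by (intro prod_zero) auto
      then show "of_int (sign \<sigma>) * (\<Prod>i=0..<n. ?M1 $$ (i, \<sigma> i)) = 0" by simp
    qed
  qed (simp add: finite_permutations)
  also have "\<dots> = (\<Sum>\<sigma> | \<sigma> permutes {0..<k}. of_int (sign \<sigma>) * (\<Prod>i=0..<k. h_band (b i) (\<sigma> i)))"
  proof (intro sum.cong refl)
    fix \<sigma> assume "\<sigma> \<in> {\<sigma>. \<sigma> permutes {0..<k}}"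
    then have p: "\<sigma> permutes {0..<k}" by simp
    have 1: "(\<Prod>i=0..<k. ?M1 $$ (i, \<sigma> i)) = (\<Prod>i=0..<k. h_band (b i) (\<sigma> i))"
    proof (rule prod.cong[OF HOL.refl])
      fix i assume i: "i \<in> {0..<k}"
      then have "\<sigma> i < k" using permutes_in_image[OF p, of i] by simp
      then show "?M1 $$ (i, \<sigma> i) = h_band (b i) (\<sigma> i)" using i k by simp
    qed
    have 2: "(\<Prod>i=k..<n. ?M1 $$ (i, \<sigma> i)) = 1"
    proof (rule prod.neutral, rule ballI)
      fix i assume i: "i \<in> {k..<n}"
      then have "\<sigma> i = i" using permutes_not_in[OF p, of i] by simp
      then show "?M1 $$ (i, \<sigma> i) = 1" using i by simp
    qed
    have "(\<Prod>i=0..<n. ?M1 $$ (i, \<sigma> i)) = (\<Prod>i=0..<k. h_band (b i) (\<sigma> i))"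
      unfolding split(1) using prod.union_disjoint[OF _ _ split(2), of "\<lambda>i. ?M1 $$ (i, \<sigma> i)"] 1 2 by simp
    then show "of_int (sign \<sigma>) * (\<Prod>i=0..<n. ?M1 $$ (i, \<sigma> i)) = of_int (sign \<sigma>) * (\<Prod>i=0..<k. h_band (b i) (\<sigma> i))" by simp
  qed
  finally have L: "det ?M1 = (\<Sum>\<sigma> | \<sigma> permutes {0..<k}. of_int (sign \<sigma>) * (\<Prod>i=0..<k. h_band (b i) (\<sigma> i)))" .
  have "det ?M2 = (\<Sum>\<tau> | \<tau> permutes {0..<n}. of_int (sign \<tau>) * (\<Prod>i=0..<n. ?M2 $$ (i, \<tau> i)))"
    by (rule det_def'[OF c(3)])
  also have "\<dots> = (\<Sum>\<tau> | \<tau> permutes {0..<n}. of_int (sign \<tau>) *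
        ((\<Prod>i=0..<k. if \<tau> i = b i then 1 else 0) * (\<Prod>i=k..<n. e_band i (\<tau> i))))"
  proof (intro sum.cong refl)
    fix \<tau> assume "\<tau> \<in> {\<tau>. \<tau> permutes {0..<n}}"
    then have p: "\<tau> permutes {0..<n}" by simp
    have in_n: "\<tau> i < n" if "i < n" for i using permutes_in_image[OF p, of i] that by simp
    have 1: "(\<Prod>i=0..<k. ?M2 $$ (i, \<tau> i)) = (\<Prod>i=0..<k. if \<tau> i = b i then 1 else 0)"
      using k in_n by (intro prod.cong) auto
    have 2: "(\<Prod>i=k..<n. ?M2 $$ (i, \<tau> i)) = (\<Prod>i=k..<n. e_band i (\<tau> i))"
      using in_n by (intro prod.cong) auto
    have "(\<Prod>i=0..<n. ?M2 $$ (i, \<tau> i)) = (\<Prod>i=0..<k. if \<tau> i = b i then 1 else 0) * (\<Prod>i=k..<n. e_band i (\<tau> i))"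
      unfolding split(1) using prod.union_disjoint[OF _ _ split(2), of "\<lambda>i. ?M2 $$ (i, \<tau> i)"] 1 2 by simp
    then show "of_int (sign \<tau>) * (\<Prod>i=0..<n. ?M2 $$ (i, \<tau> i)) = of_int (sign \<tau>) *
        ((\<Prod>i=0..<k. if \<tau> i = b i then 1 else 0) * (\<Prod>i=k..<n. e_band i (\<tau> i)))" by simp
  qed
  finally show ?thesis using det L by simp
qed

lemma act_of_int: "act (of_int c * p) F w = c * act p F w"
proof -
  have "Poly_Mapping.single 0 (of_int c :: int) = (of_int c :: int_mpoly)" by (rule single_of_int)
  then have "of_int c = Poly_Mapping.single (0 :: nat \<Rightarrow>\<^sub>0 nat) c" by simp
  then have "act (of_int c * p) F w = act (Poly_Mapping.single 0 c) (act p F) w" by (simp only: act_mult)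
  then show ?thesis by (simp add: act_single mono_act_on_0)
qed

lemma left_op_nonzero: "left_op z F w \<noteq> 0 \<Longrightarrow> w \<in> P \<and> F (iv z \<circ> w) \<noteq> 0"
  by (simp add: left_op_def split: if_splits)

lemma act_e_gen_bounded:
  assumes "finite S" "\<And>i. i \<in> S \<Longrightarrow> c i < n" "act (\<Prod>i\<in>S. e_gen (c i)) delta_id w \<noteq> 0"
  shows "w x \<le> x + int (card S)"
  using assms
proof (induction S arbitrary: w rule: finite_induct)
  case empty
  then have "w = id" by (simp add: act_1 delta_id_def split: if_splits)
  then show ?case by simp
next
  case (insert i S)
  let ?G = "act (\<Prod>i\<in>S. e_gen (c i)) delta_id"
  have "act (\<Prod>i\<in>insert i S. e_gen (c i)) delta_id w = act (e_gen (c i)) ?G w"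
    using insert.hyps by (simp add: act_mult)
  also have "\<dots> = (- 1) ^ c i * V (c i) ?G w"
    using insert.prems(1) by (intro act_e_gen supported_act supported_delta) auto
  finally have "V (c i) ?G w \<noteq> 0" using insert.prems(2) by auto
  then obtain T where T: "T \<in> supports (c i)" "left_op (iv (cyc T)) ?G w \<noteq> 0"
    unfolding V_def by (meson sum.neutral)
  have ii: "iv (iv (cyc T)) = cyc T" using inv_inv_eq[OF P_bij[OF supports_D(2)[OF T(1)]]] .
  have "?G (cyc T \<circ> w) \<noteq> 0" using left_op_nonzero[OF T(2)] unfolding ii by blast
  then have "(cyc T \<circ> w) x \<le> x + int (card S)" using insert.IH insert.prems(1) by blast
  then show ?case using cyc_ge[where T=T and x="w x"] insert.hyps by simp
qed

lemma num_fact_bounded: "num_fact as w \<noteq> 0 \<Longrightarrow> w x \<ge> x - int (length as)"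
proof (induction as arbitrary: w)
  case Nil
  then have "w = id" by (simp add: delta_id_def split: if_splits)
  then show ?case by simp
next
  case (Cons a as)
  then obtain T where T: "T \<in> supports a" "left_op (cyc T) (num_fact as) w \<noteq> 0"
    unfolding num_fact.simps U_def by (meson sum.neutral)
  define y where "y = iv (cyc T) (w x)"
  have "(iv (cyc T) \<circ> w) x \<ge> x - int (length as)" using Cons.IH left_op_nonzero[OF T(2)] by blast
  then have "y \<ge> x - int (length as)" by (simp add: y_def)
  moreover have "w x = cyc T y" unfolding y_def using supports_D(2)[OF T(1)] by simp
  ultimately show ?case using cyc_ge[where T=T and x=y] by simp
qed

lemma unbounded_overflow:
  assumes f: "f \<in> P" and k: "k \<le> n"
    and nb: "\<not> (\<forall>x. (tau_pow (- av n f) \<circ> f) x \<ge> x - int k \<and> (tau_pow (- av n f) \<circ> f) x \<le> x + int (n - k))"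
  shows "overflow n (affine_stanley_poly n k f * alternant k id)"
  unfolding overflow_def
proof (intro allI impI)
  fix \<beta> :: "nat \<Rightarrow>\<^sub>0 nat" assume \<beta>: "\<forall>i. lkp \<beta> i < n"
  let ?p = "affine_stanley_poly n k f"
  define w where "w = tau_pow (- av n f) \<circ> f"
  have keys_iff: "Poly_Mapping.keys \<alpha> \<subseteq> {..<k} \<longleftrightarrow> (\<forall>i\<ge>k. lkp \<alpha> i = 0)" for \<alpha> :: "nat \<Rightarrow>\<^sub>0 nat"
    unfolding subset_iff in_keys_iff lessThan_iff by (meson not_le)
  show "lkp (?p * alternant k id) \<beta> = 0"
  proof (cases "Poly_Mapping.keys \<beta> \<subseteq> {..<k}")
    case False
    then obtain j where j: "j \<ge> k" "lkp \<beta> j \<noteq> 0" unfolding keys_iff by blast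
    have "lkp ?p (\<beta> - expv k \<sigma>) = 0" for \<sigma>
    proof -
      have "lkp (\<beta> - expv k \<sigma>) j \<noteq> 0" using j by (simp add: lookup_minus lookup_expv)
      then have "j \<in> Poly_Mapping.keys (\<beta> - expv k \<sigma>)" by (simp only: in_keys_iff not_False_eq_True)
      then have "\<not> Poly_Mapping.keys (\<beta> - expv k \<sigma>) \<subseteq> {..<k}" using j(1) by force
      then show ?thesis unfolding lookup_stanley_poly[OF f] by (simp only: if_False)
    qed
    then show ?thesis unfolding lookup_mult_alternant by (simp cong: if_cong)
  next
    case kb: True
    let ?b = "lkp \<beta>"
    have t: "(if \<forall>i<k. \<sigma> i \<le> ?b i then sign \<sigma> * lkp ?p (\<beta> - expv k \<sigma>) else 0)
        = act (of_int (sign \<sigma>) * (\<Prod>i=0..<k. h_band (?b i) (\<sigma> i))) delta_id w" for \<sigma>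
    proof (cases "\<forall>i<k. \<sigma> i \<le> ?b i")
      case True
      have kk: "Poly_Mapping.keys (\<beta> - expv k \<sigma>) \<subseteq> {..<k}" using kb unfolding keys_iff by (simp add: lookup_minus)
      have m: "map (lkp (\<beta> - expv k \<sigma>)) [0..<k] = map (\<lambda>i. ?b i - \<sigma> i) [0..<k]"
        by (simp add: lookup_minus lookup_expv)
      have "lkp ?p (\<beta> - expv k \<sigma>) = num_fact (map (\<lambda>i. ?b i - \<sigma> i) [0..<k]) w"
        unfolding lookup_stanley_poly[OF f] w_def m using kk by (simp only: if_True)
      also have "\<dots> = act (prod_list (map h_gen (map (\<lambda>i. ?b i - \<sigma> i) [0..<k]))) delta_id w"
        by (subst act_num_fact) (use \<beta> in \<open>auto intro: le_less_trans[OF diff_le_self]\<close>)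
      also have "prod_list (map h_gen (map (\<lambda>i. ?b i - \<sigma> i) [0..<k])) = (\<Prod>i=0..<k. h_band (?b i) (\<sigma> i))"
        using True by (simp add: prod.list_conv_set_nth h_band_def)
      finally show ?thesis using True by (simp add: act_of_int)
    next
      case False
      then obtain i where "i < k" "\<not> \<sigma> i \<le> ?b i" by blast
      then have pz: "(\<Prod>i=0..<k. h_band (?b i) (\<sigma> i)) = 0" by (intro prod_zero) (auto simp: h_band_def)
      show ?thesis unfolding if_not_P[OF False] pz by (simp add: act_0)
    qed
    have "lkp (?p * alternant k id) \<beta> = act (\<Sum>\<sigma> | \<sigma> permutes {0..<k}. of_int (sign \<sigma>) * (\<Prod>i=0..<k. h_band (?b i) (\<sigma> i))) delta_id w"
      unfolding lookup_mult_alternant t act_sum ..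
    show ?thesis
    proof (cases "\<forall>x. w x \<ge> x - int k")
      case False
      then obtain x where x: "\<not> w x \<ge> x - int k" by blast
      have "num_fact (map (lkp (\<beta> - expv k \<sigma>)) [0..<k]) w = 0" for \<sigma>
        using num_fact_bounded[of "map (lkp (\<beta> - expv k \<sigma>)) [0..<k]" w x] x by auto
      then have "lkp ?p (\<beta> - expv k \<sigma>) = 0" for \<sigma> unfolding lookup_stanley_poly[OF f] w_def by simp
      then show ?thesis unfolding lookup_mult_alternant by (simp cong: if_cong)
    next
      case True
      then obtain x where x: "\<not> w x \<le> x + int (n - k)" using nb unfolding w_def by blast
      have "act (of_int (sign \<tau>) * ((\<Prod>i=0..<k. if \<tau> i = ?b i then 1 else 0) * (\<Prod>i=k..<n. e_band i (\<tau> i)))) delta_id w = 0" for \<tau>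
      proof (cases "(\<forall>i\<in>{0..<k}. \<tau> i = ?b i) \<and> (\<forall>i\<in>{k..<n}. \<tau> i \<le> i)")
        case True
        have 1: "(\<Prod>i=0..<k. if \<tau> i = ?b i then 1 else 0) = (1 :: int_mpoly)"
          using True by (intro prod.neutral) auto
        have 2: "(\<Prod>i=k..<n. e_band i (\<tau> i)) = (\<Prod>i=k..<n. e_gen (i - \<tau> i))"
          using True by (intro prod.cong) (auto simp: e_band_def)
        have "act (\<Prod>i=k..<n. e_gen (i - \<tau> i)) delta_id w = 0"
        proof (rule ccontr)
          assume "act (\<Prod>i=k..<n. e_gen (i - \<tau> i)) delta_id w \<noteq> 0"
          then have "w x \<le> x + int (card {k..<n})" by (rule act_e_gen_bounded[rotated 2]) auto
          then show False using x by simp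
        qed
        then show ?thesis unfolding act_of_int 1 2 by simp
      next
        case False
        then consider i where "i < k" "\<tau> i \<noteq> ?b i" | i where "k \<le> i" "i < n" "\<not> \<tau> i \<le> i" by auto
        then have pz: "(\<Prod>i=0..<k. if \<tau> i = ?b i then 1 else 0) * (\<Prod>i=k..<n. e_band i (\<tau> i)) = (0 :: int_mpoly)"
        proof cases
          case (1 i)
          then have "(\<Prod>i=0..<k. if \<tau> i = ?b i then 1 else 0) = (0 :: int_mpoly)" by (intro prod_zero) auto
          then show ?thesis by simp
        next
          case (2 i)
          then have "(\<Prod>i=k..<n. e_band i (\<tau> i)) = 0" by (intro prod_zero) (auto simp: e_band_def)
          then show ?thesis by simp
        qed
        show ?thesis unfolding act_of_int pz by (simp add: act_0)
      qed
      then have "act (\<Sum>\<tau> | \<tau> permutes {0..<n}. of_int (sign \<tau>) *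
        ((\<Prod>i=0..<k. if \<tau> i = ?b i then 1 else 0) * (\<Prod>i=k..<n. e_band i (\<tau> i)))) delta_id w = 0"
        unfolding act_sum by simp
      then show ?thesis
        using \<open>lkp (?p * alternant k id) \<beta> = _\<close> toeplitz_minor[OF k, of ?b] \<beta> by simp
    qed
  qed
qed

section \<open>The Chevalley rule\<close>

definition refl_pairs :: "(int \<times> int) set" where
  "refl_pairs = {(a, b). 1 \<le> a \<and> a \<le> N \<and> a < b \<and> a mod N \<noteq> b mod N}"

abbreviation rf :: "int \<times> int \<Rightarrow> int \<Rightarrow> int" where "rf t \<equiv> refl (fst t) (snd t)"

lemma refl_pairs_D: assumes "t \<in> refl_pairs" shows "fst t < snd t" "fst t mod N \<noteq> snd t mod N" "rf t \<in> P" "rf t \<circ> rf t = id"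
  using assms refl_P[of "fst t" "snd t"] refl_comp[of "fst t" "snd t"] by (auto simp: refl_pairs_def)

lemma len_refl_ge:
  assumes "t \<in> refl_pairs" shows "snd t - fst t \<le> N * int (len (rf t) + 1)"
proof -
  obtain a b where t: "t = (a, b)" by (cases t)
  have ab: "1 \<le> a" "a \<le> N" "a < b" "a mod N \<noteq> b mod N" using assms t by (auto simp: refl_pairs_def)
  define m where "m = nat ((b - a) div N)"
  have m: "int m = (b - a) div N" using ab N_pos by (simp add: m_def pos_imp_zdiv_nonneg_iff)
  have mN: "int m * N \<le> b - a" "b - a < (int m + 1) * N"
    unfolding m distrib_right mult_1
    using pos_mod_sign[OF N_pos, of "b - a"] pos_mod_bound[OF N_pos, of "b - a"] div_mult_mod_eq[of "b - a" N]
    by linarith+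
  let ?f = "\<lambda>p. (a, b - int p * N)"
  have "?f ` {0..<m} \<subseteq> reps (Inv (refl a b))"
  proof
    fix x assume "x \<in> ?f ` {0..<m}"
    then obtain p where p: "p < m" "x = (a, b - int p * N)" by auto
    have "int p * N < int m * N" using p N_pos by simp
    then have lt: "a < b - int p * N" using mN by linarith
    have "refl a b (b - int p * N) = a - int p * N"
      using P_shift_mult[OF refl_P[OF ab(4)], of b "- int p"] ab(4) by simp
    moreover have "int p * N \<ge> 0" using N_pos by simp
    ultimately have "refl a b a > refl a b (b - int p * N)" using ab(3) refl_app(1)[of a b] by linarith
    then show "x \<in> reps (Inv (refl a b))" using p lt ab by (simp add: reps_def Inv_def)
  qed
  moreover have "inj_on ?f {0..<m}" using N_pos by (auto simp: inj_on_def)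
  ultimately have "card {0..<m} \<le> card (reps (Inv (refl a b)))"
    using card_inj_on_le[OF _ _ finite_Inv[OF refl_P[OF ab(4)]]] by blast
  then have "m \<le> len (rf t)" unfolding len_pair_count pair_count_def t by simp
  then have "(int m + 1) * N \<le> (int (len (rf t)) + 1) * N" using N_pos by (intro mult_right_mono) auto
  then have "b - a \<le> N * (int (len (rf t)) + 1)" using mN(2) by (simp only: mult.commute)
  then show ?thesis using t by (simp add: add.commute)
qed

lemma finite_refl_pairs_bounded: "finite {t \<in> refl_pairs. len (rf t) \<le> L}"
proof -
  have "{t \<in> refl_pairs. len (rf t) \<le> L} \<subseteq> {1..N} \<times> {1..N + N * int (L + 1)}"
  proof
    fix t assume "t \<in> {t \<in> refl_pairs. len (rf t) \<le> L}"
    then have t: "t \<in> refl_pairs" "len (rf t) \<le> L" by auto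
    have "N * int (len (rf t) + 1) \<le> N * int (L + 1)" using t(2) N_pos by (intro mult_left_mono) auto
    then have "snd t \<le> N + N * int (L + 1)" using len_refl_ge[OF t(1)] t(1) unfolding refl_pairs_def by (cases t) (simp only: fst_conv snd_conv mem_Collect_eq case_prod_conv, linarith)
    then show "t \<in> {1..N} \<times> {1..N + N * int (L + 1)}" using t(1) by (auto simp: refl_pairs_def)
  qed
  then show ?thesis by (rule finite_subset) simp
qed

lemma finite_refl_pairs_bounded': assumes "v \<in> P" shows "finite {t \<in> refl_pairs. len (v \<circ> rf t) \<le> L}"
proof (rule finite_subset[OF _ finite_refl_pairs_bounded[of "len v + L"]], rule subsetI)
  fix t assume "t \<in> {t \<in> refl_pairs. len (v \<circ> rf t) \<le> L}"
  then have t: "t \<in> refl_pairs" "len (v \<circ> rf t) \<le> L" by auto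
  have "rf t = iv v \<circ> (v \<circ> rf t)" unfolding o_assoc inv_P_comp(1)[OF assms] by (rule id_comp[symmetric])
  then have "len (rf t) \<le> len (iv v) + len (v \<circ> rf t)"
    using len_mult_le[OF P_inv[OF assms] P_comp[OF assms refl_pairs_D(3)[OF t(1)]]] by metis
  then show "t \<in> {t \<in> refl_pairs. len (rf t) \<le> len v + L}" using t len_inv[OF assms] by simp
qed

definition covers :: "(int \<Rightarrow> int) \<Rightarrow> (int \<times> int) set" where
  "covers v = {t \<in> refl_pairs. len (v \<circ> rf t) = len v + 1}"

lemma finite_covers: "v \<in> P \<Longrightarrow> finite (covers v)"
  using finite_refl_pairs_bounded'[of v "len v + 1"] by (rule rev_finite_subset) (auto simp: covers_def)

definition jump :: "(int \<Rightarrow> int) \<Rightarrow> int \<times> int \<Rightarrow> int" where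
  "jump \<chi> t = \<chi> (snd t) - \<chi> (fst t)"

definition chevalley_op :: "(int \<Rightarrow> int) \<Rightarrow> ((int \<Rightarrow> int) \<Rightarrow> int) \<Rightarrow> (int \<Rightarrow> int) \<Rightarrow> int" where
  "chevalley_op \<chi> F v = (if v \<in> P then \<Sum>t\<in>covers v. jump \<chi> t * F (v \<circ> rf t) else 0)"

definition level_one :: "(int \<Rightarrow> int) \<Rightarrow> bool" where
  "level_one \<chi> \<longleftrightarrow> (\<forall>x. \<chi> (x + N) = \<chi> x + 1)"

lemma level_one_mult: assumes "level_one \<chi>" shows "\<chi> (x + q * N) = \<chi> x + q"
proof (induction q rule: int_induct[where k=0])
  case (step1 i)
  then show ?case using assms[unfolded level_one_def, rule_format, of "x + i * N"] by (simp add: algebra_simps)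
next
  case (step2 i)
  then show ?case using assms[unfolded level_one_def, rule_format, of "x + i * N - N"] by (simp add: algebra_simps)
qed simp

lemma level_one_comp: "level_one \<chi> \<Longrightarrow> y \<in> P \<Longrightarrow> level_one (\<lambda>x. \<chi> (y x))"
  by (simp add: level_one_def P_shift)

definition conj_pair :: "(int \<Rightarrow> int) \<Rightarrow> int \<times> int \<Rightarrow> int \<times> int" where
  "conj_pair q t = norm_pair (if q (fst t) < q (snd t) then (q (fst t), q (snd t)) else (q (snd t), q (fst t)))"

lemma norm_pair_shift: "\<exists>r. norm_pair p = (fst p + r * N, snd p + r * N)"
  unfolding norm_pair_def by (rule exI[of _ "- ((fst p - 1) div N)"]) simp

lemma norm_pair_refl_pairs: assumes "fst p < snd p" "fst p mod N \<noteq> snd p mod N" shows "norm_pair p \<in> refl_pairs" "rf (norm_pair p) = rf p"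
proof -
  obtain r where r: "norm_pair p = (fst p + r * N, snd p + r * N)" using norm_pair_shift by blast
  have "(fst p + r * N) mod N \<noteq> (snd p + r * N) mod N" using assms(2) by simp
  then show "norm_pair p \<in> refl_pairs" using norm_pair_range[of p] assms unfolding refl_pairs_def by (simp add: r)
  show "rf (norm_pair p) = rf p" unfolding r fst_conv snd_conv by (rule refl_shift)
qed

lemma conj_pair_props:
  assumes q: "q \<in> P" and t: "t \<in> refl_pairs"
  shows "conj_pair q t \<in> refl_pairs" "q \<circ> rf t = rf (conj_pair q t) \<circ> q"
    "level_one \<chi> \<Longrightarrow> jump (\<lambda>x. \<chi> (iv q x)) (conj_pair q t) = (if q (fst t) < q (snd t) then jump \<chi> t else - jump \<chi> t)"
proof -
  obtain a b where ab: "t = (a, b)" by (cases t)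
  have lt: "a < b" "a mod N \<noteq> b mod N" using refl_pairs_D[OF t] ab by auto
  have qne: "q a mod N \<noteq> q b mod N" using P_mod_eq_iff[OF q] lt by simp
  then have qn: "q a \<noteq> q b" by auto
  define p where "p = (if q a < q b then (q a, q b) else (q b, q a))"
  have c: "conj_pair q t = norm_pair p" by (simp add: conj_pair_def ab p_def)
  have p: "fst p < snd p" "fst p mod N \<noteq> snd p mod N" using qn qne by (auto simp: p_def)
  show "conj_pair q t \<in> refl_pairs" unfolding c by (rule norm_pair_refl_pairs[OF p])
  have "rf p = refl (q a) (q b)" using refl_commute[OF qne] by (simp add: p_def)
  then show "q \<circ> rf t = rf (conj_pair q t) \<circ> q" unfolding c norm_pair_refl_pairs(2)[OF p] using refl_conj[OF q, of a b] ab by simp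
  assume \<chi>: "level_one \<chi>"
  obtain r where r: "norm_pair p = (fst p + r * N, snd p + r * N)" using norm_pair_shift by blast
  have "jump (\<lambda>x. \<chi> (iv q x)) (conj_pair q t) = \<chi> (iv q (snd p)) - \<chi> (iv q (fst p))"
    unfolding c r jump_def fst_conv snd_conv P_shift_mult[OF P_inv[OF q]] level_one_mult[OF \<chi>] by simp
  then show "jump (\<lambda>x. \<chi> (iv q x)) (conj_pair q t) = (if q (fst t) < q (snd t) then jump \<chi> t else - jump \<chi> t)"
    using q by (simp add: p_def ab jump_def)
qed

lemma refl_pairs_eqI: assumes "t \<in> refl_pairs" "t' \<in> refl_pairs" "rf t = rf t'" shows "t = t'"
proof -
  obtain a b where ab: "t = (a, b)" by (cases t)
  obtain a' b' where ab': "t' = (a', b')" by (cases t')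
  have lt: "1 \<le> a" "a \<le> N" "a < b" "a mod N \<noteq> b mod N" "1 \<le> a'" "a' \<le> N" "a' < b'" "a' mod N \<noteq> b' mod N"
    using assms ab ab' by (auto simp: refl_pairs_def)
  have eq: "refl a b x = refl a' b' x" for x using assms(3) ab ab' by simp
  have "refl a' b' a = b" using eq[of a] by simp
  then have "a mod N = a' mod N" using lt by (auto simp: refl_def split: if_splits)
  then obtain q where q: "a = a' + q * N" by (rule mod_eqE)
  then have "q = 0" using rep_shift_zero[of a' q] lt by simp
  then have "a = a'" using q by simp
  moreover have "b = b'" using eq[of a] \<open>a = a'\<close> by simp
  ultimately show ?thesis using ab ab' by simp
qed

lemma conj_pair_inv: assumes q: "q \<in> P" and t: "t \<in> refl_pairs" shows "conj_pair (iv q) (conj_pair q t) = t"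
proof (rule refl_pairs_eqI)
  note c = conj_pair_props(1,2)[OF q t] and c' = conj_pair_props(1,2)[OF P_inv[OF q] conj_pair_props(1)[OF q t]]
  show "conj_pair (iv q) (conj_pair q t) \<in> refl_pairs" by (rule c'(1))
  show "t \<in> refl_pairs" by (rule t)
  have "rf (conj_pair (iv q) (conj_pair q t)) = rf (conj_pair (iv q) (conj_pair q t)) \<circ> (iv q \<circ> q)" unfolding inv_P_comp(1)[OF q] by (rule comp_id[symmetric])
  also have "\<dots> = iv q \<circ> rf (conj_pair q t) \<circ> q" unfolding o_assoc c'(2)[symmetric] ..
  also have "\<dots> = iv q \<circ> (q \<circ> rf t)" unfolding c(2) o_assoc ..
  also have "\<dots> = rf t" unfolding o_assoc inv_P_comp(1)[OF q] by (rule id_comp)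
  finally show "rf (conj_pair (iv q) (conj_pair q t)) = rf t" .
qed

text \<open>The term-by-term form of the fact that \<open>chevalley_op\<close> acts on products in the nil-Coxeter algebra as a
  derivation, up to a change of \<open>\<chi>\<close>.\<close>

lemma leibniz_local:
  assumes z: "z \<in> P" and v: "v \<in> P" and t: "t \<in> refl_pairs"
  defines "q \<equiv> iv z \<circ> v"
  defines "y \<equiv> q \<circ> rf t"
  assumes L: "len v + 1 = len z + len y" and \<chi>: "level_one \<chi>"
  shows "(if len (v \<circ> rf t) = len v + 1 then jump \<chi> t else 0)
    = (if len q + 1 = len y then jump \<chi> t else 0)
    + (if len (z \<circ> rf (conj_pair q t)) + 1 = len z then jump (\<lambda>x. \<chi> (iv y x)) (conj_pair q t) else 0)"
proof -
  obtain a b where ab: "t = (a, b)" by (cases t)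
  have lt: "a < b" "a mod N \<noteq> b mod N" using refl_pairs_D[OF t] ab by auto
  let ?t = "rf t" and ?s = "rf (conj_pair q t)"
  have qP: "q \<in> P" unfolding q_def using P_comp[OF P_inv[OF z] v] .
  have yP: "y \<in> P" unfolding y_def using P_comp[OF qP refl_pairs_D(3)[OF t]] .
  have s: "conj_pair q t \<in> refl_pairs" "q \<circ> ?t = ?s \<circ> q" using conj_pair_props[OF qP t] by auto
  have zq: "z \<circ> q = v" unfolding q_def o_assoc inv_P_comp(2)[OF z] by (rule id_comp)
  have vt: "v \<circ> ?t = z \<circ> y" unfolding y_def o_assoc zq ..
  have yt: "y \<circ> ?t = q" unfolding y_def o_assoc[symmetric] refl_pairs_D(4)[OF t] by (rule comp_id)
  have sy: "?s \<circ> y = q" unfolding y_def s(2) o_assoc refl_pairs_D(4)[OF s(1)] by (rule id_comp)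
  have zsy: "(z \<circ> ?s) \<circ> y = v" unfolding o_assoc[symmetric] sy by (rule zq)
  have zsP: "z \<circ> ?s \<in> P" using P_comp[OF z refl_pairs_D(3)[OF s(1)]] .
  have yab: "y a = q b" "y b = q a" using ab lt by (simp_all add: y_def)
  have cjy: "conj_pair q t = conj_pair y t"
  proof (rule refl_pairs_eqI[OF s(1) conj_pair_props(1)[OF yP t]])
    have "rf (conj_pair y t) \<circ> y = y \<circ> ?t" using conj_pair_props(2)[OF yP t] by simp
    also have "\<dots> = ?s \<circ> y" unfolding yt sy ..
    finally have "rf (conj_pair y t) \<circ> y \<circ> iv y = ?s \<circ> y \<circ> iv y" by simp
    then show "?s = rf (conj_pair y t)" unfolding o_assoc[symmetric] inv_P_comp(2)[OF yP] comp_id by simp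
  qed
  have kp: "jump (\<lambda>x. \<chi> (iv y x)) (conj_pair q t) = (if y a < y b then jump \<chi> t else - jump \<chi> t)"
    unfolding cjy using conj_pair_props(3)[OF yP t \<chi>] ab by simp
  have C1: "len (v \<circ> ?t) = len v + 1 \<longleftrightarrow> v a < v b"
  proof -
    have "len (v \<circ> ?t) \<le> len v + 1" unfolding vt using len_mult_le[OF z yP] L by simp
    then show ?thesis using len_refl_less_iff(2)[OF v lt] ab by auto
  qed
  have C2: "len q + 1 = len y \<longleftrightarrow> y b < y a"
  proof -
    have "len v \<le> len z + len q" using len_mult_le[OF z qP] zq by simp
    then have "len y \<le> len q + 1" using L by linarith
    then show ?thesis using len_refl_less_iff(1)[OF yP lt] ab yt by auto
  qed
  have C3: "len (z \<circ> ?s) + 1 = len z \<longleftrightarrow> z (snd (conj_pair q t)) < z (fst (conj_pair q t))"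
  proof -
    have "len v \<le> len (z \<circ> ?s) + len y" using len_mult_le[OF zsP yP] zsy by simp
    then have "len z \<le> len (z \<circ> ?s) + 1" using L by linarith
    then show ?thesis using len_refl_less_iff(1)[OF z refl_pairs_D(1,2)[OF s(1)]] by auto
  qed
  have zc: "z (snd (conj_pair q t)) < z (fst (conj_pair q t)) \<longleftrightarrow> (if q a < q b then z (q b) < z (q a) else z (q a) < z (q b))"
  proof -
    obtain r where r: "conj_pair q t = (fst (if q a < q b then (q a, q b) else (q b, q a)) + r * N, snd (if q a < q b then (q a, q b) else (q b, q a)) + r * N)"
      unfolding conj_pair_def ab fst_conv snd_conv using norm_pair_shift by blast
    show ?thesis unfolding r by (simp add: P_shift_mult[OF z])
  qed
  have zqx: "z (q x) = v x" for x using zq by (metis comp_apply)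
  have "q a \<noteq> q b" "v a \<noteq> v b" using P_inj[OF qP] P_inj[OF v] lt by auto
  then show ?thesis unfolding C1 C2 C3 zc zqx kp yab by auto
qed

definition lower_pairs :: "nat \<Rightarrow> (int set \<times> int \<times> int) set" where
  "lower_pairs r = {(T, t). T \<in> supports r \<and> t \<in> refl_pairs \<and> len (cyc T \<circ> rf t) + 1 = r}"

definition pos_pairs :: "nat \<Rightarrow> (int set \<times> int) set" where
  "pos_pairs r = {(T, p). T \<in> supports r \<and> p \<in> {1..N} \<and> on T p}"

lemma nxt_other:
  assumes T: "is_support T" "card T \<ge> 2" and p: "on T p" shows "nxt T p mod N \<noteq> p mod N" "nxt T p < p + N"
proof -
  have "\<exists>t\<in>T. t \<noteq> p mod N"
  proof (rule ccontr)
    assume "\<not> ?thesis"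
    then have "T \<subseteq> {p mod N}" by blast
    then have "card T \<le> 1" using card_mono[of "{p mod N}" T] by simp
    then show False using T(2) by simp
  qed
  then obtain t where t: "t \<in> T" "t \<noteq> p mod N" by blast
  have t0: "0 \<le> t" "t < N" using T(1) t by (auto simp: is_support_def)
  define y where "y = p + (t - p) mod N"
  have ym: "y mod N = t" unfolding y_def using t0 by (simp add: mod_simps)
  have "(t - p) mod N \<noteq> 0"
  proof
    assume "(t - p) mod N = 0"
    then have "y = p" by (simp add: y_def)
    then show False using ym t by simp
  qed
  then have y: "p < y" "y < p + N" using pos_mod_sign[OF N_pos, of "t - p"] pos_mod_bound[OF N_pos, of "t - p"]
    by (auto simp: y_def)
  then show lt: "nxt T p < p + N" using nxt_le_on[of y T p] ym t by simp
  show "nxt T p mod N \<noteq> p mod N"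
  proof
    assume "nxt T p mod N = p mod N"
    then obtain q where q: "nxt T p = p + q * N" by (rule mod_eqE)
    then have "0 < q * N" "q * N < 1 * N" using lt nxt_gt[of p T] by auto
    then have "0 < q" "q < 1" using N_pos by (auto simp: zero_less_mult_iff)
    then show False by simp
  qed
qed

lemma lower_pairs_bij:
  assumes r: "1 \<le> r" "r < n"
  shows "bij_betw (\<lambda>(T, p). (T - {nxt T p mod N}, (p, nxt T p))) (pos_pairs (r - 1)) (lower_pairs r)"
    "\<And>T p. (T, p) \<in> pos_pairs (r - 1) \<Longrightarrow> cyc (T - {nxt T p mod N}) \<circ> refl p (nxt T p) = cyc T"
proof -
  let ?f = "\<lambda>(T, p). (T - {nxt T p mod N}, (p, nxt T p))"
  let ?g = "\<lambda>(T, t). (insert (snd t mod N) T, fst t)"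
  have fwd: "?f (T, p) \<in> lower_pairs r \<and> ?g (?f (T, p)) = (T, p) \<and> cyc (T - {nxt T p mod N}) \<circ> refl p (nxt T p) = cyc T"
    if Tp: "(T, p) \<in> pos_pairs (r - 1)" for T p
  proof -
    have T: "T \<in> supports (r - 1)" "1 \<le> p" "p \<le> N" "on T p" using Tp by (auto simp: pos_pairs_def)
    note tT = supports_D[OF T(1)]
    have c2: "card T \<ge> 2" using tT(4) r by linarith
    define b where "b = nxt T p"
    have b: "b mod N \<noteq> p mod N" "p < b" "on T b" unfolding b_def using nxt_other[OF tT(1) c2 T(4)] nxt_gt nxt_on[OF tT(1)] by auto
    define T' where "T' = T - {b mod N}"
    have pT': "on T' p" using T(4) b(1) by (simp add: T'_def)
    then have T': "is_support T'" using tT(1) unfolding T'_def is_support_def by blast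
    have ins: "insert (b mod N) T' = T" using b(3) by (auto simp: T'_def)
    have "b < nxt T' p"
    proof -
      have "on T (nxt T' p)" using nxt_on[OF T'] by (simp add: T'_def)
      then have "b \<le> nxt T' p" unfolding b_def using nxt_le_on[of "nxt T' p" T p] nxt_gt by blast
      moreover have "nxt T' p \<noteq> b" using nxt_on[OF T', of p] by (auto simp: T'_def)
      ultimately show ?thesis by simp
    qed
    then have e: "cyc T' \<circ> refl p b = cyc T" using cyc_refl[OF T' pT' b(2)] ins by simp
    have "card T' = card T - 1" using b(3) card_is_support(3)[OF tT(1)] by (simp add: T'_def)
    then have "n - card T' = r" using tT(4) r by linarith
    then have "T' \<in> supports r" using T' by (simp add: supports_def)
    moreover have "(p, b) \<in> refl_pairs" using T(2,3) b by (auto simp: refl_pairs_def)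
    moreover have "len (cyc T' \<circ> rf (p, b)) + 1 = r" using e tT(3) r by simp
    ultimately have "(T', (p, b)) \<in> lower_pairs r" by (simp add: lower_pairs_def)
    then show ?thesis using ins e by (simp add: T'_def b_def)
  qed
  have bwd: "?g x \<in> pos_pairs (r - 1) \<and> ?f (?g x) = x" if x: "x \<in> lower_pairs r" for x
  proof -
    obtain T a b where xe: "x = (T, (a, b))" by (metis prod.exhaust)
    have T: "T \<in> supports r" "(a, b) \<in> refl_pairs" "len (cyc T \<circ> refl a b) + 1 = r" using x xe by (auto simp: lower_pairs_def)
    note tT = supports_D[OF T(1)]
    have ab: "1 \<le> a" "a \<le> N" "a < b" "a mod N \<noteq> b mod N" using T(2) by (auto simp: refl_pairs_def)
    have "len (cyc T \<circ> refl a b) < len (cyc T)" using T(3) tT(3) by simp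
    then have "cyc T b < cyc T a" using len_refl_less_iff(1)[OF tT(2) ab(3,4)] by simp
    then have "(a, b) \<in> Inv (cyc T)" using ab(3) by (simp add: Inv_def)
    then have i: "on T a" "\<not> on T b" "b < nxt T a" unfolding Inv_cyc[OF tT(1)] by auto
    define T' where "T' = insert (b mod N) T"
    have T': "is_support T'" unfolding T'_def by (rule is_support_insert[OF tT(1)])
    have e: "cyc T \<circ> refl a b = cyc T'" unfolding T'_def by (rule cyc_refl[OF tT(1) i(1) ab(3) i(3)])
    have "cyc T' a = cyc T b" using fun_cong[OF e, of a] by simp
    moreover have aT': "on T' a" using i(1) by (simp add: T'_def)
    ultimately have nx: "nxt T' a = b" using i(2) by (simp add: cyc_def)
    have "card T' = card T + 1" using i(2) card_is_support(3)[OF tT(1)] by (simp add: T'_def)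
    then have "n - card T' = r - 1" using tT(4) r by linarith
    then have "(T', a) \<in> pos_pairs (r - 1)" using T' aT' ab by (simp add: pos_pairs_def supports_def)
    moreover have "T' - {b mod N} = T" using i(2) by (simp add: T'_def)
    ultimately show ?thesis using nx by (simp add: xe T'_def)
  qed
  show "bij_betw ?f (pos_pairs (r - 1)) (lower_pairs r)"
  proof (rule bij_betw_byWitness[where f'="?g"])
    show "\<forall>x\<in>pos_pairs (r - 1). ?g (?f x) = x"
    proof
      fix x assume "x \<in> pos_pairs (r - 1)"
      then show "?g (?f x) = x" using fwd[of "fst x" "snd x"] by (simp only: prod.collapse)
    qed
    show "\<forall>x\<in>lower_pairs r. ?f (?g x) = x" using bwd by blast
    show "?f ` pos_pairs (r - 1) \<subseteq> lower_pairs r"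
    proof
      fix x' assume "x' \<in> ?f ` pos_pairs (r - 1)"
      then obtain x where x: "x \<in> pos_pairs (r - 1)" "x' = ?f x" by blast
      then show "x' \<in> lower_pairs r" using fwd[of "fst x" "snd x"] by (simp only: prod.collapse)
    qed
    show "?g ` lower_pairs r \<subseteq> pos_pairs (r - 1)" using bwd by blast
  qed
  show "\<And>T p. (T, p) \<in> pos_pairs (r - 1) \<Longrightarrow> cyc (T - {nxt T p mod N}) \<circ> refl p (nxt T p) = cyc T"
    using fwd by blast
qed

lemma sum_arcs:
  assumes T: "is_support T" and \<chi>: "level_one \<chi>" shows "(\<Sum>p | p \<in> {1..N} \<and> on T p. \<chi> (nxt T p) - \<chi> p) = 1"
proof -
  define f where "f = tau_pow 1 \<circ> cyc T"
  have fP: "f \<in> P" unfolding f_def using P_comp[OF P_tau cyc_P[OF T]] .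
  have sdf: "displ f = N" unfolding f_def using displ_comp[OF P_tau cyc_P[OF T]] displ_tau displ_cyc[OF T] by simp
  have f: "f p = (if on T p then nxt T p else p)" for p by (simp add: f_def tau_pow_def cyc_def)
  have "(\<Sum>p\<in>{1..N}. \<chi> (f p) - \<chi> p) * N = N"
    using sum_level_one[OF fP, of \<chi>] \<chi> sdf by (simp add: level_one_def)
  then have "(\<Sum>p\<in>{1..N}. \<chi> (f p) - \<chi> p) = 1" using N_pos by simp
  moreover have "(\<Sum>p\<in>{1..N}. \<chi> (f p) - \<chi> p) = (\<Sum>p | p \<in> {1..N} \<and> on T p. \<chi> (nxt T p) - \<chi> p)"
    by (rule sum.mono_neutral_cong_right) (auto simp: f)
  ultimately show ?thesis by simp
qed

lemma chevalley_op_U: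
  assumes v: "v \<in> P" and r: "1 \<le> r" "r < n" and \<chi>: "level_one \<chi>"
  shows "chevalley_op \<chi> (U r F) v = U r (chevalley_op \<chi> F) v + U (r - 1) F v"
proof -
  define q where "q T = iv (cyc T) \<circ> v" for T
  define B where "B T = {t \<in> refl_pairs. len v + 1 = r + len (q T \<circ> rf t)}" for T
  define y where "y T t = q T \<circ> rf t" for T t
  have qP: "q T \<in> P" if "T \<in> supports r" for T unfolding q_def using P_comp[OF P_inv[OF supports_D(2)[OF that]] v] .
  have fB: "finite (B T)" if "T \<in> supports r" for T
    using finite_refl_pairs_bounded'[OF qP[OF that], of "len v + 1"] by (rule rev_finite_subset) (auto simp: B_def)
  have qt: "iv (cyc T) \<circ> (v \<circ> rf t) = y T t" for T t unfolding y_def q_def by (rule o_assoc)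
  have vtP: "v \<circ> rf t \<in> P" if "t \<in> refl_pairs" for t using P_comp[OF v refl_pairs_D(3)[OF that]] .
  have CovRF: "t \<in> refl_pairs" if "t \<in> covers w" for t w using that by (simp add: covers_def)
  have L: "chevalley_op \<chi> (U r F) v = (\<Sum>T\<in>supports r. \<Sum>t\<in>B T. (if len (v \<circ> rf t) = len v + 1 then jump \<chi> t else 0) * F (y T t))"
  proof -
    have "chevalley_op \<chi> (U r F) v = (\<Sum>t\<in>covers v. \<Sum>T\<in>supports r. jump \<chi> t * left_op (cyc T) F (v \<circ> rf t))"
      using v by (simp only: chevalley_op_def U_def if_True sum_distrib_left)
    also have "\<dots> = (\<Sum>T\<in>supports r. \<Sum>t\<in>covers v. jump \<chi> t * left_op (cyc T) F (v \<circ> rf t))" by (rule sum.swap)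
    also have "\<dots> = (\<Sum>T\<in>supports r. \<Sum>t\<in>B T. (if len (v \<circ> rf t) = len v + 1 then jump \<chi> t else 0) * F (y T t))"
    proof (rule sum.cong[OF HOL.refl])
      fix T assume T: "T \<in> supports r"
      have l: "left_op (cyc T) F (v \<circ> rf t) = (if len (v \<circ> rf t) = r + len (y T t) then F (y T t) else 0)" if "t \<in> refl_pairs" for t
        unfolding left_op_def qt supports_D(3)[OF T] using vtP[OF that] by simp
      have "(\<Sum>t\<in>covers v. jump \<chi> t * left_op (cyc T) F (v \<circ> rf t)) = (\<Sum>t\<in>covers v \<inter> B T. jump \<chi> t * F (y T t))"
      proof (rule sum.mono_neutral_cong_right)
        show "finite (covers v)" using finite_covers[OF v] .
        show "\<forall>t\<in>covers v - covers v \<inter> B T. jump \<chi> t * left_op (cyc T) F (v \<circ> rf t) = 0"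
        proof
          fix t assume "t \<in> covers v - covers v \<inter> B T"
          then have "t \<in> refl_pairs" "len (v \<circ> rf t) \<noteq> r + len (y T t)" by (auto simp: covers_def B_def y_def)
          then show "jump \<chi> t * left_op (cyc T) F (v \<circ> rf t) = 0" using l[of t] by simp
        qed
        fix t assume "t \<in> covers v \<inter> B T"
        then have "t \<in> refl_pairs" "len (v \<circ> rf t) = r + len (y T t)" by (auto simp: covers_def B_def y_def)
        then show "jump \<chi> t * left_op (cyc T) F (v \<circ> rf t) = jump \<chi> t * F (y T t)" using l[of t] by simp
      qed simp
      also have "\<dots> = (\<Sum>t\<in>B T. (if len (v \<circ> rf t) = len v + 1 then jump \<chi> t else 0) * F (y T t))"
        using fB[OF T] by (intro sum.mono_neutral_cong_left) (auto simp: covers_def B_def)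
      finally show "(\<Sum>t\<in>covers v. jump \<chi> t * left_op (cyc T) F (v \<circ> rf t)) = (\<Sum>t\<in>B T. (if len (v \<circ> rf t) = len v + 1 then jump \<chi> t else 0) * F (y T t))" .
    qed
    finally show ?thesis .
  qed
  have M: "U r (chevalley_op \<chi> F) v = (\<Sum>T\<in>supports r. \<Sum>t\<in>B T. (if len (q T) + 1 = len (y T t) then jump \<chi> t else 0) * F (y T t))"
    unfolding U_def
  proof (intro sum.cong HOL.refl)
    fix T assume T: "T \<in> supports r"
    have "left_op (cyc T) (chevalley_op \<chi> F) v = (if len v = r + len (q T) then \<Sum>t\<in>covers (q T). jump \<chi> t * F (y T t) else 0)"
      unfolding left_op_def q_def[symmetric] supports_D(3)[OF T] chevalley_op_def y_def using v qP[OF T] by simp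
    also have "\<dots> = (\<Sum>t\<in>B T. (if len (q T) + 1 = len (y T t) then jump \<chi> t else 0) * F (y T t))"
    proof (cases "len v = r + len (q T)")
      case True
      have "(\<Sum>t\<in>covers (q T). jump \<chi> t * F (y T t)) = (\<Sum>t\<in>B T. (if len (q T) + 1 = len (y T t) then jump \<chi> t else 0) * F (y T t))"
        using fB[OF T] True by (intro sum.mono_neutral_cong_left) (auto simp: covers_def B_def y_def)
      then show ?thesis using True by simp
    next
      case False
      have "(\<Sum>t\<in>B T. (if len (q T) + 1 = len (y T t) then jump \<chi> t else 0) * F (y T t)) = 0"
        using False by (intro sum.neutral) (auto simp: B_def y_def)
      then show ?thesis using False by simp
    qed
    finally show "left_op (cyc T) (chevalley_op \<chi> F) v = (\<Sum>t\<in>B T. (if len (q T) + 1 = len (y T t) then jump \<chi> t else 0) * F (y T t))" .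
  qed
  define G where "G z s = (if len v + 1 = r + len (iv z \<circ> v) then jump (\<lambda>x. \<chi> (iv (iv z \<circ> v) x)) s * F (iv z \<circ> v) else 0)" for z s
  have R: "U (r - 1) F v = (\<Sum>T\<in>supports r. \<Sum>t\<in>B T. (if len (cyc T \<circ> rf (conj_pair (q T) t)) + 1 = len (cyc T)
      then jump (\<lambda>x. \<chi> (iv (y T t) x)) (conj_pair (q T) t) else 0) * F (y T t))"
  proof -
    have step: "(\<Sum>t\<in>B T. (if len (cyc T \<circ> rf (conj_pair (q T) t)) + 1 = len (cyc T)
      then jump (\<lambda>x. \<chi> (iv (y T t) x)) (conj_pair (q T) t) else 0) * F (y T t)) = (\<Sum>s | (T, s) \<in> lower_pairs r. G (cyc T \<circ> rf s) s)" if T: "T \<in> supports r" for T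
    proof -
      note z = supports_D(2)[OF T]
      let ?S = "{s \<in> refl_pairs. len v + 1 = r + len (iv (cyc T \<circ> rf s) \<circ> v)}"
      have ys: "iv (cyc T \<circ> rf s) \<circ> v = rf s \<circ> q T" if "s \<in> refl_pairs" for s
      proof -
        have "iv (rf s) = rf s" using refl_pairs_D(4)[OF that] by (metis inv_unique_comp)
        then show ?thesis unfolding iv_comp[OF z refl_pairs_D(3)[OF that]] q_def by (simp only: o_assoc)
      qed
      have yt: "y T t = rf (conj_pair (q T) t) \<circ> q T" if "t \<in> refl_pairs" for t
        unfolding y_def by (rule conj_pair_props(2)[OF qP[OF T] that])
      have yc: "iv (cyc T \<circ> rf (conj_pair (q T) t)) \<circ> v = y T t" if "t \<in> refl_pairs" for t
        using ys[OF conj_pair_props(1)[OF qP[OF T] that]] yt[OF that] by simp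
      have bij: "bij_betw (conj_pair (q T)) (B T) ?S"
      proof (rule bij_betw_byWitness[where f'="conj_pair (iv (q T))"])
        show "\<forall>t\<in>B T. conj_pair (iv (q T)) (conj_pair (q T) t) = t" using conj_pair_inv[OF qP[OF T]] by (simp add: B_def)
        have ivq: "iv (iv (q T)) = q T" using inv_inv_eq[OF P_bij[OF qP[OF T]]] .
        have b2: "conj_pair (q T) (conj_pair (iv (q T)) s) = s" if "s \<in> refl_pairs" for s
          using conj_pair_inv[OF P_inv[OF qP[OF T]] that] unfolding ivq .
        then show "\<forall>s\<in>?S. conj_pair (q T) (conj_pair (iv (q T)) s) = s" by simp
        show "conj_pair (q T) ` B T \<subseteq> ?S"
        proof
          fix s assume "s \<in> conj_pair (q T) ` B T"
          then obtain t where t: "t \<in> refl_pairs" "len v + 1 = r + len (y T t)" "s = conj_pair (q T) t" by (auto simp: B_def y_def)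
          then show "s \<in> ?S" using conj_pair_props(1)[OF qP[OF T] t(1)] yc[OF t(1)] by simp
        qed
        show "conj_pair (iv (q T)) ` ?S \<subseteq> B T"
        proof
          fix t assume "t \<in> conj_pair (iv (q T)) ` ?S"
          then obtain s where s: "s \<in> refl_pairs" "len v + 1 = r + len (iv (cyc T \<circ> rf s) \<circ> v)" "t = conj_pair (iv (q T)) s" by auto
          have t: "t \<in> refl_pairs" using conj_pair_props(1)[OF P_inv[OF qP[OF T]] s(1)] s(3) by simp
          have "conj_pair (q T) t = s" using b2[OF s(1)] s(3) by simp
          then show "t \<in> B T" using t s(2) yc[OF t] by (simp add: B_def y_def)
        qed
      qed
      have "(\<Sum>t\<in>B T. (if len (cyc T \<circ> rf (conj_pair (q T) t)) + 1 = len (cyc T)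
        then jump (\<lambda>x. \<chi> (iv (y T t) x)) (conj_pair (q T) t) else 0) * F (y T t))
        = (\<Sum>t\<in>B T. if len (cyc T \<circ> rf (conj_pair (q T) t)) + 1 = r then G (cyc T \<circ> rf (conj_pair (q T) t)) (conj_pair (q T) t) else 0)"
      proof (intro sum.cong HOL.refl)
        fix t assume "t \<in> B T"
        then have t: "t \<in> refl_pairs" "len v + 1 = r + len (y T t)" by (auto simp: B_def y_def)
        show "(if len (cyc T \<circ> rf (conj_pair (q T) t)) + 1 = len (cyc T)
          then jump (\<lambda>x. \<chi> (iv (y T t) x)) (conj_pair (q T) t) else 0) * F (y T t)
          = (if len (cyc T \<circ> rf (conj_pair (q T) t)) + 1 = r then G (cyc T \<circ> rf (conj_pair (q T) t)) (conj_pair (q T) t) else 0)"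
          unfolding G_def yc[OF t(1)] supports_D(3)[OF T] using t(2) by auto
      qed
      also have "\<dots> = (\<Sum>s\<in>?S. if len (cyc T \<circ> rf s) + 1 = r then G (cyc T \<circ> rf s) s else 0)"
        by (rule sum.reindex_bij_betw[OF bij])
      also have "\<dots> = (\<Sum>s | (T, s) \<in> lower_pairs r. G (cyc T \<circ> rf s) s)"
      proof -
        have fS: "finite ?S" using bij_betw_finite[OF bij] fB[OF T] by blast
        have fQ: "finite {s. (T, s) \<in> lower_pairs r}"
          using finite_refl_pairs_bounded'[OF z, of r] by (rule rev_finite_subset) (auto simp: lower_pairs_def)
        have "(\<Sum>s\<in>?S. if len (cyc T \<circ> rf s) + 1 = r then G (cyc T \<circ> rf s) s else 0)
          = (\<Sum>s\<in>?S \<inter> {s. (T, s) \<in> lower_pairs r}. G (cyc T \<circ> rf s) s)"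
          using fS T by (intro sum.mono_neutral_cong_right) (auto simp: lower_pairs_def)
        also have "\<dots> = (\<Sum>s | (T, s) \<in> lower_pairs r. G (cyc T \<circ> rf s) s)"
          using fQ by (intro sum.mono_neutral_left) (auto simp: lower_pairs_def G_def)
        finally show ?thesis .
      qed
      finally show ?thesis .
    qed
    have fPs: "finite {p. p \<in> {1..N} \<and> on T p}" for T by (rule finite_subset[of _ "{1..N}"]) auto
    have SigQ: "lower_pairs r = Sigma (supports r) (\<lambda>T. {s. (T, s) \<in> lower_pairs r})" by (auto simp: lower_pairs_def)
    have SigP: "pos_pairs (r - 1) = Sigma (supports (r - 1)) (\<lambda>T. {p. p \<in> {1..N} \<and> on T p})" by (auto simp: pos_pairs_def)
    have fQ': "finite {s. (T, s) \<in> lower_pairs r}" if "T \<in> supports r" for T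
      using finite_refl_pairs_bounded'[OF supports_D(2)[OF that], of r] by (rule rev_finite_subset) (auto simp: lower_pairs_def)
    have "(\<Sum>T\<in>supports r. \<Sum>t\<in>B T. (if len (cyc T \<circ> rf (conj_pair (q T) t)) + 1 = len (cyc T)
      then jump (\<lambda>x. \<chi> (iv (y T t) x)) (conj_pair (q T) t) else 0) * F (y T t)) = (\<Sum>T\<in>supports r. \<Sum>s | (T, s) \<in> lower_pairs r. G (cyc T \<circ> rf s) s)"
      by (rule sum.cong[OF HOL.refl step])
    also have "\<dots> = (\<Sum>x\<in>lower_pairs r. G (cyc (fst x) \<circ> rf (snd x)) (snd x))"
      by (subst SigQ, subst sum.Sigma) (use fQ' finite_supports in \<open>auto simp: case_prod_unfold\<close>)
    also have "\<dots> = (\<Sum>x\<in>pos_pairs (r - 1). G (cyc (fst x)) (snd x, nxt (fst x) (snd x)))"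
    proof -
      let ?f = "\<lambda>(T, p). (T - {nxt T p mod N}, (p, nxt T p))"
      have "(\<Sum>x\<in>lower_pairs r. G (cyc (fst x) \<circ> rf (snd x)) (snd x)) = (\<Sum>x\<in>pos_pairs (r - 1). G (cyc (fst (?f x)) \<circ> rf (snd (?f x))) (snd (?f x)))"
        by (rule sum.reindex_bij_betw[OF lower_pairs_bij(1)[OF r], symmetric])
      also have "\<dots> = (\<Sum>x\<in>pos_pairs (r - 1). G (cyc (fst x)) (snd x, nxt (fst x) (snd x)))"
      proof (intro sum.cong HOL.refl)
        fix x assume x: "x \<in> pos_pairs (r - 1)"
        obtain T p where xe: "x = (T, p)" by (cases x)
        have "cyc (fst (?f x)) \<circ> rf (snd (?f x)) = cyc T" using lower_pairs_bij(2)[OF r, of T p] x xe by (simp del: comp_apply)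
        then show "G (cyc (fst (?f x)) \<circ> rf (snd (?f x))) (snd (?f x)) = G (cyc (fst x)) (snd x, nxt (fst x) (snd x))"
          by (simp only: xe case_prod_conv fst_conv snd_conv)
      qed
      finally show ?thesis .
    qed
    also have "\<dots> = (\<Sum>T\<in>supports (r - 1). \<Sum>p | p \<in> {1..N} \<and> on T p. G (cyc T) (p, nxt T p))"
      by (subst SigP, subst sum.Sigma) (use fPs finite_supports in \<open>auto simp: case_prod_unfold\<close>)
    also have "\<dots> = (\<Sum>T\<in>supports (r - 1). left_op (cyc T) F v)"
    proof (intro sum.cong HOL.refl)
      fix T assume T: "T \<in> supports (r - 1)"
      note tT = supports_D[OF T]
      have yP: "iv (cyc T) \<circ> v \<in> P" using P_comp[OF P_inv[OF tT(2)] v] .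
      have c: "len v + 1 = r + len (iv (cyc T) \<circ> v) \<longleftrightarrow> len v = len (cyc T) + len (iv (cyc T) \<circ> v)" using tT(3) r by linarith
      have s1: "(\<Sum>p | p \<in> {1..N} \<and> on T p. jump (\<lambda>x. \<chi> (iv (iv (cyc T) \<circ> v) x)) (p, nxt T p)) = 1"
        unfolding jump_def fst_conv snd_conv by (rule sum_arcs[OF tT(1) level_one_comp[OF \<chi> P_inv[OF yP]]])
      show "(\<Sum>p | p \<in> {1..N} \<and> on T p. G (cyc T) (p, nxt T p)) = left_op (cyc T) F v"
      proof (cases "len v = len (cyc T) + len (iv (cyc T) \<circ> v)")
        case True
        then show ?thesis unfolding G_def left_op_def c using v s1 by (simp add: sum_distrib_right[symmetric])
      next
        case False
        then show ?thesis unfolding G_def left_op_def c by simp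
      qed
    qed
    finally show ?thesis unfolding U_def by simp
  qed
  have "(\<Sum>T\<in>supports r. \<Sum>t\<in>B T. (if len (v \<circ> rf t) = len v + 1 then jump \<chi> t else 0) * F (y T t))
    = (\<Sum>T\<in>supports r. \<Sum>t\<in>B T. (if len (q T) + 1 = len (y T t) then jump \<chi> t else 0) * F (y T t)
       + (if len (cyc T \<circ> rf (conj_pair (q T) t)) + 1 = len (cyc T)
      then jump (\<lambda>x. \<chi> (iv (y T t) x)) (conj_pair (q T) t) else 0) * F (y T t))"
  proof (intro sum.cong HOL.refl)
    fix T t assume T: "T \<in> supports r" and t: "t \<in> B T"
    have t': "t \<in> refl_pairs" "len v + 1 = len (cyc T) + len (iv (cyc T) \<circ> v \<circ> rf t)"
      using t supports_D(3)[OF T] by (auto simp: B_def q_def)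
    show "(if len (v \<circ> rf t) = len v + 1 then jump \<chi> t else 0) * F (y T t)
     = (if len (q T) + 1 = len (y T t) then jump \<chi> t else 0) * F (y T t)
       + (if len (cyc T \<circ> rf (conj_pair (q T) t)) + 1 = len (cyc T)
      then jump (\<lambda>x. \<chi> (iv (y T t) x)) (conj_pair (q T) t) else 0) * F (y T t)"
      using leibniz_local[OF supports_D(2)[OF T] v t'(1) t'(2) \<chi>] unfolding q_def y_def by (simp only: distrib_right)
  qed
  then show ?thesis unfolding L M R by (simp only: sum.distrib)
qed

lemma supported_chevalley_op: "supported (chevalley_op \<chi> F)" by (simp add: supported_def chevalley_op_def)

lemma chevalley_op_delta: "chevalley_op \<chi> delta_id = (\<lambda>v. 0)"
proof
  fix v
  have "delta_id (v \<circ> rf t) = 0" if "t \<in> covers v" for t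
  proof -
    have "len (v \<circ> rf t) \<noteq> 0" using that by (simp add: covers_def)
    then have "v \<circ> rf t \<noteq> id" using len_id by metis
    then show ?thesis by (simp only: delta_id_def if_False)
  qed
  then show "chevalley_op \<chi> delta_id v = 0" unfolding chevalley_op_def by simp
qed

lemma chevalley_op_num_fact:
  assumes "\<forall>a\<in>set as. a < n" "level_one \<chi>"
  shows "chevalley_op \<chi> (num_fact as) = (\<lambda>v. \<Sum>i<length as. if as ! i = 0 then 0 else num_fact (as[i := as ! i - 1]) v)"
  using assms(1)
proof (induction as)
  case Nil
  then show ?case by (simp add: chevalley_op_delta)
next
  case (Cons a as)
  let ?S = "\<lambda>v. \<Sum>i<length as. if as ! i = 0 then 0 else num_fact (as[i := as ! i - 1]) v"
  have IH: "chevalley_op \<chi> (num_fact as) = ?S" using Cons by simp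
  have US: "U a ?S v = (\<Sum>i<length as. if as ! i = 0 then 0 else num_fact (a # as[i := as ! i - 1]) v)" for v
  proof -
    have "U a ?S = (\<lambda>v. \<Sum>i<length as. U a (\<lambda>v. if as ! i = 0 then 0 else num_fact (as[i := as ! i - 1]) v) v)"
      by (rule linear_op_sum[OF linear_op_U])
    moreover have "U a (\<lambda>v. if as ! i = 0 then 0 else num_fact (as[i := as ! i - 1]) v) v = (if as ! i = 0 then 0 else num_fact (a # as[i := as ! i - 1]) v)" for i v
      using U_zero[of a] by (cases "as ! i = 0") simp_all
    ultimately show ?thesis by simp
  qed
  have shift: "(\<Sum>i<length (a # as). if (a # as) ! i = 0 then 0 else num_fact ((a # as)[i := (a # as) ! i - 1]) v)
     = (if a = 0 then 0 else num_fact ((a - 1) # as) v) + (\<Sum>i<length as. if as ! i = 0 then 0 else num_fact (a # as[i := as ! i - 1]) v)" for v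
    by (simp only: length_Cons sum.lessThan_Suc_shift nth_Cons_0 nth_Cons_Suc list_update.simps nat.case)
  show ?case
  proof
    fix v
    show "chevalley_op \<chi> (num_fact (a # as)) v = (\<Sum>i<length (a # as). if (a # as) ! i = 0 then 0 else num_fact ((a # as)[i := (a # as) ! i - 1]) v)"
    proof (cases "a = 0")
      case True
      have "chevalley_op \<chi> (num_fact (a # as)) v = chevalley_op \<chi> (num_fact as) v" using True U_0[OF supported_num_fact] by simp
      also have "\<dots> = U a (chevalley_op \<chi> (num_fact as)) v" using True U_0[OF supported_chevalley_op] by simp
      also have "\<dots> = U a ?S v" unfolding IH ..
      finally show ?thesis unfolding shift US using True by simp
    next
      case False
      show ?thesis
      proof (cases "v \<in> P")
        case vP: True
        have "chevalley_op \<chi> (num_fact (a # as)) v = U a (chevalley_op \<chi> (num_fact as)) v + U (a - 1) (num_fact as) v"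
          unfolding num_fact.simps using False Cons.prems by (intro chevalley_op_U[OF vP _ _ assms(2)]) auto
        then show ?thesis unfolding shift IH US using False by simp
      next
        case vP: False
        have "num_fact bs v = 0" for bs using supported_num_fact vP by (simp add: supported_def)
        then show ?thesis using vP unfolding chevalley_op_def shift by (simp del: num_fact.simps cong: if_cong)
      qed
    qed
  qed
qed

section \<open>Translations\<close>

lemma card_window: assumes "T \<subseteq> {0..<N}" shows "card {x \<in> {a..<a + N}. on T x} = card T"
proof (rule bij_betw_same_card)
  show "bij_betw (\<lambda>x. x mod N) {x \<in> {a..<a + N}. on T x} T"
  proof (rule bij_betw_imageI)
    show "inj_on (\<lambda>x. x mod N) {x \<in> {a..<a + N}. on T x}"
    proof (rule inj_onI)
      fix x y assume x: "x \<in> {x \<in> {a..<a + N}. on T x}" and y: "y \<in> {x \<in> {a..<a + N}. on T x}" and e: "x mod N = y mod N"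
      from e obtain q where q: "x = y + q * N" by (rule mod_eqE)
      have "1 \<le> y - a + 1" "y - a + 1 \<le> N" "1 \<le> y - a + 1 + q * N" "y - a + 1 + q * N \<le> N" using x y q by auto
      then have "q = 0" by (rule rep_shift_zero)
      then show "x = y" using q by simp
    qed
    show "(\<lambda>x. x mod N) ` {x \<in> {a..<a + N}. on T x} = T"
    proof (intro subset_antisym subsetI)
      fix t assume t: "t \<in> T"
      then have t0: "0 \<le> t" "t < N" using assms by auto
      define x where "x = a + (t - a) mod N"
      have "x mod N = t" unfolding x_def using t0 by (simp add: mod_simps)
      moreover have "a \<le> x" "x < a + N" using N_pos by (auto simp: x_def)
      ultimately show "t \<in> (\<lambda>x. x mod N) ` {x \<in> {a..<a + N}. on T x}" using t by (intro image_eqI[of _ _ x]) auto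
    qed auto
  qed
qed

definition gcyc :: "int set \<Rightarrow> int \<Rightarrow> int" where "gcyc T x = (if on T x then nxt T x else x)"

lemma gcyc_cyc: "gcyc T x = cyc T x + 1" by (simp add: gcyc_def cyc_def)

lemma gcyc_full_turn:
  assumes T: "is_support T" and x: "on T x" shows "(gcyc T ^^ card T) x = x + N"
proof -
  have it: "on T ((gcyc T ^^ j) x) \<and> x \<le> (gcyc T ^^ j) x \<and> card {z \<in> {x..<(gcyc T ^^ j) x}. on T z} = j" for j
  proof (induction j)
    case 0
    then show ?case using x by simp
  next
    case (Suc j)
    define y where "y = (gcyc T ^^ j) x"
    have y: "on T y" "x \<le> y" "card {z \<in> {x..<y}. on T z} = j" using Suc by (auto simp: y_def)
    have y': "(gcyc T ^^ Suc j) x = nxt T y" using y(1) by (simp add: y_def gcyc_def)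
    have e: "{z \<in> {x..<nxt T y}. on T z} = insert y {z \<in> {x..<y}. on T z}"
    proof (intro subset_antisym subsetI)
      fix z assume z: "z \<in> {z \<in> {x..<nxt T y}. on T z}"
      then have "\<not> y < z" using nxt_between[of y z T] by auto
      then show "z \<in> insert y {z \<in> {x..<y}. on T z}" using z by auto
    next
      fix z assume "z \<in> insert y {z \<in> {x..<y}. on T z}"
      then show "z \<in> {z \<in> {x..<nxt T y}. on T z}" using y nxt_gt[of y T] by auto
    qed
    have fin: "finite {z \<in> {x..<y}. on T z}" by (rule finite_subset[of _ "{x..<y}"]) auto
    have "card {z \<in> {x..<nxt T y}. on T z} = Suc j" unfolding e using fin y(3) by simp
    then show ?case unfolding y' using nxt_on[OF T, of y] y(2) nxt_gt[of y T] by simp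
  qed
  define x' where "x' = (gcyc T ^^ card T) x"
  have x': "on T x'" "x \<le> x'" "card {z \<in> {x..<x'}. on T z} = card T" using it[of "card T"] by (auto simp: x'_def)
  have w: "card {z \<in> {x..<x + N}. on T z} = card T" using card_window[of T x] T by (simp add: is_support_def)
  have fin: "finite {z \<in> {x..<y}. on T z}" for y by (rule finite_subset[of _ "{x..<y}"]) auto
  have xN: "on T (x + N)" using x by simp
  have "\<not> x' < x + N"
  proof
    assume "x' < x + N"
    then have "{z \<in> {x..<x'}. on T z} \<subseteq> {z \<in> {x..<x + N}. on T z}" "x' \<in> {z \<in> {x..<x + N}. on T z}"
      "x' \<notin> {z \<in> {x..<x'}. on T z}" using x' by auto
    then have "{z \<in> {x..<x'}. on T z} \<subset> {z \<in> {x..<x + N}. on T z}" by blast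
    from psubset_card_mono[OF fin this] show False using x'(3) w by (simp only: less_irrefl)
  qed
  moreover have "\<not> x + N < x'"
  proof
    assume "x + N < x'"
    then have "{z \<in> {x..<x + N}. on T z} \<subseteq> {z \<in> {x..<x'}. on T z}" "x + N \<in> {z \<in> {x..<x'}. on T z}"
      "x + N \<notin> {z \<in> {x..<x + N}. on T z}" using xN N_pos by auto
    then have "{z \<in> {x..<x + N}. on T z} \<subset> {z \<in> {x..<x'}. on T z}" by blast
    from psubset_card_mono[OF fin this] show False using x'(3) w by (simp only: less_irrefl)
  qed
  ultimately show ?thesis by (simp add: x'_def)
qed

lemma cyc_conj:
  assumes S: "is_support S" shows "\<exists>T. is_support T \<and> card T = card S \<and> cyc T = tau_pow (- j) \<circ> cyc S \<circ> tau_pow j"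
proof -
  define T where "T = (\<lambda>t. (t - j) mod N) ` S"
  have onT: "on T x \<longleftrightarrow> on S (x + j)" for x
  proof
    assume "on T x"
    then obtain t where t: "t \<in> S" "x mod N = (t - j) mod N" by (auto simp: T_def)
    then have "(x + j) mod N = (t - j + j) mod N" by (intro mod_add_cong) auto
    then have "(x + j) mod N = t" using t(1) S by (auto simp: is_support_def)
    then show "on S (x + j)" using t(1) by simp
  next
    assume "on S (x + j)"
    moreover have "((x + j) mod N - j) mod N = x mod N" by (simp add: mod_simps)
    ultimately show "on T x" unfolding T_def by (metis image_eqI)
  qed
  have T: "is_support T" using S N_pos by (auto simp: T_def is_support_def)
  have "inj_on (\<lambda>t. (t - j) mod N) S"
  proof (rule inj_onI)
    fix s t assume st: "s \<in> S" "t \<in> S" "(s - j) mod N = (t - j) mod N"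
    then have "(s - j + j) mod N = (t - j + j) mod N" by (intro mod_add_cong) auto
    then show "s = t" using st(1,2) S by (auto simp: is_support_def subset_iff)
  qed
  then have "card T = card S" unfolding T_def by (rule card_image)
  moreover have "cyc T = tau_pow (- j) \<circ> cyc S \<circ> tau_pow j"
  proof
    fix x
    have "nxt T x = nxt S (x + j) - j"
    proof (rule nxt_eqI)
      show "x < nxt S (x + j) - j" using nxt_gt[of "x + j" S] by simp
      show "on T (nxt S (x + j) - j)" unfolding onT using nxt_on[OF S, of "x + j"] by simp
      fix y assume "x < y" "y < nxt S (x + j) - j"
      then show "\<not> on T y" unfolding onT using nxt_between[of "x + j" "y + j" S] by simp
    qed
    then show "cyc T x = (tau_pow (- j) \<circ> cyc S \<circ> tau_pow j) x" by (simp add: cyc_def onT tau_pow_def)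
  qed
  ultimately show ?thesis using T by blast
qed

lemma num_fact_nonneg: "num_fact as w \<ge> 0"
proof (cases "w \<in> P")
  case True
  then show ?thesis using card_fact_lists[of w as] by (metis of_nat_0_le_iff)
next
  case False
  then show ?thesis using supported_num_fact[of as] by (simp add: supported_def)
qed

lemma num_fact_Cons_ge:
  assumes T: "T \<in> supports a" and y: "y \<in> P" and add: "len (cyc T \<circ> y) = a + len y"
  shows "num_fact (a # as) (cyc T \<circ> y) \<ge> num_fact as y"
proof -
  let ?w = "cyc T \<circ> y"
  have yw: "iv (cyc T) \<circ> ?w = y" unfolding o_assoc inv_P_comp(1)[OF supports_D(2)[OF T]] by (rule id_comp)
  have nn: "left_op (cyc T') (num_fact as) ?w \<ge> 0" for T' using num_fact_nonneg by (simp add: left_op_def)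
  have "num_fact as y = left_op (cyc T) (num_fact as) ?w"
    unfolding left_op_def yw using P_comp[OF supports_D(2)[OF T] y] add supports_D(3)[OF T] by simp
  also have "\<dots> \<le> U a (num_fact as) ?w" unfolding U_def
    by (rule member_le_sum[OF T]) (use nn finite_supports in auto)
  finally show ?thesis by simp
qed

definition transl :: "nat \<Rightarrow> (int \<Rightarrow> int) \<Rightarrow> bool" where
  "transl k w \<longleftrightarrow> (\<forall>x. w x = x - int k \<or> w x = x + int (n - k))"

context
  fixes k :: nat and w :: "int \<Rightarrow> int" and S :: "int set"
  assumes k: "k \<le> n" and w: "w \<in> P" "displ w = 0" and tr: "transl k w"
  defines "S \<equiv> {t \<in> {0..<N}. w t = t + int (n - k)}"
begin

lemma transl_on: "w x = (if on S x then x + int (n - k) else x - int k)"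
proof -
  have "w x - x = w (x mod N) - x mod N"
    using P_shift_mult[OF w(1), of "x mod N" "x div N"] by (simp add: algebra_simps)
  then have "on S x \<longleftrightarrow> w x = x + int (n - k)" using N_pos unfolding S_def by auto
  then show ?thesis using tr[unfolded transl_def, rule_format, of x] by auto
qed

lemma transl_card: "card S = k"
proof -
  have "displ w = (\<Sum>i\<in>{1..N}. (if on S i then N else 0) - int k)"
    unfolding displ_def by (intro sum.cong) (use k in \<open>auto simp: transl_on of_nat_diff\<close>)
  also have "\<dots> = N * int (card {i \<in> {1..N}. on S i}) - N * int k"
    by (simp add: sum_subtractf sum.If_cases Int_def mult.commute)
  also have "card {i \<in> {1..N}. on S i} = card S" by (rule card_residues) (auto simp: S_def)
  finally have "N * int (card S) = N * int k" using w(2) by simp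
  then show ?thesis using N_pos by simp
qed

lemma transl_len: "len w = k * (n - k)"
proof -
  let ?J = "\<lambda>i. {j \<in> {i..<i + N}. \<not> on S j}"
  have sub: "S \<subseteq> {0..<N}" by (auto simp: S_def)
  have "reps (Inv w) = Sigma {i \<in> {1..N}. on S i} ?J"
  proof (intro subset_antisym subsetI)
    fix p assume p: "p \<in> reps (Inv w)"
    obtain i j where ij: "p = (i, j)" by (cases p)
    have "1 \<le> i" "i \<le> N" "i < j" "w i > w j" using p ij by (auto simp: reps_def Inv_def)
    moreover from this have "on S i \<and> \<not> on S j \<and> j < i + N"
      unfolding transl_on[of i] transl_on[of j] using k by (auto split: if_splits simp: of_nat_diff)
    ultimately show "p \<in> Sigma {i \<in> {1..N}. on S i} ?J" using ij by auto
  next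
    fix p assume p: "p \<in> Sigma {i \<in> {1..N}. on S i} ?J"
    obtain i j where ij: "p = (i, j)" by (cases p)
    have i: "1 \<le> i" "i \<le> N" "on S i" "\<not> on S j" "i \<le> j" "j < i + N" using p ij by auto
    then have "i \<noteq> j" by auto
    then show "p \<in> reps (Inv w)" using i ij k by (simp add: reps_def Inv_def transl_on of_nat_diff)
  qed
  then have "len w = card (Sigma {i \<in> {1..N}. on S i} ?J)" unfolding len_pair_count pair_count_def by simp
  also have "\<dots> = (\<Sum>i\<in>{i \<in> {1..N}. on S i}. card (?J i))"
    by (rule card_SigmaI) (auto intro: finite_subset[of _ "{1..N}"] finite_subset[of _ "{_..<_ + N}"])
  also have "\<dots> = (\<Sum>i\<in>{i \<in> {1..N}. on S i}. n - k)"
  proof (rule sum.cong[OF HOL.refl])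
    fix i
    have e: "?J i = {i..<i + N} - {x \<in> {i..<i + N}. on S x}" by auto
    have "card (?J i) = card {i..<i + N} - card {x \<in> {i..<i + N}. on S x}" unfolding e
      by (rule card_Diff_subset[OF finite_subset[of _ "{i..<i + N}"]]) auto
    then show "card (?J i) = n - k" using card_window[OF sub, of i] transl_card by simp
  qed
  also have "\<dots> = k * (n - k)" using card_residues[OF sub] transl_card by simp
  finally show ?thesis .
qed

lemma transl_first_le:
  assumes "num_fact (a # as) w \<noteq> 0" shows "a \<le> n - k"
proof -
  obtain T where T: "T \<in> supports a" "left_op (cyc T) (num_fact as) w \<noteq> 0"
    using assms unfolding num_fact.simps U_def by (meson sum.neutral)
  note tT = supports_D[OF T(1)]
  define y where "y = iv (cyc T) \<circ> w"
  have yP: "y \<in> P" unfolding y_def using P_comp[OF P_inv[OF tT(2)] w(1)] .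
  have cy: "cyc T \<circ> y = w" unfolding y_def o_assoc inv_P_comp(2)[OF tT(2)] by (rule id_comp)
  have "len w = len (cyc T) + len y"
  proof (rule ccontr)
    assume "len w \<noteq> len (cyc T) + len y"
    then have "left_op (cyc T) (num_fact as) w = 0" unfolding y_def left_op_def by (simp only: simp_thms if_False)
    then show False using T(2) by (simp only:)
  qed
  then have add: "len (cyc T \<circ> y) = len (cyc T) + len y" unfolding cy .
  have *: "\<not> on S (b - 1 + int k)" if b: "\<not> on T b" for b
  proof -
    obtain p where p: "on T p" "p \<le> b" "b < nxt T p" using prev_ex[OF tT(1)] by blast
    have pb: "p < b" using p b by (cases "p = b") auto
    have cc: "cyc T p > cyc T b" using p b by (simp add: cyc_def)
    define i where "i = iv y p"
    define j where "j = iv y b"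
    have yi: "y i = p" "y j = b" using yP by (simp_all add: i_def j_def)
    have wi: "w i = cyc T p" "w j = cyc T b" using cy yi by (metis comp_apply)+
    have "i < j"
    proof (rule ccontr)
      assume "\<not> i < j"
      then have "j < i" using yi pb by (cases "i = j") auto
      then show False using additiveD[OF tT(2) yP add, of j i] yi pb cc by simp
    qed
    then have "\<not> on S j" using wi cc k unfolding transl_on[of i] transl_on[of j] by (auto split: if_splits simp: of_nat_diff)
    moreover from this have "j = b - 1 + int k" using wi(2) b unfolding transl_on[of j] by (simp add: cyc_def)
    ultimately show ?thesis by simp
  qed
  let ?A = "{b \<in> {1..<1 + N}. \<not> on T b}" and ?B = "{x \<in> {int k..<int k + N}. \<not> on S x}"
  have co: "card {x \<in> {a..<a + N}. \<not> on R x} = n - card R" if "R \<subseteq> {0..<N}" for R a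
  proof -
    have e: "{x \<in> {a..<a + N}. \<not> on R x} = {a..<a + N} - {x \<in> {a..<a + N}. on R x}" by auto
    have "card {x \<in> {a..<a + N}. \<not> on R x} = card {a..<a + N} - card {x \<in> {a..<a + N}. on R x}" unfolding e
      by (rule card_Diff_subset[OF finite_subset[of _ "{a..<a + N}"]]) auto
    then show ?thesis using card_window[OF that, of a] by simp
  qed
  have "inj_on (\<lambda>b. b - 1 + int k) ?A" by (simp add: inj_on_def)
  moreover have "(\<lambda>b. b - 1 + int k) ` ?A \<subseteq> ?B" using * by auto
  moreover have "finite ?B" by (rule finite_subset[of _ "{int k..<int k + N}"]) auto
  ultimately have "card ?A \<le> card ?B" by (rule card_inj_on_le)
  moreover have "card ?A = n - card T" using co[of T 1] tT(1) by (simp add: is_support_def)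
  moreover have "card ?B = n - k"
  proof -
    have "S \<subseteq> {0..<N}" by (auto simp: S_def)
    from co[OF this, of "int k"] show ?thesis using transl_card by simp
  qed
  ultimately show ?thesis using tT(4,5) by linarith
qed

lemma transl_num_fact_pos: "num_fact (replicate k (n - k)) w > 0"
proof (cases "k = 0")
  case True
  have "finite S" by (rule finite_subset[of _ "{0..<N}"]) (auto simp: S_def)
  then have "S = {}" using transl_card True card_eq_0_iff[of S] by simp
  then have "w x = x" for x using transl_on[of x] True by simp
  then have "w = id" by (simp add: fun_eq_iff)
  then show ?thesis using True by (simp add: delta_id_def)
next
  case False
  have "S \<noteq> {}" using False transl_card by auto
  moreover have "S \<subseteq> {0..<N}" by (auto simp: S_def)
  ultimately have S: "is_support S" by (simp add: is_support_def)
  define wj where "wj j = tau_pow (- int j) \<circ> (gcyc S ^^ j)" for j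
  have step: "\<exists>T. T \<in> supports (n - k) \<and> wj (Suc j) = cyc T \<circ> wj j" for j
  proof -
    obtain T where T: "is_support T" "card T = card S" "cyc T = tau_pow (- int j) \<circ> cyc S \<circ> tau_pow (int j)"
      using cyc_conj[OF S] by blast
    have "T \<in> supports (n - k)" using T transl_card k by (simp add: supports_def)
    moreover have "wj (Suc j) = cyc T \<circ> wj j"
      by (rule ext) (simp add: wj_def T(3) tau_pow_def gcyc_cyc)
    ultimately show ?thesis by blast
  qed
  have wP: "wj j \<in> P" for j
  proof (induction j)
    case 0
    have "wj 0 = id" by (simp add: wj_def fun_eq_iff tau_pow_def)
    then show ?case using P_id by (simp only:)
  next
    case (Suc j)
    obtain T where "T \<in> supports (n - k)" "wj (Suc j) = cyc T \<circ> wj j" using step by blast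
    then show ?case using P_comp[OF supports_D(2) Suc] by (simp only:)
  qed
  have up: "len (wj (Suc j)) \<le> (n - k) + len (wj j)" for j
  proof -
    obtain T where T: "T \<in> supports (n - k)" "wj (Suc j) = cyc T \<circ> wj j" using step by blast
    show ?thesis using len_mult_le[OF supports_D(2)[OF T(1)] wP[of j]] supports_D(3)[OF T(1)] T(2) by (simp only:)
  qed
  have w0: "wj 0 = id" by (simp add: wj_def fun_eq_iff tau_pow_def)
  have ub: "len (wj j) \<le> j * (n - k)" for j
  proof (induction j)
    case (Suc j)
    then show ?case using up[of j] by simp
  qed (simp only: w0 len_id)
  have lb: "len (wj (j + d)) \<le> len (wj j) + d * (n - k)" for j d
  proof (induction d)
    case (Suc d)
    then show ?case using up[of "j + d"] by simp
  qed simp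
  have wk: "wj k = w"
  proof
    fix x
    show "wj k x = w x"
    proof (cases "on S x")
      case True
      then show ?thesis using gcyc_full_turn[OF S True] transl_card transl_on[of x] k by (simp add: wj_def tau_pow_def of_nat_diff)
    next
      case False
      have "(gcyc S ^^ j) x = x" for j by (induction j) (simp_all add: gcyc_def False)
      then show ?thesis using False transl_on[of x] by (simp add: wj_def tau_pow_def)
    qed
  qed
  have len: "len (wj j) = j * (n - k)" if "j \<le> k" for j
  proof -
    have "k * (n - k) \<le> len (wj j) + (k - j) * (n - k)" using lb[of j "k - j"] that wk transl_len by simp
    moreover have "k * (n - k) = j * (n - k) + (k - j) * (n - k)" using that by (metis distrib_right le_add_diff_inverse)
    ultimately show ?thesis using ub[of j] by linarith
  qed
  have "num_fact (replicate j (n - k)) (wj j) > 0" if "j \<le> k" for j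
    using that
  proof (induction j)
    case 0
    show ?case unfolding w0 replicate_0 num_fact.simps delta_id_def by (simp only: HOL.simp_thms if_True zero_less_one)
  next
    case (Suc j)
    obtain T where T: "T \<in> supports (n - k)" "wj (Suc j) = cyc T \<circ> wj j" using step by blast
    have "len (cyc T \<circ> wj j) = (n - k) + len (wj j)"
      unfolding T(2)[symmetric] using len[of j] len[of "Suc j"] Suc.prems by simp
    then have "num_fact (replicate j (n - k)) (wj j) \<le> num_fact ((n - k) # replicate j (n - k)) (cyc T \<circ> wj j)"
      by (rule num_fact_Cons_ge[OF T(1) wP])
    then show ?case using Suc.IH Suc_leD[OF Suc.prems] unfolding T(2) replicate_Suc by (meson less_le_trans)
  qed
  then show ?thesis using wk by blast
qed

end

section \<open>Nonvanishing\<close>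

lemma lookup_stanley_poly0:
  assumes "w \<in> P" "displ w = 0"
  shows "lkp (affine_stanley_poly n k w) \<alpha> = (if Poly_Mapping.keys \<alpha> \<subseteq> {..<k} then num_fact (map (lkp \<alpha>) [0..<k]) w else 0)"
proof -
  have "av n w = 0" using av_eqI[OF assms(1), of 0] assms(2) by simp
  then have "tau_pow (- av n w) \<circ> w = w" by (simp add: tau_pow_def fun_eq_iff)
  then show ?thesis using lookup_stanley_poly[OF assms(1), of k \<alpha>] by (simp only:)
qed

definition e1 :: "nat \<Rightarrow> int_mpoly" where "e1 k = (\<Sum>i<k. var i)"

lemma lookup_e1_mult:
  "lkp (e1 k * p) \<alpha> = (\<Sum>i<k. if lkp \<alpha> i = 0 then 0 else lkp p (\<alpha> - Poly_Mapping.single i 1))"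
proof -
  have "(\<forall>j. lkp (Poly_Mapping.single i 1) j \<le> lkp \<alpha> j) \<longleftrightarrow> lkp \<alpha> i \<noteq> 0" for i
    by (auto simp: lookup_single when_def)
  then show ?thesis
    by (simp add: e1_def sum_distrib_right lookup_sum var_def lookup_monom_mult if_distrib cong: if_cong)
       (intro sum.cong HOL.refl, auto)
qed

lemma chevalley_overflow:
  assumes v: "v \<in> P" "displ v = 0" and \<chi>: "level_one \<chi>"
  shows "overflow n (e1 k * affine_stanley_poly n k v
     - (\<Sum>t\<in>covers v. Poly_Mapping.single 0 (jump \<chi> t) * affine_stanley_poly n k (v \<circ> rf t)))"
  unfolding overflow_def
proof (intro allI impI)
  fix \<alpha> :: "nat \<Rightarrow>\<^sub>0 nat" assume \<alpha>: "\<forall>i. lkp \<alpha> i < n"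
  let ?p = "\<lambda>v. affine_stanley_poly n k v"
  have keys_iff: "Poly_Mapping.keys \<beta> \<subseteq> {..<k} \<longleftrightarrow> (\<forall>i\<ge>k. lkp \<beta> i = 0)" for \<beta> :: "nat \<Rightarrow>\<^sub>0 nat"
    unfolding subset_iff in_keys_iff lessThan_iff by (meson not_le)
  have vt: "v \<circ> rf t \<in> P" "displ (v \<circ> rf t) = 0" if "t \<in> covers v" for t
  proof -
    have t: "t \<in> refl_pairs" using that by (simp add: covers_def)
    show "v \<circ> rf t \<in> P" using P_comp[OF v(1) refl_pairs_D(3)[OF t]] .
    show "displ (v \<circ> rf t) = 0" using displ_comp[OF v(1) refl_pairs_D(3)[OF t]] displ_refl[OF refl_pairs_D(2)[OF t]] v(2) by simp
  qed
  have c: "lkp (Poly_Mapping.single 0 c * p) \<alpha> = c * lkp p \<alpha>" for c and p :: int_mpoly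
    using lookup_single_mult(1)[of 0 c p \<alpha>] by simp
  have "lkp (e1 k * ?p v) \<alpha> = (\<Sum>t\<in>covers v. jump \<chi> t * lkp (?p (v \<circ> rf t)) \<alpha>)"
  proof (cases "Poly_Mapping.keys \<alpha> \<subseteq> {..<k}")
    case True
    let ?as = "map (lkp \<alpha>) [0..<k]"
    have "(\<Sum>t\<in>covers v. jump \<chi> t * lkp (?p (v \<circ> rf t)) \<alpha>) = (\<Sum>t\<in>covers v. jump \<chi> t * num_fact ?as (v \<circ> rf t))"
      using True by (intro sum.cong HOL.refl) (simp only: lookup_stanley_poly0[OF vt] if_True)
    also have "\<dots> = chevalley_op \<chi> (num_fact ?as) v" using v(1) by (simp add: chevalley_op_def)
    also have "\<dots> = (\<Sum>i<length ?as. if ?as ! i = 0 then 0 else num_fact (?as[i := ?as ! i - 1]) v)"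
      by (subst chevalley_op_num_fact[OF _ \<chi>]) (use \<alpha> in auto)
    also have "\<dots> = (\<Sum>i<k. if lkp \<alpha> i = 0 then 0 else lkp (?p v) (\<alpha> - Poly_Mapping.single i 1))"
    proof (intro sum.cong)
      fix i assume "i \<in> {..<k}"
      then have i: "i < k" by simp
      have "Poly_Mapping.keys (\<alpha> - Poly_Mapping.single i 1) \<subseteq> {..<k}"
        using True unfolding keys_iff by (simp add: lookup_minus)
      moreover have "map (lkp (\<alpha> - Poly_Mapping.single i 1)) [0..<k] = ?as[i := ?as ! i - 1]"
        using i by (intro nth_equalityI) (auto simp: lookup_minus lookup_single when_def nth_list_update)
      ultimately have "lkp (?p v) (\<alpha> - Poly_Mapping.single i 1) = num_fact (?as[i := ?as ! i - 1]) v"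
        by (simp only: lookup_stanley_poly0[OF v] if_True)
      then show "(if ?as ! i = 0 then 0 else num_fact (?as[i := ?as ! i - 1]) v)
        = (if lkp \<alpha> i = 0 then 0 else lkp (?p v) (\<alpha> - Poly_Mapping.single i 1))" using i by simp
    qed simp
    also have "\<dots> = lkp (e1 k * ?p v) \<alpha>" by (rule lookup_e1_mult[symmetric])
    finally show ?thesis by simp
  next
    case False
    then obtain j where j: "j \<ge> k" "lkp \<alpha> j \<noteq> 0" unfolding keys_iff by blast
    have "lkp (?p v) (\<alpha> - Poly_Mapping.single i 1) = 0" if "i < k" for i
    proof -
      have "lkp (\<alpha> - Poly_Mapping.single i 1) j = lkp \<alpha> j" using j that by (simp add: lookup_minus lookup_single)
      then have "j \<in> Poly_Mapping.keys (\<alpha> - Poly_Mapping.single i 1)" using j(2) by (simp only: in_keys_iff not_False_eq_True)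
      then have "\<not> Poly_Mapping.keys (\<alpha> - Poly_Mapping.single i 1) \<subseteq> {..<k}" using j(1) by force
      then show ?thesis by (simp only: lookup_stanley_poly0[OF v] if_False)
    qed
    then have "lkp (e1 k * ?p v) \<alpha> = 0" unfolding lookup_e1_mult by (intro sum.neutral) auto
    moreover have "(\<Sum>t\<in>covers v. jump \<chi> t * lkp (?p (v \<circ> rf t)) \<alpha>) = 0"
      using False by (intro sum.neutral ballI) (simp only: lookup_stanley_poly0[OF vt] if_False mult_zero_right)
    ultimately show ?thesis by simp
  qed
  then show "lkp (e1 k * ?p v - (\<Sum>t\<in>covers v. Poly_Mapping.single 0 (jump \<chi> t) * ?p (v \<circ> rf t))) \<alpha> = 0"
    by (simp add: lookup_minus lookup_sum c)
qed

definition window_bounded :: "nat \<Rightarrow> (int \<Rightarrow> int) \<Rightarrow> bool" where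
  "window_bounded k w \<longleftrightarrow> (\<forall>x. x - int k \<le> w x \<and> w x \<le> x + int (n - k))"

text \<open>The coefficient of the rectangular Schur polynomial in \<open>e1 ^ m\<close> times the affine Stanley polynomial.\<close>

definition rect_coeff :: "nat \<Rightarrow> nat \<Rightarrow> (int \<Rightarrow> int) \<Rightarrow> int" where
  "rect_coeff k m w = lkp (e1 k ^ m * (affine_stanley_poly n k w * alternant k id)) (expv k (\<lambda>i. n - k + i))"

lemma overflow_top: assumes "k \<le> n" "overflow n p" shows "lkp p (expv k (\<lambda>i. n - k + i)) = 0"
proof -
  have "\<forall>i. lkp (expv k (\<lambda>i. n - k + i)) i < n" using assms(1) n_pos by (auto simp: lookup_expv)
  then show ?thesis using assms(2) by (simp add: overflow_def)
qed

lemma rect_coeff_overflow: "k \<le> n \<Longrightarrow> overflow n (affine_stanley_poly n k w * alternant k id) \<Longrightarrow> rect_coeff k m w = 0"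
  unfolding rect_coeff_def using overflow_top overflow_mult by blast

lemma rect_coeff_Suc:
  assumes k: "k \<le> n" and v: "v \<in> P" "displ v = 0" and \<chi>: "level_one \<chi>"
  shows "rect_coeff k (Suc m) v = (\<Sum>t\<in>covers v. jump \<chi> t * rect_coeff k m (v \<circ> rf t))"
proof -
  let ?p = "\<lambda>v. affine_stanley_poly n k v" and ?a = "alternant k id" and ?top = "expv k (\<lambda>i. n - k + i)"
  let ?c = "\<lambda>t. Poly_Mapping.single 0 (jump \<chi> t) :: int_mpoly"
  let ?X = "e1 k * ?p v - (\<Sum>t\<in>covers v. ?c t * ?p (v \<circ> rf t))"
  have c: "lkp (Poly_Mapping.single 0 c * p) \<alpha> = c * lkp p \<alpha>" for c and p :: int_mpoly and \<alpha>
    using lookup_single_mult(1)[of 0 c p \<alpha>] by simp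
  have "overflow n ((e1 k ^ m * ?a) * ?X)" by (rule overflow_mult[OF chevalley_overflow[OF v \<chi>]])
  then have "lkp ((e1 k ^ m * ?a) * ?X) ?top = 0" by (rule overflow_top[OF k])
  moreover have "(e1 k ^ m * ?a) * ?X = e1 k ^ Suc m * (?p v * ?a) - (\<Sum>t\<in>covers v. ?c t * (e1 k ^ m * (?p (v \<circ> rf t) * ?a)))"
  proof -
    have "(e1 k ^ m * ?a) * (\<Sum>t\<in>covers v. ?c t * ?p (v \<circ> rf t)) = (\<Sum>t\<in>covers v. ?c t * (e1 k ^ m * (?p (v \<circ> rf t) * ?a)))"
      unfolding sum_distrib_left by (intro sum.cong HOL.refl) (simp only: mult_ac)
    moreover have "(e1 k ^ m * ?a) * (e1 k * ?p v) = e1 k ^ Suc m * (?p v * ?a)" by (simp only: power_Suc mult_ac)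
    ultimately show ?thesis by (simp only: right_diff_distrib)
  qed
  ultimately show ?thesis unfolding rect_coeff_def by (simp only: lookup_minus lookup_sum c right_minus_eq)
qed

lemma rect_coeff_transl:
  assumes k: "k \<le> n" and w: "w \<in> P" "displ w = 0" and tr: "transl k w"
  shows "rect_coeff k 0 w > 0"
proof -
  let ?p = "affine_stanley_poly n k w" and ?top = "expv k (\<lambda>i. n - k + i)"
  have val: "lkp ?p (?top - expv k \<sigma>) = num_fact (map (\<lambda>i. n - k + i - \<sigma> i) [0..<k]) w" for \<sigma>
  proof -
    have "Poly_Mapping.keys (?top - expv k \<sigma>) \<subseteq> {..<k}"
      by (auto simp: in_keys_iff lookup_minus lookup_expv split: if_splits)
    moreover have "map (lkp (?top - expv k \<sigma>)) [0..<k] = map (\<lambda>i. n - k + i - \<sigma> i) [0..<k]"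
      by (simp add: lookup_minus lookup_expv)
    ultimately show ?thesis by (simp only: lookup_stanley_poly0[OF w] if_True)
  qed
  have zero: "lkp ?p (?top - expv k \<sigma>) = 0" if \<sigma>: "\<sigma> permutes {0..<k}" "\<sigma> \<noteq> id" "\<forall>i<k. \<sigma> i \<le> lkp ?top i" for \<sigma>
  proof (rule ccontr)
    assume nz: "lkp ?p (?top - expv k \<sigma>) \<noteq> 0"
    have "\<sigma> i \<ge> i" if i: "i < k" for i
    proof -
      let ?b = "\<lambda>i. n - k + i - \<sigma> i" and ?\<pi> = "Transposition.transpose 0 i"
      have \<pi>: "?\<pi> permutes {..<k}" by (rule permutes_swap_id) (use i in auto)
      have "num_fact (map (\<lambda>j. ?b (?\<pi> j)) [0..<k]) w \<noteq> 0" using nz num_fact_perm[OF \<pi>, of ?b] unfolding val by (simp only: not_False_eq_True)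
      moreover have "[0..<k] = 0 # [1..<k]" using i by (simp add: upt_rec)
      ultimately have "num_fact (?b i # map (\<lambda>j. ?b (?\<pi> j)) [1..<k]) w \<noteq> 0"
        by (simp only: list.map transpose_apply_first not_False_eq_True)
      then have "?b i \<le> n - k" by (rule transl_first_le[OF k w tr])
      moreover have "\<sigma> i \<le> n - k + i" using \<sigma>(3) i by (simp add: lookup_expv)
      ultimately show ?thesis by linarith
    qed
    then have "\<sigma> i \<ge> i" for i using permutes_not_in[OF \<sigma>(1), of i] by (cases "i < k") auto
    then have "\<sigma> = id" using permutes_natset_ge[of \<sigma> "{0..<k}"] \<sigma>(1) by blast
    then show False using \<sigma>(2) by simp
  qed
  have "rect_coeff k 0 w = (\<Sum>\<sigma> | \<sigma> permutes {0..<k}. if \<forall>i<k. \<sigma> i \<le> lkp ?top i then sign \<sigma> * lkp ?p (?top - expv k \<sigma>) else 0)"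
    unfolding rect_coeff_def by (simp only: power_0 mult_1 lookup_mult_alternant)
  also have "\<dots> = (\<Sum>\<sigma>\<in>{id}. if \<forall>i<k. \<sigma> i \<le> lkp ?top i then sign \<sigma> * lkp ?p (?top - expv k \<sigma>) else 0)"
  proof (rule sum.mono_neutral_right)
    show "finite {\<sigma>. \<sigma> permutes {0..<k}}" by (simp add: finite_permutations)
    show "{id} \<subseteq> {\<sigma>. \<sigma> permutes {0..<k}}" using permutes_id by blast
    show "\<forall>\<sigma>\<in>{\<sigma>. \<sigma> permutes {0..<k}} - {id}. (if \<forall>i<k. \<sigma> i \<le> lkp ?top i then sign \<sigma> * lkp ?p (?top - expv k \<sigma>) else 0) = 0"
      using zero by auto
  qed
  also have "\<dots> = lkp ?p (?top - expv k id)" by (simp add: lookup_expv sign_id)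
  also have "\<dots> = num_fact (map (\<lambda>i. n - k) [0..<k]) w" unfolding val by simp
  also have "map (\<lambda>i. n - k) [0..<k] = replicate k (n - k)" by (simp add: map_replicate_const)
  also have "num_fact \<dots> w > 0" by (rule transl_num_fact_pos[OF k w tr])
  finally show ?thesis .
qed

lemma bounded_cover:
  assumes k: "k \<le> n" and w: "w \<in> P" and b: "window_bounded k w" and nt: "\<not> transl k w"
  shows "\<exists>t\<in>covers w. window_bounded k (w \<circ> rf t)"
proof -
  define f where "f = tau_pow (int k) \<circ> w"
  have fP: "f \<in> P" unfolding f_def using P_comp[OF P_tau w] .
  have fx: "f x = w x + int k" for x by (simp add: f_def tau_pow_def)
  have fb: "x \<le> f x" "f x \<le> x + N" for x
    using b[unfolded window_bounded_def, rule_format, of x] k by (auto simp: fx of_nat_diff)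
  define valid where "valid a c \<longleftrightarrow> a < c \<and> f a < f c \<and> f c \<le> a + N \<and> c \<le> f a" for a c
  have ex: "\<exists>a c. valid a c"
  proof -
    obtain i where i: "w i \<noteq> i - int k" "w i \<noteq> i + int (n - k)" using nt unfolding transl_def by blast
    then have i': "f i \<noteq> i" "f i \<noteq> i + N" using k by (auto simp: fx of_nat_diff)
    define c where "c = f i"
    have ic: "i < c" "c < i + N" using fb[of i] i' by (auto simp: c_def)
    have fc: "f c \<noteq> f i" using P_inj[OF fP] ic by auto
    show ?thesis
    proof (cases "f c \<le> i + N")
      case True
      have "valid i c" unfolding valid_def using ic fb[of c] fc True by (auto simp: c_def)
      then show ?thesis by blast
    next
      case False
      have fi: "f (i + N) = c + N" using P_shift[OF fP, of i] by (simp add: c_def)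
      have "f c \<noteq> f (i + N)" using P_inj[OF fP] ic by auto
      then have "valid c (i + N)" unfolding valid_def fi using ic fb[of c] False fi by auto
      then show ?thesis by blast
    qed
  qed
  then obtain a0 c0 where v0: "valid a0 c0" by blast
  have "\<exists>d. \<exists>a. valid a (a + int d)" using v0 by (intro exI[of _ "nat (c0 - a0)"] exI[of _ a0]) (simp add: valid_def)
  then obtain d where d: "\<exists>a. valid a (a + int d)" and dmin: "\<And>e. e < d \<Longrightarrow> \<not> (\<exists>a. valid a (a + int e))"
    using exists_least_iff[of "\<lambda>d. \<exists>a. valid a (a + int d)"] by blast
  then obtain a where va: "valid a (a + int d)" by blast
  define c where "c = a + int d"
  have ac: "a < c" "f a < f c" "f c \<le> a + N" "c \<le> f a" using va by (auto simp: valid_def c_def)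
  have mne: "a mod N \<noteq> c mod N"
  proof
    assume "a mod N = c mod N"
    then have "c mod N = a mod N" by simp
    then obtain q where q: "c = a + q * N" by (rule mod_eqE)
    have "c < a + N" using ac by linarith
    then have "0 < q * N" "q * N < 1 * N" using q ac by auto
    then have "0 < q" "q < 1" using N_pos by (auto simp: zero_less_mult_iff)
    then show False by simp
  qed
  have nb: "\<not> (f a < f x \<and> f x < f c)" if x: "a < x" "x < c" for x
  proof
    assume fx: "f a < f x \<and> f x < f c"
    have "valid a x" unfolding valid_def using x fx ac by auto
    then have "valid a (a + int (nat (x - a)))" using x by simp
    moreover have "nat (x - a) < d" using x by (simp add: c_def)
    ultimately show False using dmin by blast
  qed
  have "len (f \<circ> refl a c) = len f + 1" by (rule len_cover[OF fP ac(1) mne ac(2) nb])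
  then have lw: "len (w \<circ> refl a c) = len w + 1" unfolding f_def o_assoc[symmetric] len_tau_left .
  define t where "t = norm_pair (a, c)"
  have t: "t \<in> refl_pairs" "rf t = refl a c" unfolding t_def using norm_pair_refl_pairs[of "(a, c)"] ac(1) mne by auto
  have "t \<in> covers w" using t lw by (simp add: covers_def)
  moreover have "window_bounded k (w \<circ> rf t)"
    unfolding window_bounded_def t(2)
  proof
    fix x
    have "x \<le> f (refl a c x) \<and> f (refl a c x) \<le> x + N"
    proof (cases "x mod N = a mod N")
      case True
      then obtain q where q: "x = a + q * N" by (rule mod_eqE)
      have "refl a c x = c + q * N" using q by (simp add: refl_def)
      then show ?thesis using q P_shift_mult[OF fP, of c q] ac by simp
    next
      case F: False
      show ?thesis
      proof (cases "x mod N = c mod N")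
        case True
        then obtain q where q: "x = c + q * N" by (rule mod_eqE)
        have "refl a c x = a + q * N" using q mne by (simp add: refl_def)
        then show ?thesis using q P_shift_mult[OF fP, of a q] ac by simp
      next
        case False
        then show ?thesis using F fb[of x] by (simp add: refl_def)
      qed
    qed
    then show "x - int k \<le> (w \<circ> refl a c) x \<and> (w \<circ> refl a c) x \<le> x + int (n - k)"
      using k by (auto simp: fx of_nat_diff)
  qed
  ultimately show ?thesis by blast
qed

lemma window_bounded_len: assumes "k \<le> n" "w \<in> P" "window_bounded k w" shows "len w \<le> n * n"
proof -
  have "reps (Inv w) \<subseteq> (\<lambda>(i, d). (i, i + d)) ` ({1..N} \<times> {1..N})"
  proof
    fix p assume p: "p \<in> reps (Inv w)"
    obtain i j where ij: "p = (i, j)" by (cases p)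
    have i: "1 \<le> i" "i \<le> N" "i < j" "w i > w j" using p ij by (auto simp: reps_def Inv_def)
    have "w i \<le> i + int (n - k)" "j - int k \<le> w j" using assms(3) by (auto simp: window_bounded_def)
    then have "j - i \<le> N" using i assms(1) by (simp add: of_nat_diff)
    then show "p \<in> (\<lambda>(i, d). (i, i + d)) ` ({1..N} \<times> {1..N})" using i ij by (intro image_eqI[of _ _ "(i, j - i)"]) auto
  qed
  then have "card (reps (Inv w)) \<le> card ((\<lambda>(i, d). (i, i + d)) ` ({1..N} \<times> {1..N}))" by (rule card_mono[rotated]) simp
  also have "\<dots> \<le> card ({1..N} \<times> {1..N})" by (rule card_image_le) simp
  finally show ?thesis unfolding len_pair_count pair_count_def by (simp add: card_cartesian_product)
qed

lemma rect_coeff_pos: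
  assumes k: "k \<le> n"
  shows "w \<in> P \<Longrightarrow> displ w = 0 \<Longrightarrow> window_bounded k w \<Longrightarrow> \<exists>m. m + len w = k * (n - k) \<and> rect_coeff k m w > 0"
proof (induction "n * n - len w" arbitrary: w rule: less_induct)
  case less
  note w = less.prems
  show ?case
  proof (cases "transl k w")
    case True
    then show ?thesis using transl_len[OF k w(1,2) True] rect_coeff_transl[OF k w(1,2) True] by (intro exI[of _ 0]) simp
  next
    case False
    obtain t0 where t0: "t0 \<in> covers w" "window_bounded k (w \<circ> rf t0)" using bounded_cover[OF k w(1,3) False] by blast
    have vt: "w \<circ> rf t \<in> P" "displ (w \<circ> rf t) = 0" "len (w \<circ> rf t) = len w + 1" "t \<in> refl_pairs" if "t \<in> covers w" for t
    proof -
      show t: "t \<in> refl_pairs" using that by (simp add: covers_def)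
      show "w \<circ> rf t \<in> P" using P_comp[OF w(1) refl_pairs_D(3)[OF t]] .
      show "displ (w \<circ> rf t) = 0" using displ_comp[OF w(1) refl_pairs_D(3)[OF t]] displ_refl[OF refl_pairs_D(2)[OF t]] w(2) by simp
      show "len (w \<circ> rf t) = len w + 1" using that by (simp add: covers_def)
    qed
    have IH: "\<exists>m. m + (len w + 1) = k * (n - k) \<and> rect_coeff k m (w \<circ> rf t) > 0" if t: "t \<in> covers w" "window_bounded k (w \<circ> rf t)" for t
    proof -
      have "len w + 1 \<le> n * n" using window_bounded_len[OF k vt(1)[OF t(1)] t(2)] vt(3)[OF t(1)] by simp
      then have "n * n - len (w \<circ> rf t) < n * n - len w" using vt(3)[OF t(1)] by linarith
      from less.hyps[OF this vt(1,2)[OF t(1)] t(2)] show ?thesis unfolding vt(3)[OF t(1)] .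
    qed
    obtain m where m: "m + (len w + 1) = k * (n - k)" "rect_coeff k m (w \<circ> rf t0) > 0" using IH[OF t0] by blast
    define \<chi> where "\<chi> x = (x - fst t0 - 1) div N" for x
    have \<chi>: "level_one \<chi>"
    proof -
      have "(x + N - fst t0 - 1) div N = (x - fst t0 - 1) div N + 1" for x
        using div_add_self2[of N "x - fst t0 - 1"] N_pos by (simp add: algebra_simps)
      then show ?thesis by (simp add: level_one_def \<chi>_def)
    qed
    have mono: "\<chi> x \<le> \<chi> y" if "x \<le> y" for x y unfolding \<chi>_def using that N_pos by (intro zdiv_mono1) auto
    have kp: "jump \<chi> t \<ge> 0" if "t \<in> covers w" for t
      unfolding jump_def using mono refl_pairs_D(1)[OF vt(4)[OF that]] by simp
    have kp0: "jump \<chi> t0 > 0"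
    proof -
      have "\<chi> (fst t0) = - 1" using N_pos by (simp add: \<chi>_def div_eq_minus1)
      moreover have "\<chi> (snd t0) \<ge> 0" unfolding \<chi>_def using refl_pairs_D(1)[OF vt(4)[OF t0(1)]] N_pos
        by (simp add: pos_imp_zdiv_nonneg_iff)
      ultimately show ?thesis by (simp add: jump_def)
    qed
    have nn: "rect_coeff k m (w \<circ> rf t) \<ge> 0" if t: "t \<in> covers w" for t
    proof (cases "window_bounded k (w \<circ> rf t)")
      case True
      then obtain m' where "m' + (len w + 1) = k * (n - k)" "rect_coeff k m' (w \<circ> rf t) > 0" using IH[OF t] by blast
      then show ?thesis using m(1) by (metis add_right_cancel less_imp_le)
    next
      case False
      have av0: "tau_pow (- av n (w \<circ> rf t)) \<circ> (w \<circ> rf t) = w \<circ> rf t"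
        using av_eqI[OF vt(1)[OF t], of 0] vt(2)[OF t] by (simp add: tau_pow_def fun_eq_iff)
      have "overflow n (affine_stanley_poly n k (w \<circ> rf t) * alternant k id)"
        by (rule unbounded_overflow[OF vt(1)[OF t] k]) (use False in \<open>unfold av0 window_bounded_def, blast\<close>)
      then show ?thesis using rect_coeff_overflow[OF k] by simp
    qed
    have "rect_coeff k (Suc m) w = (\<Sum>t\<in>covers w. jump \<chi> t * rect_coeff k m (w \<circ> rf t))" by (rule rect_coeff_Suc[OF k w(1,2) \<chi>])
    also have "\<dots> > 0"
      by (rule sum_pos2[OF finite_covers[OF w(1)] t0(1)]) (use kp0 m(2) kp nn in \<open>auto intro: mult_nonneg_nonneg\<close>)
    finally show ?thesis using m(1) by (intro exI[of _ "Suc m"]) simp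
  qed
qed

lemma displ_between:
  assumes h: "h \<in> P" and b: "\<And>i. i \<le> h i \<and> h i \<le> i + N"
  shows "displ h = int (card {i \<in> {1..N}. h i > N}) * N"
proof -
  define \<chi> where "\<chi> x = (x - 1) div N" for x
  have "\<chi> (x + N) = \<chi> x + 1" for x
    using div_add_self2[of N "x - 1"] N_pos by (simp add: \<chi>_def algebra_simps)
  then have "(\<Sum>i\<in>{1..N}. \<chi> (h i) - \<chi> i) * N = displ h" using sum_level_one[OF h, of \<chi>] by blast
  moreover have "(\<Sum>i\<in>{1..N}. \<chi> (h i) - \<chi> i) = (\<Sum>i\<in>{1..N}. if h i > N then 1 else 0)"
  proof (rule sum.cong[OF HOL.refl])
    fix i assume i: "i \<in> {1..N}"
    have "\<chi> i = 0" using i by (simp add: \<chi>_def)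
    moreover have "\<chi> (h i) = (if h i > N then 1 else 0)"
    proof (cases "h i > N")
      case True
      have "(h i - 1) div N = (h i - 1 - N + N) div N" by simp
      also have "\<dots> = (h i - 1 - N) div N + 1" using N_pos by (subst div_add_self2) auto
      also have "(h i - 1 - N) div N = 0" using True b[of i] i by (intro div_pos_pos_trivial) auto
      finally show ?thesis using True by (simp add: \<chi>_def)
    next
      case False
      have "(h i - 1) div N = 0" using False b[of i] i by (intro div_pos_pos_trivial) auto
      then show ?thesis using False by (simp add: \<chi>_def)
    qed
    ultimately show "\<chi> (h i) - \<chi> i = (if h i > N then 1 else 0)" by simp
  qed
  moreover have "(\<Sum>i\<in>{1..N}. if h i > N then 1 else 0) = int (card {i \<in> {1..N}. h i > N})"
    by (subst sum.inter_filter[symmetric]) auto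
  ultimately show ?thesis by simp
qed

lemma TBound_iff:
  assumes f: "f \<in> P" and k: "k \<le> n"
  shows "f \<in> TBound k n \<longleftrightarrow> window_bounded k (tau_pow (- av n f) \<circ> f)"
proof
  assume "f \<in> TBound k n"
  then obtain j h where fh: "f = tau_pow j \<circ> h" and hB: "h \<in> Bound k n" unfolding TBound_def by blast
  have h: "h \<in> P" "\<And>i. i \<le> h i \<and> h i \<le> i + N" "card {i \<in> {1..N}. h i > N} = k" using hB by (auto simp: Bound_def)
  have "displ h = int k * N" using displ_between[OF h(1,2)] h(3) by simp
  then have "displ f = (j + int k) * N" unfolding fh using displ_comp[OF P_tau h(1)] displ_tau by (simp add: distrib_right)
  then have "av n f = j + int k" by (rule av_eqI[OF f])
  then have "(tau_pow (- av n f) \<circ> f) x = h x - int k" for x by (simp add: fh tau_pow_def)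
  then show "window_bounded k (tau_pow (- av n f) \<circ> f)" unfolding window_bounded_def using h(2) k by (auto simp: of_nat_diff)
next
  define g where "g = tau_pow (- av n f) \<circ> f"
  assume "window_bounded k (tau_pow (- av n f) \<circ> f)"
  then have b: "window_bounded k g" by (simp add: g_def)
  obtain j where j: "displ f = j * N" using displ_dvd[OF f] by blast
  have av: "av n f = j" using av_eqI[OF f j] .
  have g: "g \<in> P" "displ g = 0" unfolding g_def using P_comp[OF P_tau f] displ_comp[OF P_tau f] displ_tau j av by auto
  define h where "h = tau_pow (int k) \<circ> g"
  have h: "h \<in> P" "displ h = int k * N" unfolding h_def using P_comp[OF P_tau g(1)] displ_comp[OF P_tau g(1)] displ_tau g(2) by auto
  have h_band: "i \<le> h i \<and> h i \<le> i + N" for i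
    using b[unfolded window_bounded_def, rule_format, of i] k by (auto simp: h_def tau_pow_def of_nat_diff)
  have "int (card {i \<in> {1..N}. h i > N}) * N = int k * N" using displ_between[OF h(1) h_band] unfolding h(2) by (rule sym)
  then have "card {i \<in> {1..N}. h i > N} = k" using N_pos by simp
  then have "h \<in> Bound k n" using h(1) h_band by (simp add: Bound_def)
  moreover have "f = tau_pow (av n f - int k) \<circ> h" by (simp add: h_def g_def tau_pow_def fun_eq_iff)
  ultimately show "f \<in> TBound k n" unfolding TBound_def by blast
qed

lemma stanley_poly_notin_ideal_iff:
  assumes f: "f \<in> P" and k: "k \<le> n"
  shows "affine_stanley_poly n k f \<notin> Lambda_ideal (n - k) k \<longleftrightarrow> f \<in> TBound k n"
proof -
  define g where "g = tau_pow (- av n f) \<circ> f"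
  obtain j where j: "displ f = j * N" using displ_dvd[OF f] by blast
  have av: "av n f = j" using av_eqI[OF f j] .
  have g: "g \<in> P" "displ g = 0" unfolding g_def using P_comp[OF P_tau f] displ_comp[OF P_tau f] displ_tau j av by auto
  have eq: "affine_stanley_poly n k f = affine_stanley_poly n k g"
    by (rule poly_mapping_eqI) (simp only: lookup_stanley_poly[OF f] lookup_stanley_poly0[OF g] g_def[symmetric])
  have I: "affine_stanley_poly n k f \<in> Lambda_ideal (n - k) k \<longleftrightarrow> overflow n (affine_stanley_poly n k f * alternant k id)"
    using Lambda_ideal_iff[OF k n_pos] stanley_poly_sym[OF f] by blast
  show ?thesis unfolding I TBound_iff[OF f k] g_def[symmetric]
  proof
    assume "\<not> overflow n (affine_stanley_poly n k f * alternant k id)"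
    then show "window_bounded k g" using unbounded_overflow[OF f k] unfolding window_bounded_def g_def by blast
  next
    assume "window_bounded k g"
    then obtain m where "rect_coeff k m g > 0" using rect_coeff_pos[OF k g] by blast
    then show "\<not> overflow n (affine_stanley_poly n k f * alternant k id)" unfolding eq using rect_coeff_overflow[OF k] by force
  qed
qed

end

theorem theorem2p23:
  fixes n k :: nat and f :: "int \<Rightarrow> int"
  assumes "0 < n" and "k \<le> n" and "f \<in> affine_perms n"
  shows "G_class n f k \<noteq> \<zero>\<^bsub>Lambda_ring (n - k) k\<^esub> \<longleftrightarrow> f \<in> TBound k n"
proof -
  interpret affine n by unfold_locales (rule assms(1))
  show ?thesis unfolding G_class_zero_iff using stanley_poly_notin_ideal_iff[OF assms(3,2)] .
qed

end
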